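(* For any $\alpha\in(0,1)$ and $\beta\in[1-\frac1\alpha,\infty)$, the operator $\mathbf{L}_{\alpha,\beta}$ is the generator, with core $\mathcal{A}$ (the algebra of polynomials), of a non-self-adjoint contraction Markov semigroup $P=(P_t)_{t\ge 0}$ in the Hilbert space $L^2(\mathbf{e}_{\alpha,\beta})$, where $$\mathbf{e}_{\alpha,\beta}(x)\,dx=\frac{x^{\beta+\frac1\alpha-1}e^{-x^{1/\alpha}}}{\alpha\,\Gamma(\alpha\beta+1)}\,dx,\qquad x>0,$$ is the unique invariant measure of $P$.
   Context: $\mathcal{A}$ is the algebra of polynomials. For $\alpha\in(0,1)$, $\beta\in[1-\frac1\alpha,\infty)$, the Gauss-Laguerre operator acts on smooth functions $f$ on $x>0$ by $$\mathbf{L}_{\alpha,\beta}f(x)=(d_{\alpha,\beta}-x)f'(x)+\frac{\sin(\alpha\pi)}{\pi}\,x\int_0^1 f''(xy)\,g_{\alpha,\beta}(y)\,dy,$$ where $d_{\alpha,\beta}=\frac{\Gamma(\alpha\beta+\alpha+1)}{\Gamma(\alpha\beta+1)}$ and $g_{\alpha,\beta}(y)=\frac{\Gamma(\alpha)}{\beta+\frac1\alpha+1}\,y^{\beta+\frac1\alpha+1}\,{}_2F_1\big(\alpha(\beta+1)+1,\alpha+1;\alpha(\beta+1)+2;y^{1/\alpha}\big)$, with ${}_2F_1$ the Gauss hypergeometric function. $L^2(\mathbf{e}_{\alpha,\beta})$ is the weighted Hilbert space of (classes of) measurable functions on $(0,\infty)$ with $\|f\|^2_{\mathbf{e}_{\alpha,\beta}}=\int_0^\infty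 f^2(x)\mathbf{e}_{\alpha,\beta}(x)\,dx<\infty$. An invariant measure of $P$ is a probability measure $\nu$ with $\int P_tf\,d\nu=\int f\,d\nu$ for all $t\ge0$ and all $f\in C_0([0,\infty))$ (continuous functions vanishing at infinity). *)

theory Defs
  imports "HOL-Analysis.Analysis" "HOL-Probability.Probability_Measure"
begin

text \<open>Elements of the real Hilbert space \<open>L\<^sup>2(M)\<close> are represented by square-integrable
  functions; they are compared almost everywhere. An operator on \<open>L\<^sup>2(M)\<close> is a map on
  functions that respects this equality; its values outside \<open>L2 M\<close> carry no meaning.\<close>

definition L2 :: "'a measure \<Rightarrow> ('a \<Rightarrow> real) set" where
  "L2 M = {f \<in> borel_measurable M. integrable M (\<lambda>x. (f x)\<^sup>2)}"

definition L2_inner :: "'a measure \<Rightarrow> ('a \<Rightarrow> real) \<Rightarrow> ('a \<Rightarrow> real) \<Rightarrow> real" where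
  "L2_inner M f g = (LINT x|M. f x * g x)"

definition L2_norm :: "'a measure \<Rightarrow> ('a \<Rightarrow> real) \<Rightarrow> real" where
  "L2_norm M f = sqrt (LINT x|M. (f x)\<^sup>2)"

definition L2_linear_operator ::
  "'a measure \<Rightarrow> (('a \<Rightarrow> real) \<Rightarrow> ('a \<Rightarrow> real)) \<Rightarrow> bool" where
  "L2_linear_operator M T \<longleftrightarrow>
     (\<forall>f\<in>L2 M. T f \<in> L2 M) \<and>
     (\<forall>f\<in>L2 M. \<forall>g\<in>L2 M. (AE x in M. f x = g x) \<longrightarrow> (AE x in M. T f x = T g x)) \<and>
     (\<forall>f\<in>L2 M. \<forall>g\<in>L2 M. \<forall>a b. AE x in M. T (\<lambda>y. a * f y + b * g y) x = a * T f x + b * T g x)"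

text \<open>Strongly continuous one-parameter semigroups of contractions on \<open>L\<^sup>2(M)\<close>; only times
  \<open>t \<ge> 0\<close> matter.\<close>

definition L2_contraction_semigroup ::
  "'a measure \<Rightarrow> (real \<Rightarrow> ('a \<Rightarrow> real) \<Rightarrow> ('a \<Rightarrow> real)) \<Rightarrow> bool" where
  "L2_contraction_semigroup M P \<longleftrightarrow>
     (\<forall>t\<ge>0. L2_linear_operator M (P t)) \<and>
     (\<forall>f\<in>L2 M. AE x in M. P 0 f x = f x) \<and>
     (\<forall>s\<ge>0. \<forall>t\<ge>0. \<forall>f\<in>L2 M. AE x in M. P (s + t) f x = P s (P t f) x) \<and>
     (\<forall>t\<ge>0. \<forall>f\<in>L2 M. L2_norm M (P t f) \<le> L2_norm M f) \<and>
     (\<forall>f\<in>L2 M. ((\<lambda>t. L2_norm M (\<lambda>x. P t f x - f x)) \<longlongrightarrow> 0) (at_right 0))"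

definition L2_markov ::
  "'a measure \<Rightarrow> (real \<Rightarrow> ('a \<Rightarrow> real) \<Rightarrow> ('a \<Rightarrow> real)) \<Rightarrow> bool" where
  "L2_markov M P \<longleftrightarrow>
     (\<forall>t\<ge>0. \<forall>f\<in>L2 M. (AE x in M. 0 \<le> f x) \<longrightarrow> (AE x in M. 0 \<le> P t f x)) \<and>
     (\<forall>t\<ge>0. AE x in M. P t (\<lambda>_. 1) x = 1)"

definition L2_self_adjoint_semigroup ::
  "'a measure \<Rightarrow> (real \<Rightarrow> ('a \<Rightarrow> real) \<Rightarrow> ('a \<Rightarrow> real)) \<Rightarrow> bool" where
  "L2_self_adjoint_semigroup M P \<longleftrightarrow>
     (\<forall>t\<ge>0. \<forall>f\<in>L2 M. \<forall>g\<in>L2 M. L2_inner M (P t f) g = L2_inner M f (P t g))"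

text \<open>The graph of the infinitesimal generator: \<open>f\<close> lies in its domain and is mapped to \<open>h\<close>.\<close>

definition L2_generator_graph ::
  "'a measure \<Rightarrow> (real \<Rightarrow> ('a \<Rightarrow> real) \<Rightarrow> ('a \<Rightarrow> real)) \<Rightarrow> ('a \<Rightarrow> real) \<Rightarrow> ('a \<Rightarrow> real) \<Rightarrow> bool"
where
  "L2_generator_graph M P f h \<longleftrightarrow>
     f \<in> L2 M \<and> h \<in> L2 M \<and>
     ((\<lambda>t. L2_norm M (\<lambda>x. (P t f x - f x) / t - h x)) \<longlongrightarrow> 0) (at_right 0)"

text \<open>The generator agrees with \<open>A\<close> on \<open>D\<close>, and \<open>D\<close> is dense in the domain of the generator
  for the graph norm; that is, the generator is the closure of \<open>A\<close> restricted to \<open>D\<close>.\<close>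

definition L2_generator_with_core ::
  "'a measure \<Rightarrow> (real \<Rightarrow> ('a \<Rightarrow> real) \<Rightarrow> ('a \<Rightarrow> real)) \<Rightarrow>
   (('a \<Rightarrow> real) \<Rightarrow> ('a \<Rightarrow> real)) \<Rightarrow> ('a \<Rightarrow> real) set \<Rightarrow> bool" where
  "L2_generator_with_core M P A D \<longleftrightarrow>
     (\<forall>p\<in>D. L2_generator_graph M P p (A p)) \<and>
     (\<forall>f h. L2_generator_graph M P f h \<longrightarrow>
        (\<forall>\<epsilon>>0. \<exists>p\<in>D. L2_norm M (\<lambda>x. f x - p x) < \<epsilon> \<and> L2_norm M (\<lambda>x. h x - A p x) < \<epsilon>))"

text \<open>\<open>C\<^sub>0([0,\<infinity>))\<close>; the values on the negative half-line are ignored.\<close>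

definition C0_half_line :: "(real \<Rightarrow> real) set" where
  "C0_half_line = {f. continuous_on {0..} f \<and> (f \<longlongrightarrow> 0) at_top}"

definition preserves_C0 :: "(real \<Rightarrow> (real \<Rightarrow> real) \<Rightarrow> (real \<Rightarrow> real)) \<Rightarrow> bool" where
  "preserves_C0 P \<longleftrightarrow> (\<forall>t\<ge>0. \<forall>f\<in>C0_half_line. P t f \<in> C0_half_line)"

text \<open>Since \<open>\<nu>\<close> may be singular, the integral of \<open>P t f\<close> below depends on the function \<open>P t f\<close> and
  not just on its almost-everywhere class. The notion is to be used together with \<open>preserves_C0\<close>:
  on a reference measure of full support the representative in \<open>C0_half_line\<close> is unique.\<close>

definition invariant_measure ::
  "(real \<Rightarrow> (real \<Rightarrow> real) \<Rightarrow> (real \<Rightarrow> real)) \<Rightarrow> real measure \<Rightarrow> bool" where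
  "invariant_measure P \<nu> \<longleftrightarrow>
     prob_space \<nu> \<and> sets \<nu> = sets (restrict_space borel {0..}) \<and>
     (\<forall>t\<ge>0. \<forall>f\<in>C0_half_line. (LINT x|\<nu>. P t f x) = (LINT x|\<nu>. f x))"

definition hypergeometric_2F1 :: "real \<Rightarrow> real \<Rightarrow> real \<Rightarrow> real \<Rightarrow> real" where
  "hypergeometric_2F1 a b c z = eval_fps (fps_hypergeo [a, b] [c] 1) z"

definition gl_drift :: "real \<Rightarrow> real \<Rightarrow> real" where
  "gl_drift \<alpha> \<beta> = Gamma (\<alpha> * \<beta> + \<alpha> + 1) / Gamma (\<alpha> * \<beta> + 1)"

definition gl_kernel :: "real \<Rightarrow> real \<Rightarrow> real \<Rightarrow> real" where
  "gl_kernel \<alpha> \<beta> y =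
     Gamma \<alpha> / (\<beta> + 1 / \<alpha> + 1) * y powr (\<beta> + 1 / \<alpha> + 1) *
     hypergeometric_2F1 (\<alpha> * (\<beta> + 1) + 1) (\<alpha> + 1) (\<alpha> * (\<beta> + 1) + 2) (y powr (1 / \<alpha>))"

definition gauss_laguerre :: "real \<Rightarrow> real \<Rightarrow> (real \<Rightarrow> real) \<Rightarrow> real \<Rightarrow> real" where
  "gauss_laguerre \<alpha> \<beta> f x =
     (gl_drift \<alpha> \<beta> - x) * deriv f x +
     sin (\<alpha> * pi) / pi * x * (LINT y:{0<..<1}|lborel. deriv (deriv f) (x * y) * gl_kernel \<alpha> \<beta> y)"

definition gl_density :: "real \<Rightarrow> real \<Rightarrow> real \<Rightarrow> real" where
  "gl_density \<alpha> \<beta> x =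
     x powr (\<beta> + 1 / \<alpha> - 1) * exp (- (x powr (1 / \<alpha>))) / (\<alpha> * Gamma (\<alpha> * \<beta> + 1))"

text \<open>The measure lives on \<open>[0,\<infinity>)\<close>, the state space in \<open>C0_half_line\<close>; it does not charge \<open>0\<close>,
  so its \<open>L\<^sup>2\<close> space is that over \<open>(0,\<infinity>)\<close>.\<close>

definition gl_measure :: "real \<Rightarrow> real \<Rightarrow> real measure" where
  "gl_measure \<alpha> \<beta> =
     density (restrict_space lborel {0..}) (\<lambda>x. ennreal (gl_density \<alpha> \<beta> x))"

definition polynomial_functions :: "(real \<Rightarrow> real) set" where
  "polynomial_functions = range poly"

end

theory Submission
  imports Defs "HOL-Probability.Probability" "HOL-Real_Asymp.Real_Asymp"
begin

text \<open>Put \<open>b = \<alpha>\<beta> + 1\<close>; the hypothesis on \<open>\<beta>\<close> says \<open>b \<ge> \<alpha>\<close>.  The measure \<open>\<nu>\<close> with density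
  \<open>gl_density\<close> is the law of the \<open>\<alpha>\<close>-th power of a Gamma(\<open>b\<close>) variable, so its moments are
  \<open>moment n = \<Gamma>(\<alpha>n + b) / \<Gamma>(b)\<close>; let \<open>\<phi>(n) = moment n / moment (n - 1)\<close>.  Expanding the
  hypergeometric kernel in powers shows that the Gauss-Laguerre operator sends \<open>x\<^sup>n\<close> to
  \<open>n \<phi>(n) x\<^sup>n\<^sup>-\<^sup>1 - n x\<^sup>n\<close> (\<open>gauss_laguerre_poly\<close>).  For the normalised monomials
  \<open>v\<^sub>n = x\<^sup>n / moment n\<close> this becomes \<open>n (v\<^sub>n\<^sub>-\<^sub>1 - v\<^sub>n)\<close>, in which \<open>\<phi>\<close> has disappeared: the linear map
  \<open>\<Lambda>\<close> with \<open>\<Lambda> y\<^sup>n = v\<^sub>n\<close> intertwines the operator with \<open>q \<mapsto> (1 - y) q'\<close>, the generator of the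
  deterministic flow \<open>y \<mapsto> 1 - e + e y\<close>, \<open>e = exp (-t)\<close>.  On polynomials the semigroup is
  therefore composition with an affine map, conjugated by \<open>\<Lambda>\<close>.  The semigroup law, the surjectivity of
  \<open>1 - generator\<close> on polynomials and, because \<open>\<integral> \<Lambda> q d\<nu> = q(1)\<close> and \<open>1\<close> is a fixed point of
  the flow, the invariance of \<open>\<nu>\<close> are then elementary algebra.

  What the intertwining does not show is positivity.  It comes from the integral form of the
  operator, which satisfies the positive maximum principle (\<open>generator_nonneg_at_minimum\<close>); a
  parabolic minimum principle then shows that the semigroup preserves polynomials that are
  nonnegative on \<open>[0,\<infinity>)\<close> (\<open>transition_nonneg\<close>).  Applied to \<open>(p - c)\<^sup>2\<close> this gives
  \<open>(P t p)\<^sup>2 \<le> P t (p\<^sup>2)\<close>, and integration against the invariant \<open>\<nu>\<close> gives contractivity in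
  \<open>L\<^sup>2(\<nu>)\<close>.

  Since \<open>\<alpha> < 1\<close>, all exponentials \<open>exp (K x)\<close> are \<open>\<nu>\<close>-integrable, so the Taylor polynomials of
  \<open>exp (- k x)\<close> converge in \<open>L\<^sup>2(\<nu>)\<close>.  With the Weierstrass theorem in the variable
  \<open>exp (- x)\<close> it follows that polynomials are dense in \<open>L\<^sup>2(\<nu>)\<close>, and squares of polynomials dense
  among the nonnegative functions (\<open>polynomials_dense\<close>, \<open>L2_nonneg_square_approx\<close>).  The semigroup
  thus extends to a Markov contraction semigroup; dissipativity together with the surjectivity of
  \<open>1 - generator\<close> on polynomials makes the polynomials a core.

  The operator is not symmetric, since \<open>\<langle>P t v\<^sub>1, v\<^sub>2\<rangle> - \<langle>v\<^sub>1, P t v\<^sub>2\<rangle>\<close> is a multiple of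
  \<open>\<phi>(1) + \<phi>(3) - 2 \<phi>(2)\<close> and \<open>\<phi>\<close> is strictly concave.  On \<open>C\<^sub>0([0,\<infinity>))\<close> positivity gives a
  contraction in the supremum norm, so it suffices to treat \<open>exp (- k x)\<close> for \<open>k \<ge> 1\<close>: its image
  is a locally uniformly convergent series, hence continuous, and vanishes at infinity by
  Chebyshev's inequality.  As \<open>t \<rightarrow> \<infinity>\<close> the same series converges to a constant, which
  determines the integrals of all \<open>exp (- k x)\<close> against any invariant measure, hence the measure.\<close>

section \<open>The space \<open>L\<^sup>2(M)\<close>\<close>

lemma L2_measurable: "f \<in> L2 M \<Longrightarrow> f \<in> borel_measurable M"
  and L2_square_integrable: "f \<in> L2 M \<Longrightarrow> integrable M (\<lambda>x. (f x)\<^sup>2)"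
  by (auto simp: L2_def)

lemma L2_mult_integrable:
  assumes "f \<in> L2 M" "g \<in> L2 M"
  shows "integrable M (\<lambda>x. f x * g x)"
proof (rule Bochner_Integration.integrable_bound)
  show "integrable M (\<lambda>x. (f x)\<^sup>2 + (g x)\<^sup>2)"
    using assms by (auto dest: L2_square_integrable)
  show "(\<lambda>x. f x * g x) \<in> borel_measurable M"
    using assms[THEN L2_measurable] by measurable
  have "\<bar>f x * g x\<bar> \<le> (f x)\<^sup>2 + (g x)\<^sup>2" for x
  proof -
    have "0 \<le> (\<bar>f x\<bar> - \<bar>g x\<bar>)\<^sup>2" by simp
    then have "2 * (\<bar>f x\<bar> * \<bar>g x\<bar>) \<le> (f x)\<^sup>2 + (g x)\<^sup>2"
      by (simp add: power2_diff)
    moreover have "0 \<le> \<bar>f x\<bar> * \<bar>g x\<bar>" by simp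
    ultimately show ?thesis unfolding abs_mult by linarith
  qed
  then show "AE x in M. norm (f x * g x) \<le> norm ((f x)\<^sup>2 + (g x)\<^sup>2)"
    by (intro AE_I2) (simp add: abs_le_iff)
qed

lemma L2_lincomb:
  assumes "f \<in> L2 M" "g \<in> L2 M"
  shows "(\<lambda>x. a * f x + b * g x) \<in> L2 M"
proof -
  have "integrable M (\<lambda>x. a\<^sup>2 * (f x)\<^sup>2 + 2 * a * b * (f x * g x) + b\<^sup>2 * (g x)\<^sup>2)"
    using assms[THEN L2_square_integrable] L2_mult_integrable[OF assms]
    by (intro Bochner_Integration.integrable_add integrable_mult_right)
  moreover have "(\<lambda>x. (a * f x + b * g x)\<^sup>2)
    = (\<lambda>x. a\<^sup>2 * (f x)\<^sup>2 + 2 * a * b * (f x * g x) + b\<^sup>2 * (g x)\<^sup>2)"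
    by (auto simp: power2_eq_square algebra_simps)
  ultimately show ?thesis
    using assms[THEN L2_measurable] by (auto simp: L2_def)
qed

lemma L2_add: "f \<in> L2 M \<Longrightarrow> g \<in> L2 M \<Longrightarrow> (\<lambda>x. f x + g x) \<in> L2 M"
  using L2_lincomb[of f M g 1 1] by simp

lemma L2_diff: "f \<in> L2 M \<Longrightarrow> g \<in> L2 M \<Longrightarrow> (\<lambda>x. f x - g x) \<in> L2 M"
  using L2_lincomb[of f M g 1 "-1"] by simp

lemma L2_cmult: "f \<in> L2 M \<Longrightarrow> (\<lambda>x. c * f x) \<in> L2 M"
  using L2_lincomb[of f M f c 0] by simp

lemma L2_zero: "(\<lambda>x. 0) \<in> L2 M"
  by (simp add: L2_def)

lemma L2_sum: "(\<And>i. i \<in> I \<Longrightarrow> f i \<in> L2 M) \<Longrightarrow> (\<lambda>x. \<Sum>i\<in>I. f i x) \<in> L2 M"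
  by (induction I rule: infinite_finite_induct) (auto intro: L2_add L2_zero)

lemma L2_norm_nonneg: "0 \<le> L2_norm M f"
  by (simp add: L2_norm_def)

abbreviation L2_dist :: "'a measure \<Rightarrow> ('a \<Rightarrow> real) \<Rightarrow> ('a \<Rightarrow> real) \<Rightarrow> real" where
  "L2_dist M f g \<equiv> L2_norm M (\<lambda>x. f x - g x)"

lemma L2_norm_power2: "(L2_norm M f)\<^sup>2 = (LINT x|M. (f x)\<^sup>2)"
  by (simp add: L2_norm_def)

lemma L2_norm_cmult: "L2_norm M (\<lambda>x. c * f x) = \<bar>c\<bar> * L2_norm M f"
  by (simp add: L2_norm_def power_mult_distrib real_sqrt_mult)

lemma L2_dist_commute: "L2_dist M f g = L2_dist M g f"
  by (simp add: L2_norm_def power2_commute)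

lemma L2_norm_cong_AE:
  assumes "AE x in M. f x = g x" "f \<in> borel_measurable M" "g \<in> borel_measurable M"
  shows "L2_norm M f = L2_norm M g"
  unfolding L2_norm_def
  by (rule arg_cong[of _ _ sqrt], rule integral_cong_AE) (use assms in auto)

lemma L2_norm_eq_0_AE:
  assumes "f \<in> L2 M" "L2_norm M f = 0"
  shows "AE x in M. f x = 0"
proof -
  have "(LINT x|M. (f x)\<^sup>2) = 0"
    using assms by (simp add: L2_norm_def)
  then have "AE x in M. (f x)\<^sup>2 = 0"
    using integral_nonneg_eq_0_iff_AE[OF L2_square_integrable[OF assms(1)]] by auto
  then show ?thesis by simp
qed

lemma L2_Cauchy_Schwarz:
  assumes f: "f \<in> L2 M" and g: "g \<in> L2 M"
  shows "\<bar>LINT x|M. f x * g x\<bar> \<le> L2_norm M f * L2_norm M g"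
proof -
  let ?A = "L2_norm M f" and ?B = "L2_norm M g" and ?I = "LINT x|M. f x * g x"
  have expand: "0 \<le> s\<^sup>2 * ?A\<^sup>2 - 2 * s * t * ?I + t\<^sup>2 * ?B\<^sup>2" for s t
  proof -
    have "0 \<le> (LINT x|M. (s * f x - t * g x)\<^sup>2)" by simp
    also have "(LINT x|M. (s * f x - t * g x)\<^sup>2)
      = (LINT x|M. s\<^sup>2 * (f x)\<^sup>2 - 2 * s * t * (f x * g x) + t\<^sup>2 * (g x)\<^sup>2)"
      by (intro Bochner_Integration.integral_cong) (auto simp: power2_eq_square algebra_simps)
    also have "\<dots> = s\<^sup>2 * ?A\<^sup>2 - 2 * s * t * ?I + t\<^sup>2 * ?B\<^sup>2"
      using f g L2_mult_integrable[OF f g] by (simp add: L2_norm_power2 L2_square_integrable)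
    finally show ?thesis .
  qed
  have zero: "?I = 0" if "?A = 0 \<or> ?B = 0"
  proof -
    from that have "AE x in M. f x * g x = 0"
      using L2_norm_eq_0_AE[OF f] L2_norm_eq_0_AE[OF g] by auto
    then show ?thesis by (rule integral_eq_zero_AE)
  qed
  show ?thesis
  proof (cases "?A = 0 \<or> ?B = 0")
    case True
    then show ?thesis using zero by auto
  next
    case False
    then have pos: "?A > 0" "?B > 0"
      using L2_norm_nonneg[of M f] L2_norm_nonneg[of M g] by auto
    then have "2 * ?I / (?A * ?B) \<le> 2" "0 \<le> 2 + 2 * ?I / (?A * ?B)"
      using expand[of "1 / ?A" "1 / ?B"] expand[of "1 / ?A" "- 1 / ?B"]
      by (simp_all add: power_divide)
    then have "?I / (?A * ?B) \<le> 1" "- ?I / (?A * ?B) \<le> 1"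
      unfolding times_divide_eq_right[symmetric] by simp_all
    then have "?I \<le> ?A * ?B" "- ?I \<le> ?A * ?B"
      using pos by (simp_all only: divide_le_eq_1_pos mult_pos_pos)
    then show ?thesis by (simp add: abs_le_iff)
  qed
qed

lemma L2_norm_triangle:
  assumes f: "f \<in> L2 M" and g: "g \<in> L2 M"
  shows "L2_norm M (\<lambda>x. f x + g x) \<le> L2_norm M f + L2_norm M g"
proof (rule power2_le_imp_le)
  have "(L2_norm M (\<lambda>x. f x + g x))\<^sup>2
    = (LINT x|M. (f x)\<^sup>2 + 2 * (f x * g x) + (g x)\<^sup>2)"
    unfolding L2_norm_power2
    by (intro Bochner_Integration.integral_cong) (auto simp: power2_eq_square algebra_simps)
  also have "\<dots> = (L2_norm M f)\<^sup>2 + 2 * (LINT x|M. f x * g x) + (L2_norm M g)\<^sup>2"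
    using f g L2_mult_integrable[OF f g] by (simp add: L2_norm_power2 L2_square_integrable)
  also have "\<dots> \<le> (L2_norm M f + L2_norm M g)\<^sup>2"
    using L2_Cauchy_Schwarz[OF f g] by (simp add: power2_sum)
  finally show "(L2_norm M (\<lambda>x. f x + g x))\<^sup>2 \<le> (L2_norm M f + L2_norm M g)\<^sup>2" .
qed (simp add: L2_norm_nonneg)

lemma L2_norm_lincomb_le:
  assumes "f \<in> L2 M" "g \<in> L2 M"
  shows "L2_norm M (\<lambda>x. a * f x + b * g x) \<le> \<bar>a\<bar> * L2_norm M f + \<bar>b\<bar> * L2_norm M g"
  using L2_norm_triangle[OF L2_cmult[OF assms(1)] L2_cmult[OF assms(2)]] by (simp only: L2_norm_cmult)

lemma L2_norm_diff_triangle: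
  assumes "f \<in> L2 M" "g \<in> L2 M" "h \<in> L2 M"
  shows "L2_dist M f h \<le> L2_dist M f g + L2_dist M g h"
  using L2_norm_triangle[OF L2_diff[OF assms(1,2)] L2_diff[OF assms(2,3)]] by simp

lemma L2_norm_sum_le:
  assumes "\<And>i. i \<in> I \<Longrightarrow> f i \<in> L2 M"
  shows "L2_norm M (\<lambda>x. \<Sum>i\<in>I. f i x) \<le> (\<Sum>i\<in>I. L2_norm M (f i))"
  using assms
proof (induction I rule: infinite_finite_induct)
  case (insert i I)
  have "L2_norm M (\<lambda>x. f i x + (\<Sum>i\<in>I. f i x)) \<le> L2_norm M (f i) + L2_norm M (\<lambda>x. \<Sum>i\<in>I. f i x)"
    using insert by (intro L2_norm_triangle L2_sum) auto
  with insert show ?case by auto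
qed (auto simp: L2_norm_def)

lemma L2_norm_mono_AE:
  assumes "g \<in> L2 M" "f \<in> borel_measurable M" "AE x in M. \<bar>f x\<bar> \<le> \<bar>g x\<bar>"
  shows "f \<in> L2 M" "L2_norm M f \<le> L2_norm M g"
proof -
  have sq: "AE x in M. (f x)\<^sup>2 \<le> (g x)\<^sup>2"
    using assms(3) by eventually_elim (simp add: abs_le_square_iff)
  have int: "integrable M (\<lambda>x. (f x)\<^sup>2)"
    by (rule Bochner_Integration.integrable_bound[OF L2_square_integrable[OF assms(1)]])
       (use sq assms(2) in auto)
  then show "f \<in> L2 M"
    using assms(2) by (simp add: L2_def)
  show "L2_norm M f \<le> L2_norm M g"
    unfolding L2_norm_def
    by (intro real_sqrt_le_mono integral_mono_AE int sq L2_square_integrable[OF assms(1)])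
qed

text \<open>Lower semicontinuity of the norm under almost everywhere convergence.\<close>

lemma L2_Fatou:
  assumes f: "\<And>n. f n \<in> L2 M" and g: "g \<in> borel_measurable M"
    and lim: "AE x in M. (\<lambda>n. f n x) \<longlonglongrightarrow> g x"
    and bound: "\<And>n. L2_norm M (f n) \<le> c n" and c: "c \<longlonglongrightarrow> C"
  shows "g \<in> L2 M" "L2_norm M g \<le> C"
proof -
  have fm[measurable]: "\<And>n. f n \<in> borel_measurable M" using f L2_measurable by blast
  have c0: "0 \<le> c n" for n using bound[of n] L2_norm_nonneg[of M "f n"] by linarith
  have C0: "0 \<le> C" by (rule LIMSEQ_le_const[OF c]) (use c0 in auto)
  have "(\<integral>\<^sup>+x. ennreal ((g x)\<^sup>2) \<partial>M) = (\<integral>\<^sup>+x. liminf (\<lambda>n. ennreal ((f n x)\<^sup>2)) \<partial>M)"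
  proof (rule nn_integral_cong_AE, use lim in eventually_elim)
    case (elim x)
    then have "(\<lambda>n. ennreal ((f n x)\<^sup>2)) \<longlonglongrightarrow> ennreal ((g x)\<^sup>2)"
      by (intro tendsto_ennrealI tendsto_intros)
    then have "liminf (\<lambda>n. ennreal ((f n x)\<^sup>2)) = ennreal ((g x)\<^sup>2)"
      by (intro lim_imp_Liminf) auto
    then show ?case by simp
  qed
  also have "\<dots> \<le> liminf (\<lambda>n. \<integral>\<^sup>+x. ennreal ((f n x)\<^sup>2) \<partial>M)"
    by (rule nn_integral_liminf) measurable
  also have "\<dots> \<le> liminf (\<lambda>n. ennreal ((c n)\<^sup>2))"
  proof (rule Liminf_mono, rule always_eventually, rule allI)
    fix n
    have "(\<integral>\<^sup>+x. ennreal ((f n x)\<^sup>2) \<partial>M) = ennreal ((L2_norm M (f n))\<^sup>2)"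
      unfolding L2_norm_power2 using L2_square_integrable[OF f] by (intro nn_integral_eq_integral) auto
    also have "\<dots> \<le> ennreal ((c n)\<^sup>2)"
      using bound[of n] L2_norm_nonneg[of M "f n"] by (intro ennreal_leI power_mono) auto
    finally show "(\<integral>\<^sup>+x. ennreal ((f n x)\<^sup>2) \<partial>M) \<le> ennreal ((c n)\<^sup>2)" .
  qed
  also have "\<dots> = ennreal (C\<^sup>2)"
  proof -
    have "(\<lambda>n. ennreal ((c n)\<^sup>2)) \<longlonglongrightarrow> ennreal (C\<^sup>2)"
      by (intro tendsto_ennrealI tendsto_intros c)
    then show ?thesis by (intro lim_imp_Liminf) auto
  qed
  finally have le: "(\<integral>\<^sup>+x. ennreal ((g x)\<^sup>2) \<partial>M) \<le> ennreal (C\<^sup>2)" .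
  then have int: "integrable M (\<lambda>x. (g x)\<^sup>2)"
    using g by (intro integrableI_nonneg) (auto intro: le_less_trans)
  then show "g \<in> L2 M" using g by (simp add: L2_def)
  have "(LINT x|M. (g x)\<^sup>2) \<le> C\<^sup>2"
    using le nn_integral_eq_integral[OF int] by simp
  then show "L2_norm M g \<le> C"
    unfolding L2_norm_def using C0 by (simp add: real_le_lsqrt)
qed

lemma L2_dominated_convergence:
  assumes f: "\<And>n. f n \<in> borel_measurable M" and g: "g \<in> borel_measurable M" and h: "h \<in> L2 M"
    and lim: "AE x in M. (\<lambda>n. f n x) \<longlonglongrightarrow> g x"
    and bound: "\<And>n. AE x in M. \<bar>f n x\<bar> \<le> h x"
  shows "f n \<in> L2 M" "g \<in> L2 M" "(\<lambda>n. L2_dist M (f n) g) \<longlonglongrightarrow> 0"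
proof -
  show fL: "f n \<in> L2 M" for n
    by (rule L2_norm_mono_AE(1)[OF h f]) (use bound[of n] in \<open>eventually_elim, simp\<close>)
  have "AE x in M. \<forall>n. \<bar>f n x\<bar> \<le> h x" using bound by (simp add: AE_all_countable)
  with lim have gb: "AE x in M. \<bar>g x\<bar> \<le> h x"
  proof eventually_elim
    case (elim x)
    have "(\<lambda>n. \<bar>f n x\<bar>) \<longlonglongrightarrow> \<bar>g x\<bar>" using elim by (intro tendsto_intros) auto
    then show ?case by (rule LIMSEQ_le_const2) (use elim in auto)
  qed
  show "g \<in> L2 M"
    by (rule L2_norm_mono_AE(1)[OF h g]) (use gb in \<open>eventually_elim, simp\<close>)
  have [measurable]: "\<And>n. f n \<in> borel_measurable M" "g \<in> borel_measurable M" using f g by auto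
  have "(\<lambda>n. LINT x|M. (f n x - g x)\<^sup>2) \<longlonglongrightarrow> (LINT x|M. 0)"
  proof (rule integral_dominated_convergence[where w="\<lambda>x. 4 * (h x)\<^sup>2"])
    show "integrable M (\<lambda>x. 4 * (h x)\<^sup>2)" using L2_square_integrable[OF h] by simp
    show "AE x in M. (\<lambda>n. (f n x - g x)\<^sup>2) \<longlonglongrightarrow> 0"
      using lim
    proof eventually_elim
      case (elim x)
      then have "(\<lambda>n. (f n x - g x)\<^sup>2) \<longlonglongrightarrow> (g x - g x)\<^sup>2" by (intro tendsto_intros)
      then show ?case by simp
    qed
    fix n
    show "AE x in M. norm ((f n x - g x)\<^sup>2) \<le> 4 * (h x)\<^sup>2"
      using bound[of n] gb
    proof eventually_elim
      case (elim x)
      then have "\<bar>f n x - g x\<bar> \<le> \<bar>2 * h x\<bar>" by linarith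
      then have "(f n x - g x)\<^sup>2 \<le> (2 * h x)\<^sup>2" by (simp only: abs_le_square_iff)
      then show ?case by (simp add: power_mult_distrib)
    qed
  qed auto
  then have "(\<lambda>n. sqrt (LINT x|M. (f n x - g x)\<^sup>2)) \<longlonglongrightarrow> sqrt 0"
    by (intro tendsto_real_sqrt) simp
  then show "(\<lambda>n. L2_dist M (f n) g) \<longlonglongrightarrow> 0"
    by (simp add: L2_norm_def)
qed

lemma (in prob_space) L2_const: "(\<lambda>x. c) \<in> L2 M"
  by (simp add: L2_def)

lemma (in prob_space) L2_norm_const: "L2_norm M (\<lambda>x. c) = \<bar>c\<bar>"
  by (simp add: L2_norm_def prob_space)

lemma (in prob_space) L2_integrable: "f \<in> L2 M \<Longrightarrow> integrable M f"
  by (simp add: L2_def square_integrable_imp_integrable)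

lemma (in prob_space) L2_abs_integral_le_norm:
  assumes "f \<in> L2 M"
  shows "\<bar>LINT x|M. f x\<bar> \<le> L2_norm M f"
  using L2_Cauchy_Schwarz[OF assms L2_const[of 1]] by (simp add: L2_norm_const)

lemma (in prob_space) L2_integral_abs_le_norm:
  assumes "f \<in> L2 M"
  shows "(LINT x|M. \<bar>f x\<bar>) \<le> L2_norm M f"
proof -
  have "(\<lambda>x. \<bar>f x\<bar>) \<in> L2 M"
    using assms by (auto simp: L2_def)
  from L2_abs_integral_le_norm[OF this] show ?thesis
    by (simp add: L2_norm_def)
qed

text \<open>Completeness of \<open>L\<^sup>2\<close> enters only here, in the form in which it is used: a contraction on a
  subset extends to its closure.  Along a sequence that converges geometrically fast the
  increments of the images are summable in \<open>L\<^sup>1\<close>, hence almost everywhere, and Fatou's lemma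
  transfers the contraction inequality to the pointwise limit.\<close>

lemma (in prob_space) L2_contraction_extends:
  fixes e T :: "'b \<Rightarrow> 'a \<Rightarrow> real"
  assumes e: "\<And>p. e p \<in> L2 M" and T: "\<And>p. T p \<in> L2 M"
    and contr: "\<And>p q. L2_dist M (T p) (T q) \<le> L2_dist M (e p) (e q)"
    and f: "f \<in> L2 M" and dense: "\<And>\<epsilon>. \<epsilon> > 0 \<Longrightarrow> \<exists>p. L2_dist M f (e p) < \<epsilon>"
  shows "\<exists>g\<in>L2 M. \<forall>p. L2_dist M g (T p) \<le> L2_dist M f (e p)"
proof -
  have "\<exists>p. \<forall>n. L2_dist M f (e (p n)) < (1/2)^n"
    using dense[of "(1/2)^n" for n] by (intro choice allI) auto
  then obtain p where p: "\<And>n. L2_dist M f (e (p n)) < (1/2)^n"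
    by blast
  define d where "d n x = T (p (Suc n)) x - T (p n) x" for n x
  have pL: "e (p n) \<in> L2 M" and TL: "T (p n) \<in> L2 M" for n using e T by auto
  have dL: "d n \<in> L2 M" for n unfolding d_def by (intro L2_diff TL)
  have dn: "L2_norm M (d n) \<le> 2 * (1/2)^n" for n
  proof -
    have "L2_norm M (d n) \<le> L2_dist M (e (p (Suc n))) (e (p n))"
      unfolding d_def by (rule contr)
    also have "\<dots> \<le> L2_dist M (e (p (Suc n))) f + L2_dist M f (e (p n))"
      by (rule L2_norm_diff_triangle[OF pL f pL])
    also have "L2_dist M (e (p (Suc n))) f = L2_dist M f (e (p (Suc n)))"
      by (rule L2_dist_commute)
    finally show ?thesis using p[of n] p[of "Suc n"] L2_norm_nonneg[of M "\<lambda>x. f x - e (p (Suc n)) x"]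
      unfolding power_Suc by linarith
  qed
  have dm[measurable]: "d n \<in> borel_measurable M" for n using dL L2_measurable by blast
  have "(\<integral>\<^sup>+x. (\<Sum>n. ennreal \<bar>d n x\<bar>) \<partial>M) = (\<Sum>n. \<integral>\<^sup>+x. ennreal \<bar>d n x\<bar> \<partial>M)"
    by (rule nn_integral_suminf) measurable
  also have "\<dots> \<le> (\<Sum>n. ennreal (2 * (1/2)^n))"
  proof (rule suminf_le)
    fix n
    have "(\<integral>\<^sup>+x. ennreal \<bar>d n x\<bar> \<partial>M) = ennreal (LINT x|M. \<bar>d n x\<bar>)"
      using L2_integrable[OF dL] by (intro nn_integral_eq_integral) auto
    also have "\<dots> \<le> ennreal (2 * (1/2)^n)"
      using L2_integral_abs_le_norm[OF dL, of n] dn[of n] by (intro ennreal_leI) linarith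
    finally show "(\<integral>\<^sup>+x. ennreal \<bar>d n x\<bar> \<partial>M) \<le> ennreal (2 * (1/2)^n)" .
  qed auto
  also have "\<dots> < \<infinity>"
    by (subst suminf_ennreal2) (auto intro: summable_mult)
  finally have "AE x in M. (\<Sum>n. ennreal \<bar>d n x\<bar>) \<noteq> \<infinity>"
    by (intro nn_integral_PInf_AE) auto
  then have summ: "AE x in M. convergent (\<lambda>n. T (p n) x)"
  proof eventually_elim
    case (elim x)
    then have "summable (\<lambda>n. \<bar>d n x\<bar>)"
      by (intro summable_suminf_not_top) auto
    then have "summable (\<lambda>n. d n x)" by (rule summable_rabs_cancel)
    then have "convergent (\<lambda>N. \<Sum>n<N. d n x)" by (simp add: summable_iff_convergent)
    moreover have "(\<Sum>n<N. d n x) = T (p N) x - T (p 0) x" for N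
      unfolding d_def by (rule sum_lessThan_telescope)
    ultimately have "convergent (\<lambda>N. (T (p N) x - T (p 0) x) + T (p 0) x)"
      by (intro convergent_add convergent_const) auto
    then show ?case by simp
  qed
  define g where "g x = lim (\<lambda>n. T (p n) x)" for x
  have [measurable]: "T (p n) \<in> borel_measurable M" for n using TL L2_measurable by blast
  have gm[measurable]: "g \<in> borel_measurable M" unfolding g_def by measurable
  have lim: "AE x in M. (\<lambda>n. T (p n) x) \<longlonglongrightarrow> g x"
    using summ by eventually_elim (simp add: g_def convergent_LIMSEQ_iff)
  have fp: "(\<lambda>n. L2_dist M f (e (p n))) \<longlonglongrightarrow> 0"
    by (rule tendsto_sandwich[OF _ _ tendsto_const LIMSEQ_power_zero[of "1/2::real"]])
       (auto intro!: always_eventually less_imp_le[OF p] simp: L2_norm_nonneg)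
  have close: "(\<lambda>x. g x - T q x) \<in> L2 M \<and> L2_dist M g (T q) \<le> L2_dist M f (e q)" for q
  proof -
    have [measurable]: "T q \<in> borel_measurable M" using T L2_measurable by blast
    have c: "(\<lambda>n. L2_dist M f (e (p n)) + L2_dist M f (e q))
      \<longlonglongrightarrow> 0 + L2_dist M f (e q)"
      by (intro tendsto_intros fp)
    have b: "L2_dist M (T (p n)) (T q)
      \<le> L2_dist M f (e (p n)) + L2_dist M f (e q)" for n
    proof -
      have "L2_dist M (T (p n)) (T q) \<le> L2_dist M (e (p n)) (e q)"
        by (rule contr)
      also have "\<dots> \<le> L2_dist M (e (p n)) f + L2_dist M f (e q)"
        by (intro L2_norm_diff_triangle pL f e)
      finally show ?thesis by (simp add: L2_dist_commute)
    qed
    have l: "AE x in M. (\<lambda>n. T (p n) x - T q x) \<longlonglongrightarrow> g x - T q x"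
      using lim by eventually_elim (intro tendsto_intros)
    have m: "(\<lambda>x. g x - T q x) \<in> borel_measurable M" by measurable
    have e': "(\<lambda>x. T (p n) x - T q x) \<in> L2 M" for n by (intro L2_diff TL T)
    show ?thesis
      using L2_Fatou[OF e' m l b c] by simp
  qed
  have "g \<in> L2 M"
    using L2_add[OF conjunct1[OF close[of "p 0"]] TL[of 0]] by simp
  with close show ?thesis by blast
qed

section \<open>The invariant measure and its moments\<close>

text \<open>Logarithmic convexity between \<open>z\<close> and \<open>z + 1\<close>, where \<open>\<Gamma>(z + 1) = z \<Gamma>(z)\<close>.\<close>

lemma Gamma_add_le_powr:
  fixes z a :: real
  assumes "0 < z" "0 < a" "a < 1"
  shows "Gamma (z + a) \<le> Gamma z * z powr a"
proof -
  have "(ln \<circ> Gamma) ((1 - a) *\<^sub>R z + a *\<^sub>R (z + 1)) \<le> (1 - a) * (ln \<circ> Gamma) z + a * (ln \<circ> Gamma) (z + 1)"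
    using assms by (intro convex_onD[OF log_convex_Gamma_real]) auto
  moreover have "(1 - a) *\<^sub>R z + a *\<^sub>R (z + 1) = z + a" by (simp add: algebra_simps)
  moreover have "Gamma (z + 1) = z * Gamma z" using assms by (intro Gamma_plus1) (auto elim!: nonpos_Ints_cases)
  ultimately have "ln (Gamma (z + a)) \<le> (1 - a) * ln (Gamma z) + a * (ln z + ln (Gamma z))"
    using assms Gamma_real_pos[OF assms(1)] by (simp add: ln_mult)
  also have "\<dots> = ln (Gamma z * z powr a)"
    using assms ln_mult_pos[OF Gamma_real_pos[OF assms(1)], of "z powr a"]
    by (simp add: ln_powr algebra_simps)
  finally show ?thesis
    using assms by (subst (asm) ln_le_cancel_iff) (auto intro!: mult_pos_pos Gamma_real_pos)
qed

locale gauss_laguerre_parameters =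
  fixes \<alpha> \<beta> :: real
  assumes \<alpha>_pos: "0 < \<alpha>" and \<alpha>_less_1: "\<alpha> < 1" and \<beta>_ge: "1 - 1 / \<alpha> \<le> \<beta>"
begin

text \<open>The parameter of the Gamma law behind \<open>\<nu>\<close>.\<close>

definition b :: real where "b = \<alpha> * \<beta> + 1"

definition moment :: "nat \<Rightarrow> real" where
  "moment n = Gamma (\<alpha> * real n + b) / Gamma b"

abbreviation \<nu> :: "real measure" where "\<nu> \<equiv> gl_measure \<alpha> \<beta>"

lemma b_ge: "\<alpha> \<le> b"
proof -
  have "\<alpha> * (1 - 1 / \<alpha>) \<le> \<alpha> * \<beta>"
    using \<alpha>_pos \<beta>_ge by (intro mult_left_mono) auto
  then show ?thesis using \<alpha>_pos by (simp add: b_def algebra_simps)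
qed

lemma b_pos: "0 < b"
  using b_ge \<alpha>_pos by linarith

lemma moment_arg_pos: "0 < \<alpha> * real n + b"
  using b_pos \<alpha>_pos by (intro add_nonneg_pos) auto

lemma moment_pos: "0 < moment n"
  using b_pos moment_arg_pos by (auto simp: moment_def intro!: divide_pos_pos Gamma_real_pos)

lemma moment_0: "moment 0 = 1"
  using Gamma_real_pos[OF b_pos] by (simp add: moment_def)

lemma moment_Suc_le: "moment (Suc n) \<le> moment n * (\<alpha> * real n + b) powr \<alpha>"
proof -
  have "Gamma (\<alpha> * real n + b + \<alpha>) \<le> Gamma (\<alpha> * real n + b) * (\<alpha> * real n + b) powr \<alpha>"
    using moment_arg_pos \<alpha>_pos \<alpha>_less_1 by (intro Gamma_add_le_powr)
  moreover have "\<alpha> * real n + b + \<alpha> = \<alpha> * real (Suc n) + b" by (simp add: algebra_simps)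
  ultimately show ?thesis
    using Gamma_real_pos[OF b_pos] by (simp add: moment_def divide_right_mono)
qed

text \<open>The moments grow like \<open>(n!)\<^sup>\<alpha>\<close>; since \<open>\<alpha> < 1\<close>, the exponential moment series has infinite
  radius of convergence.\<close>

lemma summable_moment_exp: "summable (\<lambda>n. moment n * K ^ n / fact n)"
proof (cases "K = 0")
  case True
  then show ?thesis by (intro summable_finite[of "{0}"]) auto
next
  case False
  have lim: "(\<lambda>n. \<bar>K\<bar> * (\<alpha> * real n + b) powr \<alpha> / (real n + 1)) \<longlonglongrightarrow> 0"
    using \<alpha>_pos \<alpha>_less_1 b_pos by real_asymp
  then have "eventually (\<lambda>n. \<bar>K\<bar> * (\<alpha> * real n + b) powr \<alpha> / (real n + 1) < 1/2) sequentially"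
    by (rule order_tendstoD) simp
  then obtain N where N: "\<And>n. n \<ge> N \<Longrightarrow> \<bar>K\<bar> * (\<alpha> * real n + b) powr \<alpha> / (real n + 1) < 1/2"
    by (auto simp: eventually_sequentially)
  show ?thesis
  proof (rule summable_ratio_test[of "1/2" N])
    fix n assume n: "n \<ge> N"
    have "norm (moment (Suc n) * K ^ Suc n / fact (Suc n))
      = moment (Suc n) * (\<bar>K\<bar> ^ n / fact n) * (\<bar>K\<bar> / (real n + 1))"
      using moment_pos[of "Suc n"] by (simp add: abs_mult power_abs field_simps)
    also have "\<dots> \<le> (moment n * (\<alpha> * real n + b) powr \<alpha>) * (\<bar>K\<bar> ^ n / fact n) * (\<bar>K\<bar> / (real n + 1))"
      by (intro mult_right_mono moment_Suc_le) auto
    also have "\<dots> = (\<bar>K\<bar> * (\<alpha> * real n + b) powr \<alpha> / (real n + 1)) * norm (moment n * K ^ n / fact n)"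
      using moment_pos[of n] by (simp add: abs_mult power_abs field_simps)
    also have "\<dots> \<le> 1/2 * norm (moment n * K ^ n / fact n)"
      using N[OF n] by (intro mult_right_mono) auto
    finally show "norm (moment (Suc n) * K ^ Suc n / fact (Suc n)) \<le> 1/2 * norm (moment n * K ^ n / fact n)" .
  qed auto
qed

lemma space_\<nu>: "space \<nu> = {0..}"
  by (simp add: gl_measure_def space_restrict_space)

lemma sets_\<nu>: "sets \<nu> = sets (restrict_space borel {0..})"
  unfolding gl_measure_def sets_density by (rule sets_restrict_space_cong) simp

lemma measurable_\<nu>: "f \<in> borel_measurable borel \<Longrightarrow> f \<in> borel_measurable \<nu>"
  for f :: "real \<Rightarrow> 'b :: topological_space"
  by (subst measurable_cong_sets[OF sets_\<nu> refl]) (rule measurable_restrict_space1)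

lemma gl_density_nonneg: "0 \<le> gl_density \<alpha> \<beta> x"
  using \<alpha>_pos Gamma_real_pos[OF b_pos] by (simp add: gl_density_def b_def)

lemma gl_density_pos: "0 < x \<Longrightarrow> 0 < gl_density \<alpha> \<beta> x"
  using \<alpha>_pos Gamma_real_pos[OF b_pos] by (simp add: gl_density_def b_def)

lemma gl_density_measurable[measurable]: "gl_density \<alpha> \<beta> \<in> borel_measurable borel"
  unfolding gl_density_def by measurable

lemma nn_integral_\<nu>:
  assumes [measurable]: "f \<in> borel_measurable borel"
  shows "(\<integral>\<^sup>+x. f x \<partial>\<nu>) = (\<integral>\<^sup>+x. ennreal (gl_density \<alpha> \<beta> x) * f x * indicator {0..} x \<partial>lborel)"
  unfolding gl_measure_def
  by (subst nn_integral_density)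
     (auto intro!: measurable_restrict_space1 simp: nn_integral_restrict_space)

lemma AE_\<nu>: "(AE x in \<nu>. P x) \<longleftrightarrow> (AE x in lborel. 0 < x \<longrightarrow> P x)"
proof -
  have "(AE x in \<nu>. P x) \<longleftrightarrow>
    (AE x in lborel. x \<in> {0..} \<longrightarrow> 0 < ennreal (gl_density \<alpha> \<beta> x) \<longrightarrow> P x)"
    unfolding gl_measure_def
    by (subst AE_density) (auto intro!: measurable_restrict_space1 simp: AE_restrict_space_iff)
  also have "\<dots> \<longleftrightarrow> (AE x in lborel. 0 < x \<longrightarrow> P x)"
  proof -
    have "(x \<in> {0..} \<longrightarrow> 0 < ennreal (gl_density \<alpha> \<beta> x) \<longrightarrow> P x) \<longleftrightarrow> (0 < x \<longrightarrow> P x)" for x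
      using gl_density_pos[of x] by (cases "x = 0") (auto simp: gl_density_def)
    then show ?thesis by simp
  qed
  finally show ?thesis .
qed

text \<open>The substitution \<open>x = y\<^sup>\<alpha>\<close> turns the density into that of the Gamma law with parameter \<open>b\<close>.\<close>

lemma moment_density_integral:
  "(\<lambda>x. x ^ n * gl_density \<alpha> \<beta> x) absolutely_integrable_on {0<..} \<and>
   integral {0<..} (\<lambda>x. x ^ n * gl_density \<alpha> \<beta> x) = moment n"
proof -
  define s where "s = \<alpha> * real n + b"
  have s: "s > 0" using moment_arg_pos by (simp add: s_def)
  have G: "((\<lambda>t. t powr (s - 1) / exp t) has_integral Gamma s) {0<..}"
  proof -
    have "((\<lambda>t. if t \<in> {0<..} then t powr (s - 1) / exp t else 0) has_integral Gamma s) {0..}"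
      using Gamma_integral_real[OF s] by (rule has_integral_spike[of "{0}", rotated 2]) auto
    then show ?thesis by (subst (asm) has_integral_restrict) auto
  qed
  have pre: "(\<lambda>y. \<bar>\<alpha> * y powr (\<alpha> - 1)\<bar> * ((y powr \<alpha>) ^ n * gl_density \<alpha> \<beta> (y powr \<alpha>)))
     absolutely_integrable_on {0<..} \<and>
     integral {0<..} (\<lambda>y. \<bar>\<alpha> * y powr (\<alpha> - 1)\<bar> * ((y powr \<alpha>) ^ n * gl_density \<alpha> \<beta> (y powr \<alpha>)))
     = moment n"
  proof -
    have eq: "\<bar>\<alpha> * y powr (\<alpha> - 1)\<bar> * ((y powr \<alpha>) ^ n * gl_density \<alpha> \<beta> (y powr \<alpha>))
      = (y powr (s - 1) / exp y) / Gamma b" if "y \<in> {0<..}" for y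
    proof -
      from that have y: "y > 0" by simp
      have e1: "(y powr \<alpha>) ^ n = y powr (\<alpha> * real n)"
        using y by (simp add: powr_powr flip: powr_realpow)
      have e2: "(y powr \<alpha>) powr (\<beta> + 1 / \<alpha> - 1) = y powr (b - \<alpha>)"
        using \<alpha>_pos by (simp add: powr_powr b_def algebra_simps)
      have e3: "(y powr \<alpha>) powr (1 / \<alpha>) = y"
        using y \<alpha>_pos by (simp add: powr_powr)
      have e4: "y powr (\<alpha> - 1) * (y powr (\<alpha> * real n) * y powr (b - \<alpha>)) = y powr (s - 1)"
        using y by (simp add: s_def algebra_simps flip: powr_add)
      have "\<bar>\<alpha> * y powr (\<alpha> - 1)\<bar> * ((y powr \<alpha>) ^ n * gl_density \<alpha> \<beta> (y powr \<alpha>))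
        = (y powr (\<alpha> - 1) * (y powr (\<alpha> * real n) * y powr (b - \<alpha>))) * (exp (- y) / Gamma b)"
        unfolding gl_density_def e1 e2 e3 using \<alpha>_pos
        by (simp add: abs_mult b_def[symmetric])
      then show ?thesis unfolding e4 by (simp add: exp_minus field_simps)
    qed
    have I: "((\<lambda>y. (y powr (s - 1) / exp y) / Gamma b) has_integral moment n) {0<..}"
      using has_integral_divide[OF G, of "Gamma b"] by (simp add: moment_def s_def)
    have "(\<lambda>y. (y powr (s - 1) / exp y) / Gamma b) absolutely_integrable_on {0<..}"
      using has_integral_integrable[OF I] Gamma_real_pos[OF b_pos]
      by (intro nonnegative_absolutely_integrable_1) auto
    then show ?thesis
      using integral_unique[OF I] integral_cong[OF eq, of "{0<..}" "\<lambda>y. y"]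
      by (simp only: set_integrable_cong[OF refl refl eq])
  qed
  have img: "(\<lambda>y. y powr \<alpha>) ` {0<..} = {0<..}"
  proof safe
    fix x :: real assume "0 < x"
    then show "x \<in> (\<lambda>y. y powr \<alpha>) ` {0<..}"
      using \<alpha>_pos by (intro image_eqI[of _ _ "x powr (1 / \<alpha>)"]) (auto simp: powr_powr)
  qed (use \<alpha>_pos in auto)
  have "(\<lambda>x. \<bar>\<alpha> * x powr (\<alpha> - 1)\<bar> * ((x powr \<alpha>) ^ n * gl_density \<alpha> \<beta> (x powr \<alpha>)))
      absolutely_integrable_on {0<..} \<and>
    integral {0<..} (\<lambda>x. \<bar>\<alpha> * x powr (\<alpha> - 1)\<bar> * ((x powr \<alpha>) ^ n * gl_density \<alpha> \<beta> (x powr \<alpha>)))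
      = moment n \<longleftrightarrow>
    (\<lambda>x. x ^ n * gl_density \<alpha> \<beta> x) absolutely_integrable_on ((\<lambda>y. y powr \<alpha>) ` {0<..}) \<and>
    integral ((\<lambda>y. y powr \<alpha>) ` {0<..}) (\<lambda>x. x ^ n * gl_density \<alpha> \<beta> x) = moment n"
  proof (rule has_absolute_integral_change_of_variables_1')
    show "inj_on (\<lambda>y. y powr \<alpha>) {0<..}"
    proof (rule inj_on_inverseI)
      fix y :: real assume "y \<in> {0<..}"
      then show "(y powr \<alpha>) powr (1 / \<alpha>) = y" using \<alpha>_pos by (simp add: powr_powr)
    qed
  qed (auto intro!: derivative_eq_intros)
  with pre show ?thesis unfolding img by blast
qed

lemma moment_nn_integral: "(\<integral>\<^sup>+x. ennreal (x ^ n) \<partial>\<nu>) = ennreal (moment n)"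
proof -
  have "(\<integral>\<^sup>+x. ennreal (x ^ n) \<partial>\<nu>)
    = (\<integral>\<^sup>+x. ennreal (gl_density \<alpha> \<beta> x) * ennreal (x ^ n) * indicator {0..} x \<partial>lborel)"
    by (rule nn_integral_\<nu>) simp
  also have "\<dots> = (\<integral>\<^sup>+x. ennreal (indicator {0<..} x * (x ^ n * gl_density \<alpha> \<beta> x)) \<partial>lborel)"
  proof (rule nn_integral_cong_AE)
    have "AE x in lborel. x \<noteq> (0::real)" by (rule AE_lborel_singleton)
    then show "AE x in lborel. ennreal (gl_density \<alpha> \<beta> x) * ennreal (x ^ n) * indicator {0..} x
      = ennreal (indicator {0<..} x * (x ^ n * gl_density \<alpha> \<beta> x))"
      by eventually_elim
         (auto simp: indicator_def gl_density_nonneg mult_ac simp flip: ennreal_mult')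
  qed
  also have "\<dots> = (\<integral>\<^sup>+x. ennreal (indicator {0<..} x * (x ^ n * gl_density \<alpha> \<beta> x)) \<partial>lebesgue)"
    by (subst nn_integral_completion) auto
  also have "\<dots> = ennreal (LINT x|lebesgue. indicator {0<..} x * (x ^ n * gl_density \<alpha> \<beta> x))"
    using moment_density_integral[of n] gl_density_nonneg
    by (intro nn_integral_eq_integral) (auto simp: set_integrable_def indicator_def)
  also have "(LINT x|lebesgue. indicator {0<..} x * (x ^ n * gl_density \<alpha> \<beta> x)) = moment n"
    using moment_density_integral[of n]
    by (auto simp: set_lebesgue_integral_eq_integral(2)[symmetric] set_lebesgue_integral_def)
  finally show ?thesis .
qed

end

sublocale gauss_laguerre_parameters \<subseteq> prob_space "gl_measure \<alpha> \<beta>"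
proof
  show "emeasure (gl_measure \<alpha> \<beta>) (space (gl_measure \<alpha> \<beta>)) = 1"
    using moment_nn_integral[of 0] by (simp add: moment_0 one_ennreal_def[symmetric])
qed

context gauss_laguerre_parameters
begin

lemma moment_integral: "has_bochner_integral \<nu> (\<lambda>x. x ^ n) (moment n)"
proof (rule has_bochner_integral_nn_integral)
  show "AE x in \<nu>. 0 \<le> x ^ n" by (intro AE_I2) (simp add: space_\<nu>)
qed (use moment_nn_integral moment_pos less_imp_le in \<open>auto intro!: measurable_\<nu>\<close>)

text \<open>The total mass of \<open>\<nu>\<close> on \<open>[1, \<infinity>)\<close> bounds every moment from below.\<close>

lemma moment_lower_bound: "\<exists>C>0. \<forall>n. 1 / moment n \<le> C"
proof -
  have meas: "{1..} \<in> sets \<nu>"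
    unfolding sets_\<nu> by (auto simp: sets_restrict_space intro!: image_eqI[of _ _ "{1..}"])
  have "measure \<nu> {1..} \<noteq> 0"
  proof
    assume "measure \<nu> {1..} = 0"
    then have "{1..} \<in> null_sets \<nu>" using meas by (auto simp: emeasure_eq_measure)
    then have "AE x in \<nu>. x \<notin> {1..}" by (rule AE_not_in)
    then have "AE x in lborel. 0 < x \<longrightarrow> x \<notin> {1::real..}" unfolding AE_\<nu> .
    then have "AE x\<in>{0<..} in lebesgue. x \<in> {..1::real}"
      by (intro AE_completion) (auto elim: eventually_mono)
    then have "(2::real) \<in> {..1}"
      by (rule mem_closed_if_AE_lebesgue_open[rotated 2]) auto
    then show False by simp
  qed
  then have m: "0 < measure \<nu> {1..}" using zero_less_measure_iff by blast
  have "measure \<nu> {1..} \<le> moment n" for n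
  proof -
    have int: "integrable \<nu> (\<lambda>x. x ^ n)" "(LINT x|\<nu>. x ^ n) = moment n"
      using moment_integral[of n] by (auto simp: has_bochner_integral_iff)
    have "measure \<nu> {1..} = (LINT x|\<nu>. indicator {1..} x)"
      using meas by (simp add: space_\<nu> Int_absorb2)
    also have "\<dots> \<le> (LINT x|\<nu>. x ^ n)"
      using meas
      by (intro integral_mono int integrable_real_indicator)
         (auto simp: indicator_def space_\<nu> one_le_power emeasure_eq_measure)
    finally show ?thesis by (simp add: int)
  qed
  then have "1 / moment n \<le> 1 / measure \<nu> {1..}" for n
    using m by (intro divide_left_mono) (auto intro: mult_pos_pos moment_pos)
  then show ?thesis using m by (intro exI[of _ "1 / measure \<nu> {1..}"]) auto
qed

lemma exp_integrable: "integrable \<nu> (\<lambda>x. exp (K * x))"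
proof -
  have "(\<integral>\<^sup>+x. ennreal (exp (\<bar>K\<bar> * x)) \<partial>\<nu>) = (\<integral>\<^sup>+x. (\<Sum>n. ennreal (\<bar>K\<bar> ^ n / fact n) * ennreal (x ^ n)) \<partial>\<nu>)"
  proof (rule nn_integral_cong)
    fix x assume "x \<in> space \<nu>"
    then have x: "0 \<le> x" by (simp add: space_\<nu>)
    have "(\<lambda>n. \<bar>K\<bar> ^ n / fact n * x ^ n) sums exp (\<bar>K\<bar> * x)"
      using exp_converges[of "\<bar>K\<bar> * x"] by (simp add: power_mult_distrib field_simps)
    then have "(\<lambda>n. ennreal (\<bar>K\<bar> ^ n / fact n * x ^ n)) sums ennreal (exp (\<bar>K\<bar> * x))"
      using x by (subst sums_ennreal) auto
    then show "ennreal (exp (\<bar>K\<bar> * x)) = (\<Sum>n. ennreal (\<bar>K\<bar> ^ n / fact n) * ennreal (x ^ n))"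
      using x by (subst ennreal_mult'[symmetric]) (auto simp: sums_iff)
  qed
  also have "\<dots> = (\<Sum>n. \<integral>\<^sup>+x. ennreal (\<bar>K\<bar> ^ n / fact n) * ennreal (x ^ n) \<partial>\<nu>)"
    by (rule nn_integral_suminf) (intro measurable_\<nu>, measurable)
  also have "\<dots> = (\<Sum>n. ennreal (moment n * \<bar>K\<bar> ^ n / fact n))"
  proof (intro arg_cong[of _ _ suminf] ext)
    fix n
    have "(\<integral>\<^sup>+x. ennreal (\<bar>K\<bar> ^ n / fact n) * ennreal (x ^ n) \<partial>\<nu>)
      = ennreal (\<bar>K\<bar> ^ n / fact n) * ennreal (moment n)"
      by (subst nn_integral_cmult) (auto intro!: measurable_\<nu> simp: moment_nn_integral)
    also have "\<dots> = ennreal (\<bar>K\<bar> ^ n / fact n * moment n)"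
      by (rule ennreal_mult'[symmetric]) simp
    finally show "(\<integral>\<^sup>+x. ennreal (\<bar>K\<bar> ^ n / fact n) * ennreal (x ^ n) \<partial>\<nu>)
      = ennreal (moment n * \<bar>K\<bar> ^ n / fact n)"
      by (simp only: mult.commute[of "moment n"] times_divide_eq_left)
  qed
  also have "\<dots> = ennreal (\<Sum>n. moment n * \<bar>K\<bar> ^ n / fact n)"
    by (intro suminf_ennreal2 summable_moment_exp)
       (simp add: moment_pos[THEN less_imp_le])
  also have "\<dots> < \<infinity>" by simp
  finally have int: "integrable \<nu> (\<lambda>x. exp (\<bar>K\<bar> * x))"
    by (intro integrableI_nonneg) (auto intro!: measurable_\<nu>)
  show ?thesis
  proof (rule Bochner_Integration.integrable_bound[OF int])
    show "AE x in \<nu>. norm (exp (K * x)) \<le> norm (exp (\<bar>K\<bar> * x))"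
      by (intro AE_I2) (auto simp: space_\<nu> intro!: mult_right_mono)
  qed (intro measurable_\<nu>, measurable)
qed

lemma L2_exp: "(\<lambda>x. exp (K * x)) \<in> L2 \<nu>"
  using exp_integrable[of "2 * K"]
  by (auto intro!: measurable_\<nu> simp: L2_def power2_eq_square mult_exp_exp algebra_simps)

lemma L2_power: "(\<lambda>x. x ^ n) \<in> L2 \<nu>"
  using moment_integral[of "2 * n"]
  by (auto intro!: measurable_\<nu> simp: L2_def has_bochner_integral_iff mult.commute
      simp flip: power_mult)

lemma L2_poly: "poly p \<in> L2 \<nu>"
  unfolding poly_altdef[abs_def] by (intro L2_sum L2_cmult L2_power)

end

section \<open>The jump kernel as a positive combination of powers\<close>

lemma Gamma_reflection_real:
  fixes z :: real
  shows "Gamma z * Gamma (1 - z) = pi / sin (z * pi)"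
proof -
  have "of_real (Gamma z * Gamma (1 - z)) = (of_real (pi / sin (z * pi)) :: complex)"
    using Gamma_reflection_complex[of "of_real z"]
    unfolding of_real_mult of_real_divide sin_of_real[symmetric] Gamma_complex_of_real[symmetric]
      of_real_diff of_real_1 by (simp only: mult.commute)
  then show ?thesis unfolding of_real_eq_iff .
qed

lemma one_minus_powr_sums:
  fixes a t :: real
  assumes "0 \<le> t" "t < 1"
  shows "(\<lambda>n. pochhammer a n / fact n * t ^ n) sums (1 - t) powr (- a)"
proof -
  have "((- a) gchoose n) * (- t) ^ n = pochhammer a n / fact n * t ^ n" for n
    by (simp add: gbinomial_pochhammer flip: power_mult_distrib)
  then show ?thesis
    using gen_binomial_real[of "- t" "- a"] assms by simp
qed

text \<open>The binomial series of \<open>(1 - t)\<^sup>-\<^sup>a\<close> has nonnegative terms and may be integrated term by term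
  against \<open>t\<^sup>s\<^sup>-\<^sup>1\<close>.\<close>

lemma Beta_sums:
  fixes s a :: real
  assumes s: "0 < s" and a: "0 < a" "a < 1"
  shows "(\<lambda>k. pochhammer a k / fact k / (s + real k)) sums Beta s (1 - a)"
proof -
  have poch: "0 \<le> pochhammer a k / fact k" for k
    using a by (simp add: pochhammer_nonneg)
  have "(\<Sum>k. ennreal (pochhammer a k / fact k / (s + real k)))
    = (\<Sum>k. \<integral>\<^sup>+t. ennreal (indicator {0..1} t * (pochhammer a k / fact k * t powr (s + real k - 1))) \<partial>lborel)"
  proof (intro arg_cong[of _ _ suminf] ext)
    fix k
    have "((\<lambda>t. pochhammer a k / fact k * t powr (s + real k - 1)) has_integral
      pochhammer a k / fact k * (1 powr (s + real k - 1 + 1) / (s + real k - 1 + 1))) {0..1}"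
      using s by (intro has_integral_mult_right has_integral_powr_from_0) auto
    then have "((\<lambda>t. pochhammer a k / fact k * t powr (s + real k - 1)) has_integral
      pochhammer a k / fact k / (s + real k)) {0..1}" by simp
    from nn_integral_has_integral_lebesgue[OF _ this]
    show "ennreal (pochhammer a k / fact k / (s + real k))
      = (\<integral>\<^sup>+t. ennreal (indicator {0..1} t * (pochhammer a k / fact k * t powr (s + real k - 1))) \<partial>lborel)"
      using mult_nonneg_nonneg[OF poch powr_ge_zero] by (simp only:)
  qed
  also have "\<dots> = (\<integral>\<^sup>+t. (\<Sum>k. ennreal (indicator {0..1} t * (pochhammer a k / fact k * t powr (s + real k - 1)))) \<partial>lborel)"
    by (rule nn_integral_suminf[symmetric]) measurable
  also have "\<dots> = (\<integral>\<^sup>+t. ennreal (indicator {0..1} t * (t powr (s - 1) * (1 - t) powr (1 - a - 1))) \<partial>lborel)"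
  proof (rule nn_integral_cong_AE)
    have "AE t in lborel. t \<noteq> (0::real)" "AE t in lborel. t \<noteq> (1::real)" by (rule AE_lborel_singleton)+
    then show "AE t in lborel.
      (\<Sum>k. ennreal (indicator {0..1} t * (pochhammer a k / fact k * t powr (s + real k - 1))))
      = ennreal (indicator {0..1} t * (t powr (s - 1) * (1 - t) powr (1 - a - 1)))"
    proof eventually_elim
      case (elim t)
      show ?case
      proof (cases "0 < t \<and> t < 1")
        case True
        then have "(\<lambda>k. t powr (s - 1) * (pochhammer a k / fact k * t ^ k)) sums (t powr (s - 1) * (1 - t) powr (- a))"
          by (intro sums_mult one_minus_powr_sums) auto
        also have "(\<lambda>k. t powr (s - 1) * (pochhammer a k / fact k * t ^ k))
          = (\<lambda>k. indicator {0..1} t * (pochhammer a k / fact k * t powr (s + real k - 1)))"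
        proof
          fix k
          have "t powr (s + real k - 1) = t powr (s - 1) * t ^ k"
            using True by (simp add: algebra_simps flip: powr_realpow powr_add)
          then show "t powr (s - 1) * (pochhammer a k / fact k * t ^ k)
            = indicator {0..1} t * (pochhammer a k / fact k * t powr (s + real k - 1))"
            using True by simp
        qed
        finally have "(\<lambda>k. ennreal (indicator {0..1} t * (pochhammer a k / fact k * t powr (s + real k - 1))))
          sums ennreal (t powr (s - 1) * (1 - t) powr (- a))"
          using mult_nonneg_nonneg[OF poch powr_ge_zero]
          by (subst sums_ennreal) (auto simp del: times_divide_eq_left)
        then show ?thesis using True by (simp add: sums_iff)
      qed (use elim in \<open>auto simp: indicator_def\<close>)
    qed
  qed
  also have "\<dots> = ennreal (Beta s (1 - a))"
    using s a has_integral_Beta_real[of s "1 - a"] by (intro nn_integral_has_integral_lebesgue) auto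
  finally have eq: "(\<Sum>k. ennreal (pochhammer a k / fact k / (s + real k))) = ennreal (Beta s (1 - a))" .
  have nonneg: "0 \<le> pochhammer a k / fact k / (s + real k)" for k
    using poch[of k] s by (intro divide_nonneg_nonneg[of "_ / _"]) auto
  have B: "0 \<le> Beta s (1 - a)"
    using s a by (auto simp: Beta_def intro!: divide_nonneg_pos mult_nonneg_nonneg less_imp_le[OF Gamma_real_pos] Gamma_real_pos)
  have "(\<lambda>k. ennreal (pochhammer a k / fact k / (s + real k))) sums ennreal (Beta s (1 - a))"
    using eq by (simp add: sums_iff)
  then show ?thesis using nonneg B by (subst (asm) sums_ennreal) auto
qed

text \<open>With \<open>a\<close> in place of \<open>a + 1\<close> the two halves of the sum converge separately, to Beta
  functions; the relation \<open>a (a + 1)\<^sub>k = (a + k) (a)\<^sub>k\<close> reduces the sum to that case, the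
  divergent parts cancelling.\<close>

lemma Gamma_ratio_difference_sums:
  fixes s s' a :: real
  assumes a: "0 < a" "a < 1" and s: "a < s" "a < s'"
  shows "(\<lambda>k. pochhammer (a + 1) k / fact k * (1 / (s + real k) - 1 / (s' + real k)))
    sums (Gamma (1 - a) / a * (Gamma s' / Gamma (s' - a) - Gamma s / Gamma (s - a)))"
proof -
  have B: "(r - a) * Beta r (1 - a) = Gamma (1 - a) * (Gamma r / Gamma (r - a))" if "a < r" for r
  proof -
    have "Gamma (r - a + 1) = (r - a) * Gamma (r - a)"
      using that by (intro Gamma_plus1) (auto elim!: nonpos_Ints_cases)
    moreover have e: "r + (1 - a) = r - a + 1" by simp
    ultimately have "Gamma (r + (1 - a)) = (r - a) * Gamma (r - a)" unfolding e by blast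
    then show ?thesis
      using that by (simp add: Beta_def)
  qed
  have "(\<lambda>k. 1 / a * ((a - s) * (pochhammer a k / fact k / (s + real k))
        - (a - s') * (pochhammer a k / fact k / (s' + real k))))
    sums (1 / a * ((a - s) * Beta s (1 - a) - (a - s') * Beta s' (1 - a)))"
    using a s by (intro sums_mult sums_diff Beta_sums) auto
  also have "(\<lambda>k. 1 / a * ((a - s) * (pochhammer a k / fact k / (s + real k))
        - (a - s') * (pochhammer a k / fact k / (s' + real k))))
    = (\<lambda>k. pochhammer (a + 1) k / fact k * (1 / (s + real k) - 1 / (s' + real k)))"
  proof
    fix k
    have p: "pochhammer (a + 1) k = pochhammer a k * ((a + real k) / a)"
      using a pochhammer_rec[of a k] pochhammer_Suc[of a k] by (simp add: field_simps)
    have "(a + real k) / (r + real k) = 1 + (a - r) / (r + real k)" if "a < r" for r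
      using a that by (simp add: field_simps)
    then have d: "(a + real k) * (1 / (s + real k) - 1 / (s' + real k))
      = (a - s) / (s + real k) - (a - s') / (s' + real k)"
      using s by (simp add: algebra_simps)
    have "pochhammer (a + 1) k / fact k * (1 / (s + real k) - 1 / (s' + real k))
      = pochhammer a k / fact k / a * ((a + real k) * (1 / (s + real k) - 1 / (s' + real k)))"
      unfolding p by (simp add: mult_ac)
    moreover have "1 / a * ((a - s) * (P / S) - (a - s') * (P / S')) = P / a * ((a - s) / S - (a - s') / S')"
      for P S S' :: real
      unfolding divide_inverse by algebra
    ultimately show "1 / a * ((a - s) * (pochhammer a k / fact k / (s + real k))
        - (a - s') * (pochhammer a k / fact k / (s' + real k)))
      = pochhammer (a + 1) k / fact k * (1 / (s + real k) - 1 / (s' + real k))"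
      by (simp only: d)
  qed
  also have "1 / a * ((a - s) * Beta s (1 - a) - (a - s') * Beta s' (1 - a))
    = Gamma (1 - a) / a * (Gamma s' / Gamma (s' - a) - Gamma s / Gamma (s - a))"
  proof -
    have "(a - s) * Beta s (1 - a) - (a - s') * Beta s' (1 - a)
      = (s' - a) * Beta s' (1 - a) - (s - a) * Beta s (1 - a)" by (simp add: algebra_simps)
    then show ?thesis using B[OF s(1)] B[OF s(2)] by (simp add: algebra_simps)
  qed
  finally show ?thesis .
qed

context gauss_laguerre_parameters
begin

text \<open>The values at the integers \<open>n + 1\<close> of the Bernstein function
  \<open>\<phi>(u) = \<Gamma>(\<alpha>u + b) / \<Gamma>(\<alpha>u + b - \<alpha>)\<close> that governs the semigroup.\<close>

definition rate :: "nat \<Rightarrow> real" where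
  "rate n = moment (Suc n) / moment n"

definition kernel_coeff :: "nat \<Rightarrow> real" where
  "kernel_coeff k = \<alpha> * Gamma \<alpha> * (pochhammer (\<alpha> + 1) k / fact k) / (b + \<alpha> + real k)"

definition kernel_exponent :: "nat \<Rightarrow> real" where
  "kernel_exponent k = (b + \<alpha> + real k) / \<alpha>"

lemma rate_pos: "0 < rate n"
  by (simp add: rate_def moment_pos)

lemma rate_eq: "rate n = Gamma (\<alpha> * real n + b + \<alpha>) / Gamma (\<alpha> * real n + b)"
  using Gamma_real_pos[OF b_pos] by (simp add: rate_def moment_def algebra_simps)

lemma rate_0: "rate 0 = gl_drift \<alpha> \<beta>"
  by (simp add: rate_eq gl_drift_def b_def algebra_simps)

lemma kernel_coeff_pos: "0 < kernel_coeff k"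
  unfolding kernel_coeff_def using \<alpha>_pos b_pos
  by (intro divide_pos_pos mult_pos_pos Gamma_real_pos pochhammer_pos) auto

lemma kernel_exponent_ge: "2 \<le> kernel_exponent k"
  using \<alpha>_pos b_ge by (simp add: kernel_exponent_def pos_le_divide_eq)

text \<open>The parameters \<open>a = b + \<alpha>\<close> and \<open>a + 1\<close> of the hypergeometric function satisfy
  \<open>(a)\<^sub>n / (a + 1)\<^sub>n = a / (a + n)\<close>, so its coefficients are positive and explicit.\<close>

lemma gl_kernel_sums:
  assumes y: "0 < y" "y < 1"
  shows "(\<lambda>k. kernel_coeff k * y powr kernel_exponent k) sums gl_kernel \<alpha> \<beta> y"
proof -
  define a where "a = b + \<alpha>"
  define z where "z = y powr (1 / \<alpha>)"
  have a: "a > 0" using b_pos \<alpha>_pos by (simp add: a_def)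
  have z: "0 < z" "z < 1" using y \<alpha>_pos powr_less_mono2[of "1 / \<alpha>" y 1] by (auto simp: z_def)
  define F where "F n = a / (a + real n) * (pochhammer (\<alpha> + 1) n / fact n) * z ^ n" for n
  have "summable F"
  proof (rule summable_comparison_test')
    show "summable (\<lambda>n. real (Suc n) * z ^ n)"
      using geometric_deriv_sums[of z] z by (auto simp: sums_iff)
    fix n
    have "pochhammer (\<alpha> + 1) n \<le> pochhammer 2 n"
      using \<alpha>_pos \<alpha>_less_1 unfolding pochhammer_prod by (intro prod_mono) auto
    also have "pochhammer 2 n = (fact (Suc n) :: real)"
      using pochhammer_rec[of "1::real" n] by (simp add: pochhammer_fact)
    finally have "pochhammer (\<alpha> + 1) n / fact n \<le> real (Suc n)"
      by (simp add: field_simps)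
    moreover have "0 \<le> pochhammer (\<alpha> + 1) n / fact n"
      using \<alpha>_pos by (simp add: pochhammer_nonneg)
    moreover have "0 \<le> a / (a + real n)" "a / (a + real n) \<le> 1" using a by auto
    ultimately have le: "a / (a + real n) * (pochhammer (\<alpha> + 1) n / fact n) \<le> 1 * real (Suc n)"
      and nonneg: "0 \<le> a / (a + real n) * (pochhammer (\<alpha> + 1) n / fact n)"
      by (intro mult_mono mult_nonneg_nonneg; simp only: of_nat_0_le_iff)+
    have "F n \<le> 1 * real (Suc n) * z ^ n"
      unfolding F_def by (rule mult_right_mono[OF le]) (use z in simp)
    moreover have "0 \<le> F n"
      unfolding F_def by (rule mult_nonneg_nonneg[OF nonneg]) (use z in simp)
    ultimately show "norm (F n) \<le> real (Suc n) * z ^ n" by simp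
  qed
  then have "F sums hypergeometric_2F1 (\<alpha> * (\<beta> + 1) + 1) (\<alpha> + 1) (\<alpha> * (\<beta> + 1) + 2) z"
  proof -
    have ab: "\<alpha> * (\<beta> + 1) + 1 = a" "\<alpha> * (\<beta> + 1) + 2 = a + 1"
      by (auto simp: a_def b_def algebra_simps)
    have "fps_nth (fps_hypergeo [a, \<alpha> + 1] [a + 1] 1) n * z ^ n = F n" for n
    proof -
      have "pochhammer a n / pochhammer (a + 1) n = a / (a + real n)"
        using a pochhammer_rec[of a n] pochhammer_Suc[of a n] pochhammer_pos[of "a+1" n]
        by (simp add: field_simps)
      then have "pochhammer a n = a / (a + real n) * pochhammer (a + 1) n"
        using a pochhammer_pos[of "a+1" n] by (simp add: field_simps)
      then show ?thesis
        using a pochhammer_pos[of "a+1" n] by (simp add: F_def)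
    qed
    then have "hypergeometric_2F1 (\<alpha> * (\<beta> + 1) + 1) (\<alpha> + 1) (\<alpha> * (\<beta> + 1) + 2) z = suminf F"
      unfolding hypergeometric_2F1_def eval_fps_def ab by simp
    then show ?thesis using \<open>summable F\<close> by (simp add: summable_sums)
  qed
  then have "(\<lambda>k. Gamma \<alpha> / (\<beta> + 1 / \<alpha> + 1) * y powr (\<beta> + 1 / \<alpha> + 1) * F k) sums gl_kernel \<alpha> \<beta> y"
    unfolding gl_kernel_def z_def by (rule sums_mult)
  moreover have "Gamma \<alpha> / (\<beta> + 1 / \<alpha> + 1) * y powr (\<beta> + 1 / \<alpha> + 1) * F k
    = kernel_coeff k * y powr kernel_exponent k" for k
  proof -
    have e: "\<beta> + 1 / \<alpha> + 1 = a / \<alpha>" using \<alpha>_pos by (simp add: a_def b_def field_simps)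
    have "y powr (a / \<alpha>) * z ^ k = y powr kernel_exponent k"
      using y \<alpha>_pos by (simp add: z_def kernel_exponent_def a_def powr_powr add_divide_distrib
          flip: powr_realpow powr_add)
    moreover have "Gamma \<alpha> / (a / \<alpha>) * (a / (a + real k) * (pochhammer (\<alpha> + 1) k / fact k)) = kernel_coeff k"
      using a by (simp add: kernel_coeff_def a_def mult_ac)
    moreover have "G / A * Y * (B * P * Z) = G / A * (B * P) * (Y * Z)" for G A Y B P Z :: real
      by simp
    ultimately show ?thesis unfolding e F_def by (simp only:)
  qed
  ultimately show ?thesis by simp
qed

text \<open>Partial fractions reduce the series to the difference of Gamma ratios above; the constant comes
  from Euler's reflection formula and cancels the factor \<open>sin (\<alpha> \<pi>) / \<pi>\<close> of the operator.\<close>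

lemma kernel_moment_sums:
  assumes j: "0 < j"
  shows "(\<lambda>k. kernel_coeff k / (kernel_exponent k + real j))
    sums (pi / sin (\<alpha> * pi) * ((rate j - rate 0) / real j))"
proof -
  define a where "a = b + \<alpha>"
  have a: "\<alpha> < a" using b_pos by (simp add: a_def)
  have c: "kernel_coeff k / (kernel_exponent k + real j)
    = \<alpha> * Gamma \<alpha> / real j * (pochhammer (\<alpha> + 1) k / fact k * (1 / (a + real k) - 1 / (a + \<alpha> * real j + real k)))" for k
  proof -
    have p: "a + real k > 0" "\<alpha> * real j > 0" "a + \<alpha> * real j + real k > 0" using a \<alpha>_pos j by (auto intro!: add_pos_nonneg)
    have "1 / (a + real k) - 1 / (a + \<alpha> * real j + real k)
      = (\<alpha> * real j) / ((a + real k) * (a + \<alpha> * real j + real k))"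
      using p by (simp add: field_simps)
    moreover have "kernel_exponent k + real j = (a + \<alpha> * real j + real k) / \<alpha>"
      using \<alpha>_pos by (simp add: kernel_exponent_def a_def field_simps)
    moreover have "kernel_coeff k = \<alpha> * Gamma \<alpha> * (pochhammer (\<alpha> + 1) k / fact k) / (a + real k)"
      by (simp add: kernel_coeff_def a_def)
    moreover have "A / P / (Q / \<alpha>) = A / J * (\<alpha> * J / (P * Q))" if "P > 0" "Q > 0" "J > 0" for A P Q J :: real
      using that \<alpha>_pos by (simp add: field_simps)
    ultimately show ?thesis using p j by (simp add: mult_ac)
  qed
  have "(\<lambda>k. kernel_coeff k / (kernel_exponent k + real j)) sums
    (\<alpha> * Gamma \<alpha> / real j * (Gamma (1 - \<alpha>) / \<alpha> *
      (Gamma (a + \<alpha> * real j) / Gamma (a + \<alpha> * real j - \<alpha>) - Gamma a / Gamma (a - \<alpha>))))"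
    unfolding c using a \<alpha>_pos \<alpha>_less_1
    by (intro sums_mult Gamma_ratio_difference_sums) (auto intro: less_le_trans[OF a])
  also have "Gamma (a + \<alpha> * real j) / Gamma (a + \<alpha> * real j - \<alpha>) = rate j"
    by (simp add: rate_eq a_def algebra_simps)
  also have "Gamma a / Gamma (a - \<alpha>) = rate 0"
    by (simp add: rate_eq a_def)
  also have "\<alpha> * Gamma \<alpha> / real j * (Gamma (1 - \<alpha>) / \<alpha> * (rate j - rate 0))
    = (Gamma \<alpha> * Gamma (1 - \<alpha>)) * ((rate j - rate 0) / real j)"
    using \<alpha>_pos by simp
  finally show ?thesis unfolding Gamma_reflection_real .
qed

text \<open>Every integral against the kernel is a positive combination of integrals against powers
  \<open>y\<^sup>r\<close> with \<open>r \<ge> 2\<close>.  This serves both to evaluate the operator on monomials and to find the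
  sign of its jump part at a minimum.\<close>

lemma kernel_integral_sums:
  assumes H: "continuous_on {0..1} H"
  shows "(\<lambda>k. kernel_coeff k * integral {0..1} (\<lambda>y. H y * y powr kernel_exponent k))
    sums (LINT y:{0<..<1}|lborel. H y * gl_kernel \<alpha> \<beta> y)"
    and "set_integrable lborel {0<..<1} (\<lambda>y. H y * gl_kernel \<alpha> \<beta> y)"
proof -
  define f where "f k y = indicator {0<..<1} y * (kernel_coeff k * (H y * y powr kernel_exponent k))" for k y
  have "bounded (H ` {0..1})"
    by (intro compact_imp_bounded compact_continuous_image H) simp
  then obtain C where C: "C > 0" "\<And>y. y \<in> {0..1} \<Longrightarrow> \<bar>H y\<bar> \<le> C"
    unfolding bounded_pos by (auto simp: image_iff)
  have r: "0 < kernel_exponent k" for k using kernel_exponent_ge[of k] by linarith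
  have cont: "continuous_on {0..1} (\<lambda>y. H y * y powr kernel_exponent k)" for k
    using r by (intro continuous_intros continuous_on_powr' H) auto
  have int: "set_integrable lborel {0<..<1} (\<lambda>y. H y * y powr kernel_exponent k)" for k
    by (rule set_integrable_subset[OF borel_integrable_atLeastAtMost'[OF cont]]) auto
  have f_int: "integrable lborel (f k)" for k
    using integrable_mult_right[OF int[unfolded set_integrable_def], of "kernel_coeff k" k]
    unfolding f_def by (simp only: real_scaleR_def mult.left_commute[of "kernel_coeff k"])
  have f_LINT: "(LINT y|lborel. f k y) = kernel_coeff k * integral {0..1} (\<lambda>y. H y * y powr kernel_exponent k)" for k
  proof -
    have "(LINT y|lborel. f k y) = kernel_coeff k * (LINT y:{0<..<1}|lborel. H y * y powr kernel_exponent k)"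
      unfolding set_lebesgue_integral_def f_def real_scaleR_def integral_mult_right_zero[symmetric]
      by (simp only: mult.left_commute[of "kernel_coeff k"])
    also have "(LINT y:{0<..<1}|lborel. H y * y powr kernel_exponent k) = integral {0..1} (\<lambda>y. H y * y powr kernel_exponent k)"
      using set_borel_integral_eq_integral(2)[OF int] by (simp add: integral_open_interval_real)
    finally show ?thesis .
  qed
  have f_norm: "(LINT y|lborel. norm (f k y)) \<le> C * (kernel_coeff k / (kernel_exponent k + 1))" for k
  proof -
    have P: "((\<lambda>y. y powr kernel_exponent k) has_integral (1 / (kernel_exponent k + 1))) {0..1}"
      using has_integral_powr_from_0[of "kernel_exponent k" 1] r[of k] by simp
    have Pc: "continuous_on {0..1} (\<lambda>y. y powr kernel_exponent k)"
      using r by (intro continuous_intros continuous_on_powr') auto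
    have Pi: "set_integrable lborel {0..1} (\<lambda>y. y powr kernel_exponent k)"
      by (rule borel_integrable_atLeastAtMost'[OF Pc])
    have "(LINT y|lborel. norm (f k y)) \<le> (LINT y|lborel. C * kernel_coeff k * (indicator {0..1} y * y powr kernel_exponent k))"
    proof (rule integral_mono)
      show "integrable lborel (\<lambda>y. norm (f k y))" using f_int by simp
      show "integrable lborel (\<lambda>y. C * kernel_coeff k * (indicator {0..1} y * y powr kernel_exponent k))"
        using integrable_mult_right[OF Pi[unfolded set_integrable_def], of "C * kernel_coeff k"] by simp
      fix y
      show "norm (f k y) \<le> C * kernel_coeff k * (indicator {0..1} y * y powr kernel_exponent k)"
      proof (cases "y \<in> {0<..<1}")
        case True
        then have "norm (f k y) = \<bar>H y\<bar> * (kernel_coeff k * y powr kernel_exponent k)"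
          using kernel_coeff_pos[of k] by (simp add: f_def abs_mult)
        also have "\<dots> \<le> C * (kernel_coeff k * y powr kernel_exponent k)"
          using True C(2)[of y] kernel_coeff_pos[of k] by (intro mult_right_mono) auto
        finally show ?thesis using True by (simp add: mult.assoc)
      next
        case False
        then show ?thesis using C(1) kernel_coeff_pos[of k] by (simp add: f_def)
      qed
    qed
    also have "\<dots> = C * kernel_coeff k * (LINT y:{0..1}|lborel. y powr kernel_exponent k)"
      by (simp add: set_lebesgue_integral_def)
    also have "(LINT y:{0..1}|lborel. y powr kernel_exponent k) = 1 / (kernel_exponent k + 1)"
      using set_borel_integral_eq_integral(2)[OF Pi] integral_unique[OF P] by simp
    finally show ?thesis by simp
  qed
  have f_summ: "summable (\<lambda>k. LINT y|lborel. norm (f k y))"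
  proof (rule summable_comparison_test')
    show "summable (\<lambda>k. C * (kernel_coeff k / (kernel_exponent k + 1)))"
      using kernel_moment_sums[of 1] by (intro summable_mult) (auto simp: sums_iff)
  qed (use f_norm in auto)
  have f_sums: "(\<lambda>k. f k y) sums (indicator {0<..<1} y * (H y * gl_kernel \<alpha> \<beta> y))" for y
  proof (cases "y \<in> {0<..<1}")
    case True
    then show ?thesis
      using sums_mult[OF gl_kernel_sums[of y], of "H y"] by (simp add: f_def mult.left_commute)
  qed (simp add: f_def)
  have f_ae: "AE y in lborel. summable (\<lambda>k. norm (f k y))"
  proof (intro AE_I2)
    fix y :: real
    show "summable (\<lambda>k. norm (f k y))"
    proof (cases "y \<in> {0<..<1}")
      case True
      then have "summable (\<lambda>k. \<bar>H y\<bar> * (kernel_coeff k * y powr kernel_exponent k))"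
        using gl_kernel_sums[of y] by (intro summable_mult) (auto simp: sums_iff)
      moreover have "norm (f k y) = \<bar>H y\<bar> * (kernel_coeff k * y powr kernel_exponent k)" for k
        using True kernel_coeff_pos[of k] by (simp add: f_def abs_mult)
      ultimately show ?thesis by simp
    qed (simp add: f_def)
  qed
  have s: "(\<Sum>k. f k y) = indicator {0<..<1} y *\<^sub>R (H y * gl_kernel \<alpha> \<beta> y)" for y
    using f_sums[of y] by (simp add: sums_iff)
  show "set_integrable lborel {0<..<1} (\<lambda>y. H y * gl_kernel \<alpha> \<beta> y)"
    using integrable_suminf[OF f_int f_ae f_summ] unfolding s set_integrable_def .
  show "(\<lambda>k. kernel_coeff k * integral {0..1} (\<lambda>y. H y * y powr kernel_exponent k))
    sums (LINT y:{0<..<1}|lborel. H y * gl_kernel \<alpha> \<beta> y)"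
    using sums_integral[OF f_int f_ae f_summ] unfolding s f_LINT set_lebesgue_integral_def .
qed

end

section \<open>The operator on polynomials\<close>

definition rescale :: "(nat \<Rightarrow> real) \<Rightarrow> real poly \<Rightarrow> real poly" where
  "rescale c p = (\<Sum>k\<le>degree p. monom (c k * coeff p k) k)"

lemma coeff_rescale [simp]: "coeff (rescale c p) k = c k * coeff p k"
proof -
  have "coeff (rescale c p) k = (\<Sum>i\<le>degree p. if i = k then c i * coeff p i else 0)"
    by (simp add: rescale_def coeff_sum)
  also have "\<dots> = c k * coeff p k"
    by (auto simp: not_le coeff_eq_0)
  finally show ?thesis .
qed

lemma rescale_add: "rescale c (p + q) = rescale c p + rescale c q"
  by (rule poly_eqI) (simp add: algebra_simps)

lemma rescale_smult: "rescale c (smult a p) = smult a (rescale c p)"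
  by (rule poly_eqI) simp

lemma rescale_0: "rescale c 0 = 0"
  by (rule poly_eqI) simp

lemma rescale_monom: "rescale c (monom a n) = monom (c n * a) n"
  by (rule poly_eqI) simp

lemma rescale_rescale: "rescale c (rescale d p) = rescale (\<lambda>k. c k * d k) p"
  by (rule poly_eqI) simp

lemma rescale_id: "(\<And>k. c k = 1) \<Longrightarrow> rescale c p = p"
  by (rule poly_eqI) simp

lemma degree_rescale:
  assumes "\<And>k. c k \<noteq> 0"
  shows "degree (rescale c p) = degree p"
proof (rule antisym)
  show "degree (rescale c p) \<le> degree p"
    by (intro degree_le) (simp add: coeff_eq_0)
  show "degree p \<le> degree (rescale c p)"
  proof (intro degree_le allI impI)
    fix k assume "degree (rescale c p) < k"
    then have "coeff (rescale c p) k = 0" by (rule coeff_eq_0)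
    then show "coeff p k = 0" using assms by simp
  qed
qed

lemma poly_eq_sum_le_degree:
  fixes p :: "real poly"
  assumes "degree p \<le> n"
  shows "poly p x = (\<Sum>k\<le>n. coeff p k * x ^ k)"
proof -
  have "(\<Sum>k\<le>degree p. coeff p k * x ^ k) = (\<Sum>k\<le>n. coeff p k * x ^ k)"
    using assms by (intro sum.mono_neutral_left) (auto simp: coeff_eq_0)
  then show ?thesis by (simp add: poly_altdef)
qed

lemma poly_eq_sum_pos_degree:
  fixes p :: "real poly"
  assumes "poly p 0 = 0"
  shows "poly p x = (\<Sum>k\<in>{1..degree p}. coeff p k * x ^ k)"
proof -
  have "coeff p 0 = 0" using assms by (simp add: poly_0_coeff_0)
  then show ?thesis
    unfolding poly_altdef by (intro sum.mono_neutral_right) (auto simp: not_less_eq_eq)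
qed

lemma deriv_poly: "deriv (poly p) = poly (pderiv p)" for p :: "real poly"
  by (rule ext) (rule DERIV_imp_deriv[OF poly_DERIV])

text \<open>Integration by parts against \<open>y\<^sup>r\<close>, twice: \<open>h'(y) y\<^sup>r - r (h(y) - h(1)) y\<^sup>r\<^sup>-\<^sup>1\<close> has
  the derivative \<open>h''(y) y\<^sup>r - r (r - 1) (h(y) - h(1)) y\<^sup>r\<^sup>-\<^sup>2\<close> and vanishes at both ends.\<close>

lemma integral_second_derivative_powr_nonneg:
  fixes h :: "real poly" and r :: real
  assumes r: "1 < r" and stat: "poly (pderiv h) 1 = 0"
    and min: "\<And>y. y \<in> {0..1} \<Longrightarrow> poly h 1 \<le> poly h y"
  shows "0 \<le> integral {0..1} (\<lambda>y. poly (pderiv (pderiv h)) y * y powr r)"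
proof -
  define F where "F y = poly (pderiv h) y * y powr r - r * (poly h y - poly h 1) * y powr (r - 1)" for y
  define f where "f y = poly (pderiv (pderiv h)) y * y powr r
    - r * (r - 1) * (poly h y - poly h 1) * y powr (r - 2)" for y
  have "(f has_integral (F 1 - F 0)) {0..1}"
  proof (rule fundamental_theorem_of_calculus_interior)
    show "continuous_on {0..1} F"
      unfolding F_def using r by (intro continuous_intros continuous_on_powr') auto
    fix y :: real assume y: "y \<in> {0<..<1}"
    have "(F has_real_derivative f y) (at y)"
    proof -
      have "(F has_real_derivative
        (poly (pderiv (pderiv h)) y * y powr r + poly (pderiv h) y * (r * y powr (r - 1))
        - (r * poly (pderiv h) y * y powr (r - 1)
           + r * (poly h y - poly h 1) * ((r - 1) * y powr (r - 1 - 1))))) (at y)"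
        unfolding F_def using y
        by (auto intro!: derivative_eq_intros poly_DERIV simp: algebra_simps)
      then show ?thesis by (simp add: f_def algebra_simps)
    qed
    then show "(F has_vector_derivative f y) (at y)"
      by (simp add: has_real_derivative_iff_has_vector_derivative)
  qed simp
  then have f: "(f has_integral 0) {0..1}"
    using r stat by (simp add: F_def)
  have g: "((\<lambda>y. poly (pderiv (pderiv h)) y * y powr r) has_integral
    integral {0..1} (\<lambda>y. poly (pderiv (pderiv h)) y * y powr r)) {0..1}"
    using r by (intro integrable_integral integrable_continuous_real continuous_intros continuous_on_powr') auto
  show ?thesis
  proof (rule has_integral_le[OF f g])
    fix y :: real assume "y \<in> {0..1}"
    then have "0 \<le> r * (r - 1) * (poly h y - poly h 1) * y powr (r - 2)"
      using r min[of y] by simp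
    then show "f y \<le> poly (pderiv (pderiv h)) y * y powr r" by (simp add: f_def)
  qed
qed

context gauss_laguerre_parameters
begin

text \<open>The intertwining operator \<open>y\<^sup>n \<mapsto> x\<^sup>n / moment n\<close> carries the generator of the flow
  \<open>y' = 1 - y\<close> to the Gauss-Laguerre operator.\<close>

definition \<Lambda> :: "real poly \<Rightarrow> real poly" where
  "\<Lambda> = rescale (\<lambda>k. 1 / moment k)"

definition \<Lambda>_inv :: "real poly \<Rightarrow> real poly" where
  "\<Lambda>_inv = rescale moment"

definition generator :: "real poly \<Rightarrow> real poly" where
  "generator p = \<Lambda> ([:1, -1:] * pderiv (\<Lambda>_inv p))"

lemma moment_neq_0 [simp]: "moment k \<noteq> 0"
  using moment_pos[of k] by linarith

lemma \<Lambda>_\<Lambda>_inv [simp]: "\<Lambda> (\<Lambda>_inv p) = p"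
  by (simp add: \<Lambda>_def \<Lambda>_inv_def rescale_rescale rescale_id)

lemma \<Lambda>_inv_\<Lambda> [simp]: "\<Lambda>_inv (\<Lambda> p) = p"
  by (simp add: \<Lambda>_def \<Lambda>_inv_def rescale_rescale rescale_id)

lemma \<Lambda>_linear: "\<Lambda> (p + q) = \<Lambda> p + \<Lambda> q" "\<Lambda> (smult a p) = smult a (\<Lambda> p)" "\<Lambda> 0 = 0"
  by (simp_all add: \<Lambda>_def rescale_add rescale_smult rescale_0)

lemma \<Lambda>_inv_linear: "\<Lambda>_inv (p + q) = \<Lambda>_inv p + \<Lambda>_inv q" "\<Lambda>_inv (smult a p) = smult a (\<Lambda>_inv p)"
  "\<Lambda>_inv 0 = 0"
  by (simp_all add: \<Lambda>_inv_def rescale_add rescale_smult rescale_0)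

lemma coeff_\<Lambda> [simp]: "coeff (\<Lambda> p) k = coeff p k / moment k"
  by (simp add: \<Lambda>_def)

lemma coeff_\<Lambda>_inv [simp]: "coeff (\<Lambda>_inv p) k = moment k * coeff p k"
  by (simp add: \<Lambda>_inv_def)

lemma degree_\<Lambda> [simp]: "degree (\<Lambda> p) = degree p"
  by (simp add: \<Lambda>_def degree_rescale)

lemma degree_\<Lambda>_inv [simp]: "degree (\<Lambda>_inv p) = degree p"
  by (simp add: \<Lambda>_inv_def degree_rescale)

lemma \<Lambda>_quadratic: "\<Lambda> [:x, y, z:] = [:x, y / moment 1, z / moment 2:]"
  by (rule poly_eqI) (simp add: moment_0 coeff_pCons numeral_2_eq_2 split: nat.split)

lemma \<Lambda>_inv_cubic: "\<Lambda>_inv [:x, y, z, w:] = [:x, y * moment 1, z * moment 2, w * moment 3:]"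
  by (rule poly_eqI) (simp add: moment_0 coeff_pCons numeral_2_eq_2 numeral_3_eq_3 split: nat.split)

lemma generator_add: "generator (p + q) = generator p + generator q"
  by (simp add: generator_def \<Lambda>_linear \<Lambda>_inv_linear pderiv_add distrib_left)

lemma coeff_generator:
  "coeff (generator p) n = real (Suc n) * rate n * coeff p (Suc n) - real n * coeff p n"
proof -
  have "coeff ([:1, -1:] * pderiv (\<Lambda>_inv p)) n
    = real (Suc n) * moment (Suc n) * coeff p (Suc n) - real n * moment n * coeff p n"
    by (cases n) (simp_all add: coeff_pderiv)
  then show ?thesis
    by (simp add: generator_def rate_def diff_divide_distrib)
qed

lemma kernel_power_integral:
  "(LINT y:{0<..<1}|lborel. y ^ m * gl_kernel \<alpha> \<beta> y)
    = pi / sin (\<alpha> * pi) * ((rate (Suc m) - rate 0) / real (Suc m))"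
proof -
  have "integral {0..1} (\<lambda>y. y ^ m * y powr kernel_exponent k) = 1 / (kernel_exponent k + real (Suc m))" for k
  proof (rule integral_unique)
    have r: "0 < kernel_exponent k" using kernel_exponent_ge[of k] by linarith
    have "((\<lambda>y. y powr (kernel_exponent k + real m)) has_integral (1 / (kernel_exponent k + real (Suc m)))) {0..1}"
      using has_integral_powr_from_0[of "kernel_exponent k + real m" 1] r by (simp add: add.assoc add.commute)
    then show "((\<lambda>y. y ^ m * y powr kernel_exponent k) has_integral (1 / (kernel_exponent k + real (Suc m)))) {0..1}"
      by (rule has_integral_spike[of "{0}", rotated 2]) (auto simp: powr_add powr_realpow)
  qed
  moreover have "continuous_on {0..1} (\<lambda>y::real. y ^ m)" by (intro continuous_intros)
  ultimately show ?thesis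
    using kernel_integral_sums(1)[of "\<lambda>y. y ^ m"] kernel_moment_sums[of "Suc m"]
    by (intro sums_unique2[of "\<lambda>k. kernel_coeff k / (kernel_exponent k + real (Suc m))"]) auto
qed

lemma gauss_laguerre_add:
  "gauss_laguerre \<alpha> \<beta> (poly (p + q)) x = gauss_laguerre \<alpha> \<beta> (poly p) x + gauss_laguerre \<alpha> \<beta> (poly q) x"
proof -
  have "set_integrable lborel {0<..<1} (\<lambda>y. poly r (x * y) * gl_kernel \<alpha> \<beta> y)" for r
    by (intro kernel_integral_sums(2) continuous_intros)
  from set_integral_add(2)[OF this this] show ?thesis
    by (simp add: gauss_laguerre_def deriv_poly pderiv_add algebra_simps)
qed

lemma gauss_laguerre_monom:
  "gauss_laguerre \<alpha> \<beta> (poly (monom c n)) x = poly (generator (monom c n)) x"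
proof -
  have g: "generator (monom c n) = monom (real n * rate (n - 1) * c) (n - 1) - monom (real n * c) n"
    by (rule poly_eqI) (auto simp: coeff_generator)
  show ?thesis
  proof (cases "2 \<le> n")
    case False
    then have "n = 0 \<or> n = 1" by auto
    then show ?thesis
      by (auto simp: g gauss_laguerre_def deriv_poly pderiv_monom poly_monom rate_0 set_lebesgue_integral_def algebra_simps)
  next
    case True
    then obtain m where n: "n = Suc (Suc m)" by (metis Suc_le_D numeral_2_eq_2 Suc_le_mono)
    define s where "s = sin (\<alpha> * pi) / pi"
    have s: "pi / sin (\<alpha> * pi) = 1 / s" "s \<noteq> 0"
      using sin_gt_zero[of "\<alpha> * pi"] \<alpha>_pos \<alpha>_less_1 by (auto simp: s_def)
    have d1: "poly (pderiv (monom c n)) x = real n * c * x ^ Suc m"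
      by (simp add: n pderiv_monom poly_monom)
    have "(LINT y:{0<..<1}|lborel. poly (pderiv (pderiv (monom c n))) (x * y) * gl_kernel \<alpha> \<beta> y)
      = real (Suc m) * real n * c * x ^ m * (LINT y:{0<..<1}|lborel. y ^ m * gl_kernel \<alpha> \<beta> y)"
      unfolding set_lebesgue_integral_def integral_mult_right_zero[symmetric]
      by (rule Bochner_Integration.integral_cong) (simp_all add: n pderiv_monom poly_monom power_mult_distrib)
    also have "\<dots> = real n * c * x ^ m * ((rate (Suc m) - rate 0) / s)"
      unfolding kernel_power_integral s(1) by simp
    finally have "gauss_laguerre \<alpha> \<beta> (poly (monom c n)) x
      = (rate 0 - x) * (real n * c * x ^ Suc m) + s * x * (real n * c * x ^ m * ((rate (Suc m) - rate 0) / s))"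
      using d1 unfolding gauss_laguerre_def deriv_poly rate_0[symmetric] s_def[symmetric] by simp
    also have "\<dots> = poly (generator (monom c n)) x"
      unfolding g using s(2) by (simp add: n poly_monom field_simps)
    finally show ?thesis .
  qed
qed

theorem gauss_laguerre_poly: "gauss_laguerre \<alpha> \<beta> (poly p) x = poly (generator p) x"
proof -
  have "gauss_laguerre \<alpha> \<beta> (poly (\<Sum>i\<le>n. monom (coeff p i) i)) x = poly (generator (\<Sum>i\<le>n. monom (coeff p i) i)) x" for n
  proof (induction n)
    case (Suc n)
    then show ?case unfolding sum.atMost_Suc gauss_laguerre_add generator_add
      by (simp add: gauss_laguerre_monom)
  qed (simp add: gauss_laguerre_monom)
  from this[of "degree p"] show ?thesis by (simp add: poly_as_sum_of_monoms)
qed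

text \<open>The positive maximum principle.  At \<open>0\<close> the operator is an inward drift; at an interior
  minimum the drift term vanishes and the jump term is a positive combination of the integrals
  of the preceding lemma.\<close>

theorem generator_nonneg_at_minimum:
  assumes x: "0 \<le> x" and min: "\<And>y. 0 \<le> y \<Longrightarrow> poly p x \<le> poly p y"
  shows "0 \<le> poly (generator p) x"
proof (cases "x = 0")
  case True
  have "0 \<le> poly (pderiv p) 0"
  proof (rule ccontr)
    assume "\<not> ?thesis"
    then have "poly (pderiv p) 0 < 0" by simp
    from DERIV_neg_dec_right[OF poly_DERIV this]
    obtain d where d: "d > 0" "\<And>h. 0 < h \<Longrightarrow> h < d \<Longrightarrow> poly p (0 + h) < poly p 0" by auto
    then have "poly p (d / 2) < poly p 0" using d(2)[of "d / 2"] by simp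
    then show False using min[of "d / 2"] d(1) True by simp
  qed
  moreover have "poly (generator p) 0 = rate 0 * poly (pderiv p) 0"
    by (simp add: poly_0_coeff_0 coeff_generator coeff_pderiv)
  ultimately show ?thesis using rate_pos[of 0] True by simp
next
  case False
  with x have x: "0 < x" by simp
  have stat: "poly (pderiv p) x = 0"
    by (rule DERIV_local_min[OF poly_DERIV x]) (auto intro!: min)
  define h where "h = pcompose p [:0, x:]"
  have h: "poly h y = poly p (x * y)" "poly (pderiv h) y = x * poly (pderiv p) (x * y)"
    "poly (pderiv (pderiv h)) y = x\<^sup>2 * poly (pderiv (pderiv p)) (x * y)" for y
    by (simp_all add: h_def poly_pcompose pderiv_pcompose pderiv_mult pderiv_smult pderiv_pCons power2_eq_square mult.commute)
  have nonneg: "0 \<le> integral {0..1} (\<lambda>y. poly (pderiv (pderiv p)) (x * y) * y powr kernel_exponent k)" for k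
  proof -
    have "0 \<le> integral {0..1} (\<lambda>y. poly (pderiv (pderiv h)) y * y powr kernel_exponent k)"
      using kernel_exponent_ge[of k] x stat
      by (intro integral_second_derivative_powr_nonneg) (auto simp: h intro!: min)
    also have "\<dots> = x\<^sup>2 * integral {0..1} (\<lambda>y. poly (pderiv (pderiv p)) (x * y) * y powr kernel_exponent k)"
      by (simp add: h mult.assoc)
    finally show ?thesis using x by (simp add: zero_le_mult_iff)
  qed
  have "0 \<le> (LINT y:{0<..<1}|lborel. poly (pderiv (pderiv p)) (x * y) * gl_kernel \<alpha> \<beta> y)"
  proof (rule sums_le[OF _ sums_zero kernel_integral_sums(1)])
    show "continuous_on {0..1} (\<lambda>y. poly (pderiv (pderiv p)) (x * y))" by (intro continuous_intros)
    show "0 \<le> kernel_coeff k * integral {0..1} (\<lambda>y. poly (pderiv (pderiv p)) (x * y) * y powr kernel_exponent k)" for k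
      using nonneg[of k] kernel_coeff_pos[of k] by simp
  qed
  moreover have "0 < sin (\<alpha> * pi)"
    using sin_gt_zero[of "\<alpha> * pi"] \<alpha>_pos \<alpha>_less_1 by simp
  ultimately have "0 \<le> sin (\<alpha> * pi) / pi * x * (LINT y:{0<..<1}|lborel. deriv (deriv (poly p)) (x * y) * gl_kernel \<alpha> \<beta> y)"
    using x by (intro mult_nonneg_nonneg) (auto simp: deriv_poly)
  then show ?thesis
    using stat unfolding gauss_laguerre_poly[symmetric] gauss_laguerre_def by (simp add: deriv_poly)
qed

end

section \<open>The semigroup on polynomials\<close>

text \<open>A parabolic minimum principle: if \<open>u t x + \<epsilon> (1 + t)\<close> were not positive everywhere, it would
  vanish for a first time, at a minimum in \<open>x\<close>, and there its time derivative would be positive.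
  The positive leading coefficients confine the minimum to a compact set.\<close>

lemma polynomial_flow_nonneg:
  fixes u :: "real \<Rightarrow> real poly" and G :: "real poly \<Rightarrow> real poly"
  assumes deg: "\<And>t. degree (u t) \<le> n" and degG: "\<And>p. degree (G p) \<le> degree p"
    and deriv: "\<And>t k. ((\<lambda>t. coeff (u t) k) has_real_derivative coeff (G (u t)) k) (at t)"
    and lead: "\<And>t. 0 < coeff (u t) n"
    and G_min: "\<And>p x. 0 \<le> x \<Longrightarrow> (\<And>y. 0 \<le> y \<Longrightarrow> poly p x \<le> poly p y) \<Longrightarrow> 0 \<le> poly (G p) x"
    and init: "\<And>x. 0 \<le> x \<Longrightarrow> 0 \<le> poly (u 0) x"
    and T: "0 \<le> T" and X: "0 \<le> X"
  shows "0 \<le> poly (u T) X"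
proof (rule field_le_epsilon)
  fix \<epsilon>' :: real assume "0 < \<epsilon>'"
  define \<epsilon> where "\<epsilon> = \<epsilon>' / (1 + T)"
  have \<epsilon>: "\<epsilon> > 0" using \<open>0 < \<epsilon>'\<close> T by (simp add: \<epsilon>_def)
  define v where "v t x = poly (u t) x + \<epsilon> * (1 + t)" for t x
  have coeff_cont: "continuous_on A (\<lambda>t. coeff (u t) k)" for A k
    by (rule DERIV_continuous_on) (rule DERIV_subset[OF deriv], simp)
  have poly_u: "poly (u t) x = (\<Sum>k\<le>n. coeff (u t) k * x ^ k)" for t x
    by (rule poly_eq_sum_le_degree[OF deg])
  have v_cont: "continuous_on UNIV (\<lambda>z. v (fst z) (snd z))"
    unfolding v_def poly_u
    by (intro continuous_intros continuous_on_compose2[OF coeff_cont[of UNIV]]) auto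
  have v_deriv: "((\<lambda>t. v t x) has_real_derivative (poly (G (u t)) x + \<epsilon>)) (at t)" for t x
  proof -
    have "degree (G (u t)) \<le> n" using degG[of "u t"] deg[of t] by linarith
    then have e: "poly (G (u t)) x = (\<Sum>k\<le>n. coeff (G (u t)) k * x ^ k)"
      by (rule poly_eq_sum_le_degree)
    show ?thesis
      unfolding v_def poly_u e by (auto intro!: derivative_eq_intros deriv)
  qed
  \<comment> \<open>The points where \<open>v\<close> has failed to stay positive; a point of \<open>K\<close> with least \<open>t\<close> is
    a first zero.\<close>
  define K where "K = {z. 0 \<le> fst z \<and> fst z \<le> T \<and> 0 \<le> snd z \<and> v (fst z) (snd z) \<le> 0}"
  have "K = {}"
  proof (rule ccontr)
    assume "K \<noteq> {}"
    have "\<exists>A. \<forall>t\<in>{0..T}. \<bar>coeff (u t) k\<bar> \<le> A" for k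
      using compact_imp_bounded[OF compact_continuous_image[OF coeff_cont[of "{0..T}" k]]]
      by (auto simp: bounded_iff)
    then obtain A where A: "\<And>k t. t \<in> {0..T} \<Longrightarrow> \<bar>coeff (u t) k\<bar> \<le> A k"
      using choice[of "\<lambda>k A. \<forall>t\<in>{0..T}. \<bar>coeff (u t) k\<bar> \<le> A"] by blast
    define B where "B = (\<Sum>k<n. A k)"
    obtain t1 where t1: "t1 \<in> {0..T}" "\<And>t. t \<in> {0..T} \<Longrightarrow> coeff (u t1) n \<le> coeff (u t) n"
      using continuous_attains_inf[of "{0..T}" "\<lambda>t. coeff (u t) n"] coeff_cont T by auto
    define \<delta> where "\<delta> = coeff (u t1) n"
    have \<delta>: "\<delta> > 0" using lead by (simp add: \<delta>_def)
    \<comment> \<open>For large \<open>x\<close> the leading term, bounded below by \<open>\<delta> x\<^sup>n\<close>, dominates the others.\<close>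
    have bnd: "0 \<le> poly (u t) x" if t: "t \<in> {0..T}" and x: "x \<ge> 1" "x \<ge> B / \<delta>" for t x
    proof -
      have "x * (\<Sum>k<n. - (coeff (u t) k * x ^ k)) \<le> x * (\<Sum>k<n. A k * x ^ (n - 1))"
      proof (intro mult_left_mono sum_mono)
        fix k assume k: "k \<in> {..<n}"
        have "- (coeff (u t) k * x ^ k) \<le> A k * x ^ k"
          using A[OF t, of k] x mult_right_mono[of "- coeff (u t) k" "A k" "x ^ k"] by simp
        also have "\<dots> \<le> A k * x ^ (n - 1)"
          using k x A[OF t, of k] by (intro mult_left_mono power_increasing) auto
        finally show "- (coeff (u t) k * x ^ k) \<le> A k * x ^ (n - 1)" .
      qed (use x in auto)
      also have "\<dots> = B * x ^ n"
        by (cases n) (simp_all add: B_def mult.left_commute mult.commute flip: sum_distrib_right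
            del: sum.lessThan_Suc)
      also have "\<dots> \<le> x * \<delta> * x ^ n"
        using x \<delta> by (intro mult_right_mono) (auto simp: divide_le_eq)
      also have "\<dots> \<le> x * (coeff (u t) n * x ^ n)"
        using t1(2)[OF t] x unfolding mult.assoc by (intro mult_left_mono mult_right_mono) (auto simp: \<delta>_def)
      finally have "(\<Sum>k<n. - (coeff (u t) k * x ^ k)) \<le> coeff (u t) n * x ^ n"
        using x by (subst (asm) mult_le_cancel_left_pos) auto
      then show ?thesis
        by (simp add: poly_u sum_negf lessThan_Suc_atMost[symmetric])
    qed
    have "bounded K"
    proof (rule bounded_subset)
      show "K \<subseteq> {0..T} \<times> {0..max 1 (B / \<delta>)}"
      proof
        fix z assume z: "z \<in> K"
        have "snd z \<le> max 1 (B / \<delta>)"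
        proof (rule ccontr)
          assume "\<not> ?thesis"
          then have "0 \<le> poly (u (fst z)) (snd z)" using z by (intro bnd) (auto simp: K_def)
          moreover have "0 < \<epsilon> * (1 + fst z)" using z \<epsilon> by (simp add: K_def)
          ultimately show False using z by (simp add: K_def v_def)
        qed
        then show "z \<in> {0..T} \<times> {0..max 1 (B / \<delta>)}" using z by (auto simp: K_def mem_Times_iff)
      qed
      show "bounded ({0..T} \<times> {0..max 1 (B / \<delta>)})" by (intro bounded_Times bounded_closed_interval)
    qed
    moreover have "closed K"
      unfolding K_def by (intro closed_Collect_conj closed_Collect_le continuous_intros v_cont)
    ultimately have "compact K" by (simp add: compact_eq_bounded_closed)
    then obtain z where z: "z \<in> K" "\<And>y. y \<in> K \<Longrightarrow> fst z \<le> fst y"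
      using continuous_attains_inf[OF _ \<open>K \<noteq> {}\<close> continuous_on_fst[OF continuous_on_id]] by blast
    define t x where "t = fst z" and "x = snd z"
    have tx: "0 \<le> t" "t \<le> T" "0 \<le> x" "v t x \<le> 0" using z by (auto simp: K_def t_def x_def)
    have before: "0 < v s y" if "0 \<le> s" "s < t" "0 \<le> y" for s y
      using z(2)[of "(s, y)"] that tx by (force simp: K_def t_def)
    have "t \<noteq> 0"
    proof
      assume "t = 0"
      then have "0 \<le> poly (u t) x" using init tx by simp
      then show False using tx \<epsilon> \<open>t = 0\<close> by (simp add: v_def)
    qed
    then have t: "t > 0" using tx by simp
    have now: "0 \<le> v t y" if y: "0 \<le> y" for y
    proof -
      have "(\<lambda>m. t - t / real (Suc m)) \<longlonglongrightarrow> t - 0"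
        by (intro tendsto_intros LIMSEQ_Suc[OF lim_const_over_n])
      then have "(\<lambda>m. v (t - t / real (Suc m)) y) \<longlonglongrightarrow> v t y"
        by (intro isCont_tendsto_compose[OF DERIV_isCont[OF v_deriv]]) simp
      moreover have "0 \<le> v (t - t / real (Suc m)) y" for m
      proof (rule less_imp_le[OF before[OF _ _ y]])
        show "0 \<le> t - t / real (Suc m)"
          using t mult_left_mono[of 1 "real (Suc m)" t] by (simp add: divide_le_eq)
        show "t - t / real (Suc m) < t" using t by simp
      qed
      ultimately show ?thesis by (blast intro: LIMSEQ_le_const)
    qed
    have "0 \<le> poly (G (u t)) x"
    proof (rule G_min)
      show "0 \<le> x" by (rule tx)
      fix y :: real assume "0 \<le> y"
      then show "poly (u t) x \<le> poly (u t) y" using now[of y] tx by (simp add: v_def)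
    qed
    with \<epsilon> have "0 < poly (G (u t)) x + \<epsilon>" by simp
    from DERIV_pos_inc_left[OF v_deriv this]
    obtain d where d: "d > 0" "\<And>h. h > 0 \<Longrightarrow> h < d \<Longrightarrow> v (t - h) x < v t x" by blast
    define h where "h = min (d / 2) t"
    have h: "0 < h" "h < d" "h \<le> t" using d t by (auto simp: h_def min_def)
    then have "0 < v (t - h) x" using tx by (intro before) auto
    then show False using d(2)[OF h(1,2)] tx by linarith
  qed
  then have "(T, X) \<notin> K" by simp
  then have "0 < poly (u T) X + \<epsilon> * (1 + T)"
    using T X by (simp add: K_def v_def)
  then show "0 \<le> poly (u T) X + \<epsilon>'"
    using T by (simp add: \<epsilon>_def)
qed

text \<open>The chain rule for \<open>q(1 - e + e y)\<close> in the variable \<open>e\<close>, for each coefficient in \<open>y\<close>.\<close>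

lemma coeff_pcompose_affine_has_derivative:
  "((\<lambda>e. coeff (pcompose q [:1 - e, e:]) k) has_real_derivative
    coeff ([:-1, 1:] * pcompose (pderiv q) [:1 - e, e:]) k) (at e)"
proof (induction q arbitrary: k)
  case 0
  then show ?case by simp
next
  case (pCons a q)
  have expand: "coeff ([:c, d:] * r) k = c * coeff r k + (if k = 0 then 0 else d * coeff r (k - 1))"
    for c d :: real and r k
    by (cases k) auto
  define c where "c j e = coeff (pcompose q [:1 - e, e:]) j" for j e
  define d where "d j = coeff ([:-1, 1:] * pcompose (pderiv q) [:1 - e, e:]) j" for j
  have cd: "(c j has_real_derivative d j) (at e)" for j
    unfolding c_def d_def by (rule pCons.IH)
  have "((\<lambda>e. coeff [:a:] k + ((1 - e) * c k e + (if k = 0 then 0 else e * c (k - 1) e)))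
    has_real_derivative (- c k e + (1 - e) * d k + (if k = 0 then 0 else c (k - 1) e + e * d (k - 1)))) (at e)"
    by (cases "k = 0") (auto intro!: derivative_eq_intros cd)
  moreover have "coeff (pcompose (pCons a q) [:1 - e, e:]) k = coeff [:a:] k + ((1 - e) * c k e
      + (if k = 0 then 0 else e * c (k - 1) e))" for e
    unfolding pcompose_pCons coeff_add expand c_def by simp
  moreover have "coeff ([:-1, 1:] * pcompose (pderiv (pCons a q)) [:1 - e, e:]) k
    = - c k e + (1 - e) * d k + (if k = 0 then 0 else c (k - 1) e + e * d (k - 1))"
  proof -
    have "[:-1, 1:] * pcompose (pderiv (pCons a q)) [:1 - e, e:]
      = [:-1, 1:] * pcompose q [:1 - e, e:] + [:1 - e, e:] * ([:-1, 1:] * pcompose (pderiv q) [:1 - e, e:])"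
      unfolding pderiv_pCons pcompose_add pcompose_pCons by (simp only: distrib_left mult_ac) simp
    then show ?thesis unfolding c_def d_def by (simp only: coeff_add expand) simp
  qed
  ultimately show ?case by (simp only:)
qed

context gauss_laguerre_parameters
begin

text \<open>The semigroup on polynomials at time \<open>t\<close>, as a function of \<open>e = exp (-t)\<close>.\<close>

definition transition :: "real \<Rightarrow> real poly \<Rightarrow> real poly" where
  "transition e p = \<Lambda> (pcompose (\<Lambda>_inv p) [:1 - e, e:])"

lemma transition_add: "transition e (p + q) = transition e p + transition e q"
  by (simp add: transition_def \<Lambda>_linear \<Lambda>_inv_linear pcompose_add)

lemma transition_smult: "transition e (smult a p) = smult a (transition e p)"
  by (simp add: transition_def \<Lambda>_linear \<Lambda>_inv_linear pcompose_smult)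

lemma transition_diff: "transition e (p - q) = transition e p - transition e q"
  using transition_add[of e p "smult (-1) q"] transition_smult[of e "-1" q] by simp

lemma transition_0: "transition e 0 = 0"
  using transition_smult[of e 0 0] by simp

lemma transition_sum: "transition e (\<Sum>i\<in>I. p i) = (\<Sum>i\<in>I. transition e (p i))"
  by (induction I rule: infinite_finite_induct) (auto simp: transition_add transition_0)

lemma transition_const: "transition e [:c:] = [:c:]"
proof -
  have "\<Lambda>_inv [:c:] = [:c:]"
    by (rule poly_eqI) (simp add: moment_0 coeff_pCons split: nat.split)
  moreover have "\<Lambda> [:c:] = [:c:]"
    by (rule poly_eqI) (simp add: moment_0 coeff_pCons split: nat.split)
  ultimately show ?thesis by (simp add: transition_def pcompose_const)
qed

lemma transition_1: "transition 1 p = p"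
  by (simp add: transition_def pcompose_idR)

lemma transition_transition: "transition e (transition e' p) = transition (e * e') p"
proof -
  have "pcompose [:1 - e', e':] [:1 - e, e:] = [:1 - e * e', e * e':]"
    by (simp add: pcompose_pCons algebra_simps)
  then show ?thesis
    by (simp add: transition_def pcompose_assoc[symmetric])
qed

lemma degree_transition: "degree (transition e p) \<le> degree p"
proof -
  have "degree (pcompose (\<Lambda>_inv p) [:1 - e, e:]) \<le> degree p * degree [:1 - e, e:]"
    using degree_pcompose_le[of "\<Lambda>_inv p" "[:1 - e, e:]"] by simp
  also have "\<dots> \<le> degree p * 1" by (intro mult_left_mono) auto
  finally show ?thesis by (simp add: transition_def)
qed

lemma coeff_transition_degree:
  assumes "e \<noteq> 0"
  shows "coeff (transition e p) (degree p) = e ^ degree p * coeff p (degree p)"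
proof -
  have "lead_coeff (pcompose (\<Lambda>_inv p) [:1 - e, e:]) = lead_coeff (\<Lambda>_inv p) * e ^ degree p"
    using lead_coeff_comp[of "[:1 - e, e:]" "\<Lambda>_inv p"] assms by simp
  then show ?thesis
    using assms by (simp add: transition_def degree_pcompose)
qed

lemma degree_generator: "degree (generator p) \<le> degree p"
  by (intro degree_le) (simp add: coeff_generator coeff_eq_0)

lemma transition_has_derivative:
  "((\<lambda>t. coeff (transition (exp (- t)) p) k) has_real_derivative
    coeff (generator (transition (exp (- t)) p)) k) (at t)"
proof -
  let ?e = "exp (- t)" and ?q = "\<Lambda>_inv p"
  have "((\<lambda>t. coeff (pcompose ?q [:1 - exp (- t), exp (- t):]) k) has_real_derivative
    coeff ([:-1, 1:] * pcompose (pderiv ?q) [:1 - ?e, ?e:]) k * (- ?e)) (at t)"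
    by (rule DERIV_chain2[OF coeff_pcompose_affine_has_derivative]) (auto intro!: derivative_eq_intros)
  also have "coeff ([:-1, 1:] * pcompose (pderiv ?q) [:1 - ?e, ?e:]) k * (- ?e)
    = coeff ([:1, -1:] * pderiv (pcompose ?q [:1 - ?e, ?e:])) k"
  proof -
    have "[:1, -1:] * pderiv (pcompose ?q [:1 - ?e, ?e:])
      = [:1, -1:] * (pcompose (pderiv ?q) [:1 - ?e, ?e:] * [:?e:])"
      by (simp add: pderiv_pcompose pderiv_pCons)
    also have "\<dots> = smult (- ?e) ([:-1, 1:] * pcompose (pderiv ?q) [:1 - ?e, ?e:])"
      by (simp add: smult_add_right smult_diff_right)
    finally show ?thesis by (simp only: coeff_smult mult.commute)
  qed
  finally have "((\<lambda>t. coeff (pcompose ?q [:1 - exp (- t), exp (- t):]) k / moment k) has_real_derivative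
    coeff ([:1, -1:] * pderiv (pcompose ?q [:1 - ?e, ?e:])) k / moment k) (at t)"
    by (rule DERIV_cdivide)
  then show ?thesis
    by (simp only: transition_def generator_def coeff_\<Lambda> \<Lambda>_inv_\<Lambda>)
qed

text \<open>The generator satisfies the positive maximum principle, and the flow multiplies the leading
  coefficient by \<open>exp (- n t)\<close>, so it remains positive.\<close>

theorem transition_nonneg:
  assumes p: "\<And>y. 0 \<le> y \<Longrightarrow> 0 \<le> poly p y" and t: "0 \<le> t" and x: "0 \<le> x"
  shows "0 \<le> poly (transition (exp (- t)) p) x"
proof (cases "p = 0")
  case True
  then show ?thesis using transition_smult[of _ 0 0] by simp
next
  case False
  have lc: "0 < lead_coeff p"
  proof (rule ccontr)
    assume "\<not> 0 < lead_coeff p"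
    then have "0 < lead_coeff (- p)" using False by (simp add: not_less order.order_iff_strict)
    from poly_pinfty_gt_lc[OF this] obtain m where m: "\<And>x. x \<ge> m \<Longrightarrow> lead_coeff (- p) \<le> poly (- p) x" by blast
    have "lead_coeff (- p) \<le> poly (- p) (max m 0)" "0 \<le> poly p (max m 0)"
      by (intro m p; simp)+
    with \<open>0 < lead_coeff (- p)\<close> show False by simp
  qed
  show ?thesis
  proof (rule polynomial_flow_nonneg[where n = "degree p" and G = generator
        and u = "\<lambda>t. transition (exp (- t)) p"])
    show "0 < coeff (transition (exp (- t)) p) (degree p)" for t
      using lc by (simp add: coeff_transition_degree)
  qed (use degree_transition degree_generator transition_has_derivative generator_nonneg_at_minimum
        p t x in \<open>simp_all add: transition_1\<close>)
qed

text \<open>Positivity for \<open>(p - c)\<^sup>2\<close>, where \<open>c\<close> is the value of the semigroup on \<open>p\<close> at the given point.\<close>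

lemma transition_square:
  assumes t: "0 \<le> t" and x: "0 \<le> x"
  shows "(poly (transition (exp (- t)) p) x)\<^sup>2 \<le> poly (transition (exp (- t)) (p * p)) x"
proof -
  define c where "c = poly (transition (exp (- t)) p) x"
  have "0 \<le> poly (transition (exp (- t)) ((p - [:c:]) * (p - [:c:]))) x"
    by (rule transition_nonneg[OF _ t x]) simp
  also have "(p - [:c:]) * (p - [:c:]) = p * p - smult (2 * c) p + [:c * c:]"
    by (simp add: algebra_simps flip: smult_add_left)
  finally show ?thesis
    by (simp add: transition_add transition_diff transition_smult transition_const c_def[symmetric] power2_eq_square)
qed

lemma integral_poly: "(LINT x|\<nu>. poly p x) = poly (\<Lambda>_inv p) 1"
proof -
  have "integrable \<nu> (\<lambda>x. x ^ n)" "(LINT x|\<nu>. x ^ n) = moment n" for n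
    using moment_integral[of n] by (auto simp: has_bochner_integral_iff)
  then show ?thesis
    by (simp add: poly_altdef mult.commute)
qed

lemma integral_transition: "(LINT x|\<nu>. poly (transition e p) x) = (LINT x|\<nu>. poly p x)"
  by (simp add: integral_poly transition_def poly_pcompose)

lemma transition_contraction:
  assumes t: "0 \<le> t"
  shows "L2_norm \<nu> (poly (transition (exp (- t)) p)) \<le> L2_norm \<nu> (poly p)"
proof -
  have "(LINT x|\<nu>. (poly (transition (exp (- t)) p) x)\<^sup>2) \<le> (LINT x|\<nu>. poly (transition (exp (- t)) (p * p)) x)"
    using transition_square[OF t]
    by (intro integral_mono L2_square_integrable L2_integrable L2_poly) (simp add: space_\<nu>)
  also have "\<dots> = (LINT x|\<nu>. (poly p x)\<^sup>2)"
    by (simp add: integral_transition power2_eq_square)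
  finally show ?thesis by (simp add: L2_norm_def)
qed

end

section \<open>Density of polynomials and of their squares\<close>

text \<open>The substitution \<open>u = exp (-x)\<close> turns \<open>C\<^sub>0([0,\<infinity>))\<close> into the continuous functions on
  \<open>[0,1]\<close> that vanish at \<open>0\<close>, where the Weierstrass theorem applies.\<close>

lemma C0_half_line_exp_approx:
  assumes f: "f \<in> C0_half_line" and \<epsilon>: "0 < \<epsilon>"
  shows "\<exists>r :: real poly. poly r 0 = 0 \<and> (\<forall>x\<ge>0. \<bar>f x - poly r (exp (- x))\<bar> < \<epsilon>)"
proof -
  have fc: "continuous_on {0..} f" and f0: "(f \<longlongrightarrow> 0) at_top"
    using f by (auto simp: C0_half_line_def)
  define \<phi> where "\<phi> u = (if u = 0 then 0 else f (- ln u))" for u :: real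
  have "continuous_on {0..1} \<phi>"
    unfolding continuous_on_def
  proof
    fix u :: real assume u: "u \<in> {0..1}"
    show "(\<phi> \<longlongrightarrow> \<phi> u) (at u within {0..1})"
    proof (cases "u = 0")
      case True
      have "filterlim (\<lambda>u::real. - ln u) at_top (at_right 0)"
        using ln_at_0 by (simp add: filterlim_uminus_at_bot)
      then have "((\<lambda>u. f (- ln u)) \<longlongrightarrow> 0) (at_right 0)"
        by (rule filterlim_compose[OF f0])
      then have "(\<phi> \<longlongrightarrow> 0) (at_right 0)"
        by (rule Lim_transform_eventually) (auto simp: eventually_at_filter \<phi>_def)
      then have "(\<phi> \<longlongrightarrow> 0) (at 0 within {0<..1})"
        by (rule tendsto_within_subset) auto
      moreover have "{0<..1} - {0} = {0..1} - {0::real}" by auto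
      then have "at 0 within {0<..1} = at (0::real) within {0..1}" unfolding at_within_def by simp
      ultimately have "(\<phi> \<longlongrightarrow> 0) (at 0 within {0..1})" by simp
      then show ?thesis using True by (simp add: \<phi>_def)
    next
      case False
      with u have u: "0 < u" "u \<le> 1" by auto
      have "continuous_on {0<..1} (\<lambda>u. f (- ln u))"
        by (intro continuous_on_compose2[OF fc] continuous_intros) auto
      then have "continuous_on {0<..1} \<phi>"
        by (rule continuous_on_eq) (auto simp: \<phi>_def)
      then have "(\<phi> \<longlongrightarrow> \<phi> u) (at u within {0<..1})"
        using u by (auto simp: continuous_on_def)
      moreover have "at u within {0<..1} = at u within {0..1}"
        by (rule at_within_nhd[of u "{0<..}"]) (use u in auto)
      ultimately show ?thesis by simp
    qed
  qed
  then obtain g where g: "real_polynomial_function g" "\<And>u. u \<in> {0..1} \<Longrightarrow> \<bar>\<phi> u - g u\<bar> < \<epsilon> / 2"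
    using Stone_Weierstrass_real_polynomial_function[of "{0..1}" \<phi> "\<epsilon> / 2"] \<epsilon> by auto
  then obtain a n where an: "g = (\<lambda>x. \<Sum>i\<le>n. a i * x ^ i)"
    using real_polynomial_function_iff_sum[of g] by auto
  define s where "s = (\<Sum>i\<le>n. monom (a i) i)"
  have s: "poly s u = g u" for u by (simp add: s_def an poly_sum poly_monom)
  have "\<bar>f x - poly (s - [:poly s 0:]) (exp (- x))\<bar> < \<epsilon>" if "0 \<le> x" for x
  proof -
    have "\<bar>\<phi> (exp (- x)) - g (exp (- x))\<bar> < \<epsilon> / 2" "\<bar>\<phi> 0 - g 0\<bar> < \<epsilon> / 2"
      by (rule g(2); use that in simp)+
    then show ?thesis
      using abs_triangle_ineq[of "f x - g (exp (- x))" "g 0"] by (simp add: s \<phi>_def algebra_simps)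
  qed
  then show ?thesis by (intro exI[of _ "s - [:poly s 0:]"]) simp
qed

lemma C0_half_line_bounded:
  assumes "f \<in> C0_half_line"
  shows "\<exists>B>0. \<forall>x\<ge>0. \<bar>f x\<bar> \<le> B"
proof -
  obtain r :: "real poly" where r: "\<And>x. x \<ge> 0 \<Longrightarrow> \<bar>f x - poly r (exp (- x))\<bar> < 1"
    using C0_half_line_exp_approx[OF assms, of 1] by auto
  have "compact (poly r ` {0..1})"
    by (intro compact_continuous_image continuous_intros) simp
  then obtain C where C: "\<And>u. u \<in> {0..1} \<Longrightarrow> \<bar>poly r u\<bar> \<le> C"
    using compact_imp_bounded by (fastforce simp: bounded_iff)
  have "\<bar>f x\<bar> \<le> \<bar>C\<bar> + 1" if "x \<ge> 0" for x
    using r[OF that] C[of "exp (- x)"] that by simp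
  then show ?thesis by (intro exI[of _ "\<bar>C\<bar> + 1"]) auto
qed

lemma space_half_line:
  "sets \<mu> = sets (restrict_space borel {0::real..}) \<Longrightarrow> space \<mu> = {0..}"
  using sets_eq_imp_space_eq[of \<mu>] by (simp add: space_restrict_space)

lemma continuous_on_measurable_half_line:
  fixes f :: "real \<Rightarrow> real"
  assumes "sets \<mu> = sets (restrict_space borel {0..})" "continuous_on {0..} f"
  shows "f \<in> borel_measurable \<mu>"
  by (subst measurable_cong_sets[OF assms(1) refl])
     (rule borel_measurable_continuous_on_restrict[OF assms(2)])

text \<open>Taylor polynomials, at \<open>0\<close>, of the function \<open>r (exp (- x))\<close>.\<close>

definition exp_taylor :: "real poly \<Rightarrow> nat \<Rightarrow> real poly" where
  "exp_taylor r N = (\<Sum>k\<le>degree r. smult (coeff r k) (\<Sum>n<N. monom ((- real k) ^ n / fact n) n))"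

lemma poly_exp_taylor:
  "poly (exp_taylor r N) x = (\<Sum>k\<le>degree r. coeff r k * (\<Sum>n<N. (- real k * x) ^ n / fact n))"
  by (simp add: exp_taylor_def poly_sum poly_monom flip: power_mult_distrib)

lemma exp_taylor_tendsto: "(\<lambda>N. poly (exp_taylor r N) x) \<longlonglongrightarrow> poly r (exp (- x))"
proof -
  have e: "(\<lambda>N. \<Sum>n<N. (- real k * x) ^ n / fact n) \<longlonglongrightarrow> exp (- x) ^ k" for k
  proof -
    have "(\<lambda>n. (- real k * x) ^ n / fact n) sums exp (- real k * x)"
      using exp_converges[of "- real k * x"] by (simp add: field_simps)
    then show ?thesis by (simp add: sums_def exp_of_nat_mult[symmetric])
  qed
  show ?thesis
    unfolding poly_exp_taylor poly_altdef[of r] by (intro tendsto_intros e)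
qed

lemma exp_taylor_bound:
  assumes "0 \<le> x"
  shows "\<bar>poly (exp_taylor r N) x\<bar> \<le> (\<Sum>k\<le>degree r. \<bar>coeff r k\<bar>) * exp (real (degree r) * x)"
proof -
  have "\<bar>poly (exp_taylor r N) x\<bar> \<le> (\<Sum>k\<le>degree r. \<bar>coeff r k\<bar> * exp (real (degree r) * x))"
    unfolding poly_exp_taylor
  proof (rule order_trans[OF sum_abs], rule sum_mono)
    fix k assume k: "k \<in> {..degree r}"
    have "\<bar>\<Sum>n<N. (- real k * x) ^ n / fact n\<bar> \<le> (\<Sum>n<N. (real k * x) ^ n / fact n)"
      by (rule order_trans[OF sum_abs])
         (use assms in \<open>auto intro!: sum_mono simp: abs_mult power_abs\<close>)
    also have "\<dots> \<le> exp (real k * x)"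
    proof -
      have "(\<lambda>n. (real k * x) ^ n / fact n) sums exp (real k * x)"
        using exp_converges[of "real k * x"] by (simp add: field_simps)
      then show ?thesis
        using assms by (intro sum_le_suminf[of _ "{..<N}", THEN order_trans]) (auto simp: sums_iff)
    qed
    also have "\<dots> \<le> exp (real (degree r) * x)"
      using k assms by (simp add: mult_right_mono)
    finally show "\<bar>coeff r k * (\<Sum>n<N. (- real k * x) ^ n / fact n)\<bar> \<le> \<bar>coeff r k\<bar> * exp (real (degree r) * x)"
      by (simp add: abs_mult mult_left_mono)
  qed
  then show ?thesis by (simp add: sum_distrib_right)
qed

context gauss_laguerre_parameters
begin

lemma borel_measurable_\<nu>_iff:
  "f \<in> borel_measurable \<nu> \<longleftrightarrow> (\<lambda>x. indicator {0..} x * f x) \<in> borel_measurable borel" for f :: "real \<Rightarrow> real"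
  by (subst measurable_cong_sets[OF sets_\<nu> refl]) (simp add: borel_measurable_restrict_space_iff)

lemmas continuous_on_measurable_\<nu> = continuous_on_measurable_half_line[OF sets_\<nu>]

lemma bounded_L2:
  assumes "f \<in> borel_measurable \<nu>" "\<And>x. 0 \<le> x \<Longrightarrow> \<bar>f x\<bar> \<le> B"
  shows "f \<in> L2 \<nu>" "L2_norm \<nu> f \<le> B"
proof -
  have "0 \<le> B" using assms(2)[of 0] by simp
  have AE: "AE x in \<nu>. \<bar>f x\<bar> \<le> \<bar>B\<bar>"
    using assms(2) by (intro AE_I2) (force simp: space_\<nu>)
  show "f \<in> L2 \<nu>" using L2_norm_mono_AE(1)[OF L2_const assms(1) AE] .
  show "L2_norm \<nu> f \<le> B"
    using L2_norm_mono_AE(2)[OF L2_const assms(1) AE] \<open>0 \<le> B\<close> by (simp add: L2_norm_const)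
qed

lemma C0_L2: "f \<in> C0_half_line \<Longrightarrow> f \<in> L2 \<nu>"
  using C0_half_line_bounded[of f] continuous_on_measurable_\<nu>[of f] bounded_L2(1)[of f]
  by (auto simp: C0_half_line_def)

lemma exp_taylor_L2:
  shows "(\<lambda>x. poly r (exp (- x))) \<in> L2 \<nu>"
    and "(\<lambda>N. L2_norm \<nu> (\<lambda>x. poly (exp_taylor r N) x - poly r (exp (- x)))) \<longlonglongrightarrow> 0"
    and "(\<lambda>x. (poly r (exp (- x)))\<^sup>2) \<in> L2 \<nu>"
    and "(\<lambda>N. L2_norm \<nu> (\<lambda>x. (poly (exp_taylor r N) x)\<^sup>2 - (poly r (exp (- x)))\<^sup>2)) \<longlonglongrightarrow> 0"
proof -
  define C where "C = (\<Sum>k\<le>degree r. \<bar>coeff r k\<bar>)"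
  define D where "D = real (degree r)"
  have h: "(\<lambda>x. C * exp (D * x)) \<in> L2 \<nu>" "(\<lambda>x. C\<^sup>2 * exp (2 * D * x)) \<in> L2 \<nu>"
    by (intro L2_cmult L2_exp)+
  have m: "poly p \<in> borel_measurable \<nu>" "(\<lambda>x. (poly p x)\<^sup>2) \<in> borel_measurable \<nu>"
    "(\<lambda>x. poly r (exp (- x))) \<in> borel_measurable \<nu>" "(\<lambda>x. (poly r (exp (- x)))\<^sup>2) \<in> borel_measurable \<nu>" for p
    by (intro continuous_on_measurable_\<nu> continuous_intros)+
  have b: "AE x in \<nu>. \<bar>poly (exp_taylor r N) x\<bar> \<le> C * exp (D * x)" for N
    using exp_taylor_bound[of _ r N] by (intro AE_I2) (simp add: space_\<nu> C_def D_def)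
  have b2: "AE x in \<nu>. \<bar>(poly (exp_taylor r N) x)\<^sup>2\<bar> \<le> C\<^sup>2 * exp (2 * D * x)" for N
    using b[of N]
  proof eventually_elim
    case (elim x)
    then have "\<bar>poly (exp_taylor r N) x\<bar> ^ 2 \<le> (C * exp (D * x)) ^ 2" by (intro power_mono) auto
    also have "\<dots> = C\<^sup>2 * exp (2 * D * x)"
      by (simp add: power_mult_distrib power2_eq_square mult_exp_exp)
    finally show ?case by simp
  qed
  note 1 = L2_dominated_convergence[OF m(1) m(3) h(1) AE_I2[OF exp_taylor_tendsto] b]
  have t2: "(\<lambda>N. (poly (exp_taylor r N) x)\<^sup>2) \<longlonglongrightarrow> (poly r (exp (- x)))\<^sup>2" for x
    by (intro tendsto_intros exp_taylor_tendsto)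
  note 2 = L2_dominated_convergence[OF m(2) m(4) h(2) AE_I2[OF t2] b2]
  show "(\<lambda>x. poly r (exp (- x))) \<in> L2 \<nu>" by (rule 1(2))
  show "(\<lambda>N. L2_norm \<nu> (\<lambda>x. poly (exp_taylor r N) x - poly r (exp (- x)))) \<longlonglongrightarrow> 0" by (rule 1(3))
  show "(\<lambda>x. (poly r (exp (- x)))\<^sup>2) \<in> L2 \<nu>" by (rule 2(2))
  show "(\<lambda>N. L2_norm \<nu> (\<lambda>x. (poly (exp_taylor r N) x)\<^sup>2 - (poly r (exp (- x)))\<^sup>2)) \<longlonglongrightarrow> 0" by (rule 2(3))
qed

text \<open>The square root of \<open>f\<close> is uniformly close to some \<open>r (exp (- x))\<close>, whose square is close to the
  squares of its Taylor polynomials.\<close>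

lemma C0_square_approx:
  assumes f: "f \<in> C0_half_line" "\<And>x. 0 \<le> x \<Longrightarrow> 0 \<le> f x" and \<epsilon>: "0 < \<epsilon>"
  shows "\<exists>q. L2_dist \<nu> f (poly (q * q)) < \<epsilon>"
proof -
  have g: "(\<lambda>x. sqrt (f x)) \<in> C0_half_line"
    using f tendsto_real_sqrt[of f 0 at_top] by (auto simp: C0_half_line_def intro!: continuous_intros)
  obtain B where B: "B > 0" "\<And>x. 0 \<le> x \<Longrightarrow> \<bar>sqrt (f x)\<bar> \<le> B"
    using C0_half_line_bounded[OF g] by blast
  define \<delta> where "\<delta> = min 1 (\<epsilon> / (2 * (2 * B + 1)))"
  have \<delta>: "0 < \<delta>" "\<delta> \<le> 1" "\<delta> * (2 * B + 1) \<le> \<epsilon> / 2"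
  proof -
    show "0 < \<delta>" "\<delta> \<le> 1" using \<epsilon> B by (auto simp: \<delta>_def)
    have "\<delta> * (2 * B + 1) \<le> \<epsilon> / (2 * (2 * B + 1)) * (2 * B + 1)"
      using B by (intro mult_right_mono) (auto simp: \<delta>_def)
    also have "\<dots> = \<epsilon> / 2" using B by (simp add: field_simps)
    finally show "\<delta> * (2 * B + 1) \<le> \<epsilon> / 2" .
  qed
  obtain r where r: "\<And>x. 0 \<le> x \<Longrightarrow> \<bar>sqrt (f x) - poly r (exp (- x))\<bar> < \<delta>"
    using C0_half_line_exp_approx[OF g \<delta>(1)] by blast
  have fL: "f \<in> L2 \<nu>" using f by (intro C0_L2)
  \<comment> \<open>\<open>\<bar>f - s\<^sup>2\<bar> = \<bar>\<surd>f - s\<bar> \<bar>\<surd>f + s\<bar>\<close> with \<open>s\<close> within \<open>\<delta> \<le> 1\<close> of \<open>\<surd>f \<le> B\<close>.\<close>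
  have close: "L2_norm \<nu> (\<lambda>x. f x - (poly r (exp (- x)))\<^sup>2) \<le> \<epsilon> / 2"
  proof (rule bounded_L2(2))
    show "(\<lambda>x. f x - (poly r (exp (- x)))\<^sup>2) \<in> borel_measurable \<nu>"
      using f by (intro continuous_on_measurable_\<nu> continuous_intros) (auto simp: C0_half_line_def)
    fix x :: real assume x: "0 \<le> x"
    define s t where "s = sqrt (f x)" and "t = poly r (exp (- x))"
    have "\<bar>f x - t\<^sup>2\<bar> = \<bar>s - t\<bar> * \<bar>s + t\<bar>"
      using f(2)[OF x] by (simp add: s_def power2_eq_square algebra_simps flip: abs_mult)
    also have "\<dots> \<le> \<delta> * (2 * B + 1)"
      using r[OF x] B(2)[OF x] \<delta> by (intro mult_mono) (auto simp: s_def t_def)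
    also have "\<dots> \<le> \<epsilon> / 2" by (rule \<delta>)
    finally show "\<bar>f x - (poly r (exp (- x)))\<^sup>2\<bar> \<le> \<epsilon> / 2" by (simp add: t_def)
  qed
  have "eventually (\<lambda>N. L2_norm \<nu> (\<lambda>x. (poly (exp_taylor r N) x)\<^sup>2 - (poly r (exp (- x)))\<^sup>2) < \<epsilon> / 2) sequentially"
    using order_tendstoD(2)[OF exp_taylor_L2(4), of "\<epsilon> / 2"] \<epsilon> by simp
  then obtain N where N: "L2_norm \<nu> (\<lambda>x. (poly (exp_taylor r N) x)\<^sup>2 - (poly r (exp (- x)))\<^sup>2) < \<epsilon> / 2"
    by (auto simp: eventually_sequentially)
  define q where "q = exp_taylor r N"
  have "L2_dist \<nu> f (poly (q * q))
    \<le> L2_norm \<nu> (\<lambda>x. f x - (poly r (exp (- x)))\<^sup>2) + L2_norm \<nu> (\<lambda>x. (poly r (exp (- x)))\<^sup>2 - poly (q * q) x)"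
    by (intro L2_norm_diff_triangle fL exp_taylor_L2 L2_poly)
  also have "L2_norm \<nu> (\<lambda>x. (poly r (exp (- x)))\<^sup>2 - poly (q * q) x)
    = L2_norm \<nu> (\<lambda>x. (poly q x)\<^sup>2 - (poly r (exp (- x)))\<^sup>2)"
    by (subst L2_dist_commute) (simp add: power2_eq_square)
  finally show ?thesis using close N by (intro exI[of _ q]) (simp add: q_def)
qed

text \<open>A measurable function is almost everywhere a limit of continuous functions.  Clipping these to
  \<open>[0, m]\<close> and damping them by \<open>exp (- \<bar>x\<bar> / n)\<close> makes them members of \<open>C\<^sub>0\<close> with a common bound.\<close>

lemma L2_nonneg_C0_approx:
  assumes f: "f \<in> L2 \<nu>" and pos: "AE x in \<nu>. 0 \<le> f x" and \<epsilon>: "0 < \<epsilon>"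
  shows "\<exists>g\<in>C0_half_line. (\<forall>x. 0 \<le> g x) \<and> L2_dist \<nu> f g < \<epsilon>"
proof -
  have fm: "f \<in> borel_measurable \<nu>" by (rule L2_measurable[OF f])
  define F where "F x = indicator {0..} x * f x" for x
  have Fm[measurable]: "F \<in> borel_measurable borel"
    using fm unfolding borel_measurable_\<nu>_iff F_def .
  have "F measurable_on UNIV"
    by (rule lebesgue_measurable_imp_measurable_on) (auto intro: measurable_completion)
  then obtain N G where N: "negligible N" and G: "\<And>n. continuous_on UNIV (G n)"
    "\<And>x. x \<notin> N \<Longrightarrow> (\<lambda>n. G n x) \<longlonglongrightarrow> F x"
    unfolding measurable_on_def by auto
  have "AE x in lebesgue. x \<notin> N"
    using N by (intro AE_not_in) (simp add: negligible_iff_null_sets)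
  then have "AE x in lborel. x \<notin> N" by (simp add: AE_completion_iff)
  then have notN: "AE x in \<nu>. x \<notin> N" unfolding AE_\<nu> by (auto elim: eventually_mono)
  have approx: "\<exists>g\<in>C0_half_line. (\<forall>x. 0 \<le> g x) \<and> L2_norm \<nu> (\<lambda>x. min (real m) (f x) - g x) < \<delta>" if \<delta>: "0 < \<delta>" for m \<delta>
  proof -
    define h where "h n x = min (real m) (max 0 (G n x)) * exp (- \<bar>x\<bar> / real (Suc n))" for n x
    have hb: "0 \<le> h n x" "h n x \<le> real m" for n x
    proof -
      show "0 \<le> h n x" by (simp add: h_def)
      have "h n x \<le> real m * 1"
        unfolding h_def by (intro mult_mono) auto
      then show "h n x \<le> real m" by simp
    qed
    have hC: "h n \<in> C0_half_line" for n
    proof -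
      have e: "((\<lambda>x::real. exp (- \<bar>x\<bar> / real (Suc n))) \<longlongrightarrow> 0) at_top"
        by real_asymp
      have "((\<lambda>x. real m * exp (- \<bar>x\<bar> / real (Suc n))) \<longlongrightarrow> real m * 0) at_top"
        by (intro tendsto_intros e)
      then have lim0: "((\<lambda>x. real m * exp (- \<bar>x\<bar> / real (Suc n))) \<longlongrightarrow> 0) at_top"
        by simp
      have "(h n \<longlongrightarrow> 0) at_top"
      proof (rule tendsto_sandwich[OF _ _ tendsto_const lim0])
        show "eventually (\<lambda>x. 0 \<le> h n x) at_top" using hb by simp
        show "eventually (\<lambda>x. h n x \<le> real m * exp (- \<bar>x\<bar> / real (Suc n))) at_top"
          unfolding h_def by (intro always_eventually allI mult_right_mono) auto
      qed
      moreover have "continuous_on {0..} (h n)"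
        unfolding h_def by (intro continuous_intros continuous_on_subset[OF G(1)]) auto
      ultimately show ?thesis by (simp add: C0_half_line_def)
    qed
    have lim: "AE x in \<nu>. (\<lambda>n. h n x) \<longlonglongrightarrow> min (real m) (f x)"
      using notN pos AE_space
    proof eventually_elim
      case (elim x)
      have e: "(\<lambda>n. exp (- \<bar>x\<bar> / real (Suc n))) \<longlonglongrightarrow> exp 0"
        by (intro tendsto_intros LIMSEQ_Suc[OF lim_const_over_n])
      have "(\<lambda>n. h n x) \<longlonglongrightarrow> min (real m) (max 0 (F x)) * exp 0"
        unfolding h_def by (intro tendsto_mult e tendsto_intros G(2) elim)
      then show ?case using elim by (simp add: F_def space_\<nu>)
    qed
    have fm': "(\<lambda>x. min (real m) (f x)) \<in> borel_measurable \<nu>"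
      using fm by measurable
    have hm: "h n \<in> borel_measurable \<nu>" for n using C0_L2[OF hC] L2_measurable by blast
    have "AE x in \<nu>. \<bar>h n x\<bar> \<le> real m" for n using hb by (intro AE_I2) simp
    from L2_dominated_convergence(3)[OF hm fm' L2_const lim this]
    have "eventually (\<lambda>n. L2_norm \<nu> (\<lambda>x. h n x - min (real m) (f x)) < \<delta>) sequentially"
      using \<delta> by (rule order_tendstoD)
    then obtain n where "L2_norm \<nu> (\<lambda>x. h n x - min (real m) (f x)) < \<delta>"
      by (auto simp: eventually_sequentially)
    then show ?thesis using hC hb by (intro bexI[of _ "h n"]) (auto simp: L2_dist_commute)
  qed
  have lim: "AE x in \<nu>. (\<lambda>m. min (real m) (f x)) \<longlonglongrightarrow> f x"
  proof (intro AE_I2)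
    fix x
    obtain M where M: "f x \<le> real M" using real_arch_simple by blast
    have "eventually (\<lambda>m. min (real m) (f x) = f x) sequentially"
      using eventually_ge_at_top[of M] by eventually_elim (use M in auto)
    then show "(\<lambda>m. min (real m) (f x)) \<longlonglongrightarrow> f x" by (rule tendsto_eventually)
  qed
  have bd: "AE x in \<nu>. \<bar>min (real m) (f x)\<bar> \<le> f x" for m
    using pos by eventually_elim auto
  have mm: "(\<lambda>x. min (real m) (f x)) \<in> borel_measurable \<nu>" for m using fm by measurable
  note dc = L2_dominated_convergence[OF mm fm f lim bd]
  have "eventually (\<lambda>m. L2_norm \<nu> (\<lambda>x. min (real m) (f x) - f x) < \<epsilon> / 2) sequentially"
    using order_tendstoD(2)[OF dc(3), of "\<epsilon> / 2"] \<epsilon> by simp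
  then obtain m where m: "L2_norm \<nu> (\<lambda>x. min (real m) (f x) - f x) < \<epsilon> / 2"
    by (auto simp: eventually_sequentially)
  obtain g where g: "g \<in> C0_half_line" "\<And>x. 0 \<le> g x" "L2_norm \<nu> (\<lambda>x. min (real m) (f x) - g x) < \<epsilon> / 2"
    using approx[of "\<epsilon> / 2" m] \<epsilon> by auto
  have "L2_dist \<nu> f g \<le> L2_norm \<nu> (\<lambda>x. f x - min (real m) (f x)) + L2_norm \<nu> (\<lambda>x. min (real m) (f x) - g x)"
    by (intro L2_norm_diff_triangle f dc C0_L2 g)
  then show ?thesis using m g by (intro bexI[of _ g]) (auto simp: L2_dist_commute)
qed

theorem L2_nonneg_square_approx:
  assumes f: "f \<in> L2 \<nu>" and pos: "AE x in \<nu>. 0 \<le> f x" and \<epsilon>: "0 < \<epsilon>"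
  shows "\<exists>q. L2_dist \<nu> f (poly (q * q)) < \<epsilon>"
proof -
  obtain g where g: "g \<in> C0_half_line" "\<And>x. 0 \<le> g x" "L2_dist \<nu> f g < \<epsilon> / 2"
    using L2_nonneg_C0_approx[OF f pos, of "\<epsilon> / 2"] \<epsilon> by auto
  obtain q where q: "L2_dist \<nu> g (poly (q * q)) < \<epsilon> / 2"
    using C0_square_approx[OF g(1,2), of "\<epsilon> / 2"] \<epsilon> by auto
  have "L2_dist \<nu> f (poly (q * q)) \<le> L2_dist \<nu> f g + L2_dist \<nu> g (poly (q * q))"
    by (intro L2_norm_diff_triangle f C0_L2 g L2_poly)
  then show ?thesis using q g by (intro exI[of _ q]) auto
qed

theorem polynomials_dense:
  assumes f: "f \<in> L2 \<nu>" and \<epsilon>: "0 < \<epsilon>"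
  shows "\<exists>p. L2_dist \<nu> f (poly p) < \<epsilon>"
proof -
  have fm[measurable]: "f \<in> borel_measurable \<nu>" by (rule L2_measurable[OF f])
  have u: "(\<lambda>x. max 0 (f x)) \<in> L2 \<nu>" and v: "(\<lambda>x. max 0 (- f x)) \<in> L2 \<nu>"
    by (rule L2_norm_mono_AE(1)[OF f]; auto)+
  obtain p q where p: "L2_norm \<nu> (\<lambda>x. max 0 (f x) - poly (p * p) x) < \<epsilon> / 2"
    and q: "L2_norm \<nu> (\<lambda>x. max 0 (- f x) - poly (q * q) x) < \<epsilon> / 2"
    using L2_nonneg_square_approx[OF u, of "\<epsilon> / 2"] L2_nonneg_square_approx[OF v, of "\<epsilon> / 2"] \<epsilon> by auto
  have eq: "(\<lambda>x. f x - poly (p * p - q * q) x)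
    = (\<lambda>x. (max 0 (f x) - poly (p * p) x) + (-1) * (max 0 (- f x) - poly (q * q) x))"
    by (auto simp: max_def)
  have "L2_dist \<nu> f (poly (p * p - q * q))
    \<le> L2_norm \<nu> (\<lambda>x. max 0 (f x) - poly (p * p) x) + L2_norm \<nu> (\<lambda>x. (-1) * (max 0 (- f x) - poly (q * q) x))"
    unfolding eq by (intro L2_norm_triangle L2_diff L2_cmult u v L2_poly)
  then show ?thesis
    using p q unfolding L2_norm_cmult by (intro exI[of _ "p * p - q * q"]) auto
qed

end

section \<open>Extension to \<open>L\<^sup>2\<close>\<close>

text \<open>The classical dissipativity of generators, read off from
  \<open>2 f = P t f + (1 - t) f + t (f - h) - t ((P t f - f) / t - h)\<close>.\<close>

lemma generator_dissipative:
  assumes P: "\<And>t. 0 < t \<Longrightarrow> P t f \<in> L2 M" "\<And>t. 0 < t \<Longrightarrow> L2_norm M (P t f) \<le> L2_norm M f"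
    and graph: "L2_generator_graph M P f h"
  shows "L2_norm M f \<le> L2_dist M f h"
proof -
  let ?R = "\<lambda>t x. (P t f x - f x) / t - h x"
  have f: "f \<in> L2 M" and h: "h \<in> L2 M" and lim: "((\<lambda>t. L2_norm M (?R t)) \<longlongrightarrow> 0) (at_right 0)"
    using graph by (auto simp: L2_generator_graph_def)
  have bound: "L2_norm M f \<le> L2_dist M f h + L2_norm M (?R t)" if t: "0 < t" "t < 1" for t
  proof -
    have q: "(\<lambda>x. (1/t) * (P t f x - f x)) \<in> L2 M" by (intro L2_cmult L2_diff P f t)
    have R: "?R t \<in> L2 M" using L2_diff[OF q h] by simp
    have "2 * L2_norm M f = L2_norm M (\<lambda>x. 2 * f x)" by (simp add: L2_norm_cmult)
    also have "(\<lambda>x. 2 * f x) = (\<lambda>x. P t f x + ((1 - t) * f x + (t * (f x - h x) + (- t) * ?R t x)))"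
    proof
      fix x
      define D where "D = (P t f x - f x) / t"
      have "t * D = P t f x - f x" using t by (simp add: D_def)
      then show "2 * f x = P t f x + ((1 - t) * f x + (t * (f x - h x) + (- t) * ?R t x))"
        unfolding D_def[symmetric] by (simp add: algebra_simps)
    qed
    also have "L2_norm M \<dots> \<le> L2_norm M (P t f) + (L2_norm M (\<lambda>x. (1 - t) * f x)
      + (L2_norm M (\<lambda>x. t * (f x - h x)) + L2_norm M (\<lambda>x. (- t) * ?R t x)))"
      by (intro order_trans[OF L2_norm_triangle] add_mono order_refl L2_add L2_cmult L2_diff P f h R t)
    also have "\<dots> \<le> L2_norm M f + ((1 - t) * L2_norm M f
      + (t * L2_dist M f h + t * L2_norm M (?R t)))"
      unfolding L2_norm_cmult using P(2)[OF t(1)] t by simp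
    finally have "t * L2_norm M f \<le> t * (L2_dist M f h + L2_norm M (?R t))"
      by (simp add: algebra_simps)
    then show ?thesis using t by simp
  qed
  have "((\<lambda>t. L2_dist M f h + L2_norm M (?R t)) \<longlongrightarrow> L2_dist M f h + 0) (at_right 0)"
    by (intro tendsto_intros lim)
  moreover have "eventually (\<lambda>t. L2_norm M f \<le> L2_dist M f h + L2_norm M (?R t)) (at_right 0)"
    using eventually_at_right_less[of 0] eventually_at_right[of 0 1]
    by (auto simp: eventually_at_right_field intro!: bound exI[of _ 1])
  ultimately show ?thesis
    by (intro tendsto_lowerbound) auto
qed

context gauss_laguerre_parameters
begin

text \<open>The image \<open>g\<close> of \<open>f\<close> under the continuous extension of the semigroup from polynomials,
  described without a limit.  By density of the polynomials the inequality determines \<open>g\<close>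
  up to null sets.\<close>

definition extends_to :: "real \<Rightarrow> (real \<Rightarrow> real) \<Rightarrow> (real \<Rightarrow> real) \<Rightarrow> bool" where
  "extends_to t f g \<longleftrightarrow> f \<in> L2 \<nu> \<and> g \<in> L2 \<nu> \<and>
     (\<forall>p. L2_dist \<nu> g (poly (transition (exp (- t)) p)) \<le> L2_dist \<nu> f (poly p))"

lemma extends_toD:
  assumes "extends_to t f g"
  shows "f \<in> L2 \<nu>" "g \<in> L2 \<nu>"
    "L2_dist \<nu> g (poly (transition (exp (- t)) p)) \<le> L2_dist \<nu> f (poly p)"
  using assms by (auto simp: extends_to_def)

lemma transition_diff_le:
  assumes "0 \<le> t"
  shows "L2_dist \<nu> (poly (transition (exp (- t)) p)) (poly (transition (exp (- t)) q))
    \<le> L2_dist \<nu> (poly p) (poly q)"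
  using transition_contraction[OF assms, of "p - q"] by (simp add: transition_diff poly_diff[abs_def])

lemma extends_to_exists: "0 \<le> t \<Longrightarrow> f \<in> L2 \<nu> \<Longrightarrow> \<exists>g. extends_to t f g"
  using L2_contraction_extends[of poly "\<lambda>p. poly (transition (exp (- t)) p)" f]
    L2_poly transition_diff_le polynomials_dense
  unfolding extends_to_def by blast

lemma extends_to_poly: "0 \<le> t \<Longrightarrow> extends_to t (poly p) (poly (transition (exp (- t)) p))"
  by (simp add: extends_to_def L2_poly transition_diff_le)

lemma extends_to_diff_le:
  assumes "extends_to t f g" "extends_to t f' g'"
  shows "L2_dist \<nu> g g' \<le> L2_dist \<nu> f f'"
proof (rule field_le_epsilon)
  fix \<epsilon> :: real assume "0 < \<epsilon>"
  note fg = extends_toD[OF assms(1)] and fg' = extends_toD[OF assms(2)]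
  obtain p where p: "L2_dist \<nu> f (poly p) < \<epsilon> / 2"
    using polynomials_dense[OF fg(1), of "\<epsilon> / 2"] \<open>0 < \<epsilon>\<close> by auto
  let ?T = "poly (transition (exp (- t)) p)"
  have "L2_dist \<nu> g g' \<le> L2_dist \<nu> g ?T + L2_dist \<nu> ?T g'"
    by (intro L2_norm_diff_triangle fg fg' L2_poly)
  also have "\<dots> \<le> L2_dist \<nu> f (poly p) + L2_dist \<nu> f' (poly p)"
    using fg(3)[of p] fg'(3)[of p] by (simp add: L2_dist_commute[of \<nu> ?T])
  also have "L2_dist \<nu> f' (poly p) \<le> L2_dist \<nu> f' f + L2_dist \<nu> f (poly p)"
    by (intro L2_norm_diff_triangle fg fg' L2_poly)
  also have "L2_dist \<nu> f' f = L2_dist \<nu> f f'"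
    by (rule L2_dist_commute)
  finally show "L2_dist \<nu> g g' \<le> L2_dist \<nu> f f' + \<epsilon>"
    using p by simp
qed

lemma L2_norm_le_0_AE_eq:
  assumes "f \<in> L2 \<nu>" "g \<in> L2 \<nu>" "L2_dist \<nu> f g \<le> 0"
  shows "AE x in \<nu>. f x = g x"
  using L2_norm_eq_0_AE[OF L2_diff[OF assms(1,2)]] assms(3) L2_norm_nonneg[of \<nu> "\<lambda>x. f x - g x"]
  by auto

lemma extends_to_unique:
  assumes fg: "extends_to t f g" and fg': "extends_to t f' g'" and eq: "AE x in \<nu>. f x = f' x"
  shows "AE x in \<nu>. g x = g' x"
proof -
  have "L2_dist \<nu> f f' = L2_norm \<nu> (\<lambda>x. 0)"
    using L2_measurable[OF extends_toD(1)[OF fg]] L2_measurable[OF extends_toD(1)[OF fg']] eq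
    by (intro L2_norm_cong_AE) auto
  then have "L2_dist \<nu> g g' \<le> 0"
    using extends_to_diff_le[OF fg fg'] by (simp add: L2_norm_const)
  then show ?thesis
    by (intro L2_norm_le_0_AE_eq extends_toD(2)[OF fg] extends_toD(2)[OF fg'])
qed

lemma extends_to_limit:
  assumes fg: "\<And>n. extends_to t (F n) (G n)" and f: "f \<in> L2 \<nu>" and g: "g \<in> L2 \<nu>"
    and F: "(\<lambda>n. L2_dist \<nu> (F n) f) \<longlonglongrightarrow> 0"
    and G: "(\<lambda>n. L2_dist \<nu> (G n) g) \<longlonglongrightarrow> 0"
  shows "extends_to t f g"
  unfolding extends_to_def
proof (intro conjI f g allI)
  fix p
  let ?T = "poly (transition (exp (- t)) p)"
  have le: "L2_dist \<nu> g ?T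
    \<le> L2_dist \<nu> (G n) g + (L2_dist \<nu> (F n) f + L2_dist \<nu> f (poly p))" for n
  proof -
    note FG = extends_toD[OF fg[of n]]
    have "L2_dist \<nu> g ?T \<le> L2_dist \<nu> g (G n) + L2_dist \<nu> (G n) ?T"
      by (intro L2_norm_diff_triangle FG g L2_poly)
    also have "L2_dist \<nu> (G n) ?T \<le> L2_dist \<nu> (F n) (poly p)" by (rule FG)
    also have "\<dots> \<le> L2_dist \<nu> (F n) f + L2_dist \<nu> f (poly p)"
      by (intro L2_norm_diff_triangle FG f L2_poly)
    finally show ?thesis by (simp add: L2_dist_commute[of \<nu> g])
  qed
  have "(\<lambda>n. L2_dist \<nu> (G n) g + (L2_dist \<nu> (F n) f + L2_dist \<nu> f (poly p)))
    \<longlonglongrightarrow> 0 + (0 + L2_dist \<nu> f (poly p))"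
    by (intro tendsto_intros F G)
  then show "L2_dist \<nu> g ?T \<le> L2_dist \<nu> f (poly p)"
    using le by (auto intro: LIMSEQ_le_const)
qed

lemma extends_to_lincomb:
  assumes t: "0 \<le> t" and fg: "extends_to t f g" and fg': "extends_to t f' g'"
  shows "extends_to t (\<lambda>x. a * f x + c * f' x) (\<lambda>x. a * g x + c * g' x)"
  unfolding extends_to_def
proof (intro conjI allI L2_lincomb extends_toD[OF fg] extends_toD[OF fg'])
  let ?F = "\<lambda>x. a * f x + c * f' x" and ?G = "\<lambda>x. a * g x + c * g' x"
  let ?T = "\<lambda>p. poly (transition (exp (- t)) p)"
  fix p
  show "L2_dist \<nu> ?G (?T p) \<le> L2_dist \<nu> ?F (poly p)"
  proof (rule field_le_epsilon)
    fix \<epsilon> :: real assume "0 < \<epsilon>"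
    define C where "C = \<bar>a\<bar> + \<bar>c\<bar> + 1"
    define \<delta> where "\<delta> = \<epsilon> / (2 * C)"
    have "0 < C" by (simp add: C_def add_nonneg_pos)
    then have \<delta>: "0 < \<delta>" "2 * (C * \<delta>) = \<epsilon>" using \<open>0 < \<epsilon>\<close> by (simp_all add: \<delta>_def)
    note L = extends_toD[OF fg] extends_toD[OF fg']
    obtain q where q: "L2_dist \<nu> f (poly q) < \<delta>"
      using polynomials_dense[OF L(1) \<delta>(1)] by blast
    obtain q' where q': "L2_dist \<nu> f' (poly q') < \<delta>"
      using polynomials_dense[OF L(4) \<delta>(1)] by blast
    define r where "r = smult a q + smult c q'"
    have comb: "L2_norm \<nu> (\<lambda>x. (a * h x + c * h' x) - (a * k x + c * k' x)) \<le> C * \<delta>"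
      if h: "h \<in> L2 \<nu>" "k \<in> L2 \<nu>" "h' \<in> L2 \<nu>" "k' \<in> L2 \<nu>"
        and \<delta>': "L2_dist \<nu> h k \<le> \<delta>" "L2_dist \<nu> h' k' \<le> \<delta>" for h k h' k'
    proof -
      have "L2_norm \<nu> (\<lambda>x. (a * h x + c * h' x) - (a * k x + c * k' x))
        = L2_norm \<nu> (\<lambda>x. a * (h x - k x) + c * (h' x - k' x))"
        by (rule arg_cong[of _ _ "L2_norm \<nu>"]) (auto simp: algebra_simps)
      also have "\<dots> \<le> \<bar>a\<bar> * L2_dist \<nu> h k + \<bar>c\<bar> * L2_dist \<nu> h' k'"
        by (intro L2_norm_lincomb_le L2_diff h)
      also have "\<dots> \<le> \<bar>a\<bar> * \<delta> + \<bar>c\<bar> * \<delta>"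
        using \<delta>' by (intro add_mono mult_left_mono) auto
      finally show ?thesis using \<delta>(1) by (simp add: C_def algebra_simps)
    qed
    have Gr: "L2_dist \<nu> ?G (?T r) \<le> C * \<delta>"
      using comb[OF L(2) L2_poly L(5) L2_poly order_trans[OF L(3) less_imp_le[OF q]]
          order_trans[OF L(6) less_imp_le[OF q']]]
      by (simp add: r_def transition_add transition_smult)
    have Fr: "L2_dist \<nu> ?F (poly r) \<le> C * \<delta>"
      using comb[OF L(1) L2_poly L(4) L2_poly less_imp_le[OF q] less_imp_le[OF q']]
      by (simp add: r_def)
    have "L2_dist \<nu> ?G (?T p) \<le> L2_dist \<nu> ?G (?T r) + L2_dist \<nu> (?T r) (?T p)"
      by (intro L2_norm_diff_triangle L2_lincomb L L2_poly)
    moreover have "L2_dist \<nu> (?T r) (?T p) \<le> L2_dist \<nu> (poly r) (poly p)"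
      by (rule transition_diff_le[OF t])
    moreover have "L2_dist \<nu> (poly r) (poly p) \<le> L2_dist \<nu> (poly r) ?F + L2_dist \<nu> ?F (poly p)"
      by (intro L2_norm_diff_triangle L2_lincomb L L2_poly)
    ultimately show "L2_dist \<nu> ?G (?T p) \<le> L2_dist \<nu> ?F (poly p) + \<epsilon>"
      using Gr Fr \<delta>(2) L2_dist_commute[of \<nu> "poly r" ?F] by linarith
  qed
qed

lemma extends_to_semigroup:
  assumes fg: "extends_to t f g" and gh: "extends_to s g h"
  shows "extends_to (s + t) f h"
proof -
  have "L2_dist \<nu> h (poly (transition (exp (- (s + t))) p)) \<le> L2_dist \<nu> f (poly p)" for p
    using extends_toD(3)[OF gh, of "transition (exp (- t)) p"] extends_toD(3)[OF fg, of p]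
    by (simp add: transition_transition mult_exp_exp)
  then show ?thesis using extends_toD[OF fg] extends_toD[OF gh] by (simp add: extends_to_def)
qed

lemma extends_to_0: "f \<in> L2 \<nu> \<Longrightarrow> extends_to 0 f f"
  by (simp add: extends_to_def transition_1)

lemma extends_to_norm_le:
  assumes "extends_to t f g"
  shows "L2_norm \<nu> g \<le> L2_norm \<nu> f"
  using extends_toD(3)[OF assms, of 0] by (simp add: transition_0)

lemma extends_to_integral:
  assumes fg: "extends_to t f g"
  shows "(LINT x|\<nu>. g x) = (LINT x|\<nu>. f x)"
proof -
  note L = extends_toD[OF fg]
  have "\<bar>(LINT x|\<nu>. g x) - (LINT x|\<nu>. f x)\<bar> \<le> 0 + \<epsilon>" if \<epsilon>: "0 < \<epsilon>" for \<epsilon>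
  proof -
    obtain p where p: "L2_dist \<nu> f (poly p) < \<epsilon> / 2"
      using polynomials_dense[OF L(1), of "\<epsilon> / 2"] \<epsilon> by auto
    let ?T = "poly (transition (exp (- t)) p)"
    have "(LINT x|\<nu>. g x) - (LINT x|\<nu>. f x) = (LINT x|\<nu>. g x - ?T x) - (LINT x|\<nu>. f x - poly p x)"
      using L2_integrable[OF L(1)] L2_integrable[OF L(2)] L2_integrable[OF L2_poly]
      by (simp add: integral_transition)
    moreover have "\<bar>LINT x|\<nu>. g x - ?T x\<bar> \<le> L2_dist \<nu> f (poly p)"
      using L2_abs_integral_le_norm[OF L2_diff[OF L(2) L2_poly]] L(3) by (rule order_trans)
    moreover have "\<bar>LINT x|\<nu>. f x - poly p x\<bar> \<le> L2_dist \<nu> f (poly p)"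
      by (intro L2_abs_integral_le_norm L2_diff L L2_poly)
    ultimately show ?thesis using p by linarith
  qed
  then have "\<bar>(LINT x|\<nu>. g x) - (LINT x|\<nu>. f x)\<bar> \<le> 0" by (rule field_le_epsilon)
  then show ?thesis by simp
qed

text \<open>Here it matters that \<open>f\<close> is approximated by squares, on whose images the sign is known.\<close>

lemma extends_to_nonneg:
  assumes t: "0 \<le> t" and fg: "extends_to t f g" and pos: "AE x in \<nu>. 0 \<le> f x"
  shows "AE x in \<nu>. 0 \<le> g x"
proof -
  note L = extends_toD[OF fg]
  have gm[measurable]: "g \<in> borel_measurable \<nu>" by (rule L2_measurable[OF L(2)])
  define n where "n x = min 0 (g x)" for x
  have nL: "n \<in> L2 \<nu>" unfolding n_def by (rule L2_norm_mono_AE(1)[OF L(2)]) auto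
  have "L2_norm \<nu> n \<le> 0 + \<epsilon>" if \<epsilon>: "0 < \<epsilon>" for \<epsilon>
  proof -
    obtain q where q: "L2_dist \<nu> f (poly (q * q)) < \<epsilon>"
      using L2_nonneg_square_approx[OF L(1) pos \<epsilon>] by blast
    let ?T = "poly (transition (exp (- t)) (q * q))"
    have "0 \<le> ?T x" if "0 \<le> x" for x
      by (rule transition_nonneg[OF _ t that]) simp
    then have "AE x in \<nu>. \<bar>n x\<bar> \<le> \<bar>g x - ?T x\<bar>"
      by (intro AE_I2) (force simp: n_def space_\<nu> min_def)
    then have "L2_norm \<nu> n \<le> L2_dist \<nu> g ?T"
      by (intro L2_norm_mono_AE(2) L2_diff L L2_poly L2_measurable[OF nL])
    also have "\<dots> \<le> L2_dist \<nu> f (poly (q * q))" by (rule L)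
    finally show ?thesis using q by simp
  qed
  then have "L2_norm \<nu> n \<le> 0" by (rule field_le_epsilon)
  then have "L2_norm \<nu> n = 0" using L2_norm_nonneg[of \<nu> n] by simp
  from L2_norm_eq_0_AE[OF nL this] show ?thesis
    by eventually_elim (auto simp: n_def min_def split: if_splits)
qed

lemma L2_norm_poly_tendsto_0:
  assumes deg: "\<And>t. degree (u t) \<le> n" and c: "\<And>k. ((\<lambda>t. coeff (u t) k) \<longlongrightarrow> 0) F"
  shows "((\<lambda>t. L2_norm \<nu> (poly (u t))) \<longlongrightarrow> 0) F"
proof (rule tendsto_sandwich[OF _ _ tendsto_const])
  have "L2_norm \<nu> (poly (u t)) \<le> (\<Sum>k\<le>n. \<bar>coeff (u t) k\<bar> * L2_norm \<nu> (\<lambda>x. x ^ k))" for t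
  proof -
    have "poly (u t) = (\<lambda>x. \<Sum>k\<le>n. coeff (u t) k * x ^ k)"
      using poly_eq_sum_le_degree[OF deg] by auto
    then have "L2_norm \<nu> (poly (u t)) \<le> (\<Sum>k\<le>n. L2_norm \<nu> (\<lambda>x. coeff (u t) k * x ^ k))"
      by (simp only:) (rule L2_norm_sum_le[OF L2_cmult[OF L2_power]])
    then show ?thesis by (simp add: L2_norm_cmult)
  qed
  then show "eventually (\<lambda>t. L2_norm \<nu> (poly (u t)) \<le> (\<Sum>k\<le>n. \<bar>coeff (u t) k\<bar> * L2_norm \<nu> (\<lambda>x. x ^ k))) F"
    by simp
  have "((\<lambda>t. \<Sum>k\<le>n. \<bar>coeff (u t) k\<bar> * L2_norm \<nu> (\<lambda>x. x ^ k)) \<longlongrightarrow> (\<Sum>k\<le>n. \<bar>0\<bar> * L2_norm \<nu> (\<lambda>x. x ^ k))) F"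
    by (intro tendsto_intros c)
  then show "((\<lambda>t. \<Sum>k\<le>n. \<bar>coeff (u t) k\<bar> * L2_norm \<nu> (\<lambda>x. x ^ k)) \<longlongrightarrow> 0) F" by simp
qed (simp add: L2_norm_nonneg)

lemma transition_difference_quotient:
  "((\<lambda>t. coeff (smult (1 / t) (transition (exp (- t)) p - p)) k) \<longlongrightarrow> coeff (generator p) k) (at_right 0)"
proof -
  have "((\<lambda>t. (coeff (transition (exp (- t)) p) k - coeff p k) / t) \<longlongrightarrow> coeff (generator p) k) (at 0)"
    using transition_has_derivative[of p k 0] by (simp add: has_field_derivative_iff transition_1)
  then show ?thesis
    by (simp add: filterlim_at_split)
qed

lemma transition_strongly_continuous:
  "((\<lambda>t. L2_dist \<nu> (poly (transition (exp (- t)) p)) (poly p)) \<longlongrightarrow> 0) (at_right 0)"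
proof -
  have "((\<lambda>t. L2_norm \<nu> (poly (transition (exp (- t)) p - p))) \<longlongrightarrow> 0) (at_right 0)"
  proof (rule L2_norm_poly_tendsto_0[where n = "degree p"])
    show "degree (transition (exp (- t)) p - p) \<le> degree p" for t
      by (intro degree_diff_le degree_transition order_refl)
    fix k
    have "((\<lambda>t. coeff (transition (exp (- t)) p) k - coeff p k) \<longlongrightarrow> coeff (transition (exp (- 0)) p) k - coeff p k) (at 0)"
      by (intro tendsto_intros isContD DERIV_isCont[OF transition_has_derivative])
    then show "((\<lambda>t. coeff (transition (exp (- t)) p - p) k) \<longlongrightarrow> 0) (at_right 0)"
      by (simp add: transition_1 filterlim_at_split)
  qed
  then show ?thesis by (simp add: poly_diff[abs_def])
qed

lemma transition_derivative_L2:
  "((\<lambda>t. L2_norm \<nu> (\<lambda>x. (poly (transition (exp (- t)) p) x - poly p x) / t - poly (generator p) x)) \<longlongrightarrow> 0) (at_right 0)"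
proof -
  have "((\<lambda>t. L2_norm \<nu> (poly (smult (1 / t) (transition (exp (- t)) p - p) - generator p))) \<longlongrightarrow> 0) (at_right 0)"
  proof (rule L2_norm_poly_tendsto_0[where n = "degree p"])
    show "degree (smult (1 / t) (transition (exp (- t)) p - p) - generator p) \<le> degree p" for t
      by (intro degree_diff_le degree_transition degree_generator order_refl
          order_trans[OF degree_smult_le])
    fix k
    have "((\<lambda>t. coeff (smult (1 / t) (transition (exp (- t)) p - p)) k - coeff (generator p) k)
      \<longlongrightarrow> coeff (generator p) k - coeff (generator p) k) (at_right 0)"
      by (intro tendsto_diff transition_difference_quotient tendsto_const)
    then show "((\<lambda>t. coeff (smult (1 / t) (transition (exp (- t)) p - p) - generator p) k) \<longlongrightarrow> 0) (at_right 0)"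
      by simp
  qed
  then show ?thesis by (simp add: poly_diff[abs_def])
qed

text \<open>In the coordinates \<open>p = \<Lambda> r\<close> the resolvent equation reads \<open>(k + 1) (r\<^sub>k - r\<^sub>k\<^sub>+\<^sub>1) = q\<^sub>k\<close>.\<close>

lemma one_minus_generator_surjective: "\<exists>p. p - generator p = q"
proof -
  define s where "s = \<Lambda>_inv q"
  define c where "c k = (\<Sum>j\<in>{k..degree s}. coeff s j / real (Suc j))" for k
  define r where "r = (\<Sum>k\<le>degree s. monom (c k) k)"
  have r: "coeff r k = c k" for k
  proof -
    have "coeff r k = (\<Sum>i\<le>degree s. if i = k then c i else 0)"
      by (simp add: r_def coeff_sum)
    then show ?thesis by (auto simp: c_def)
  qed
  have step: "real (Suc k) * (c k - c (Suc k)) = coeff s k" for k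
  proof (cases "k \<le> degree s")
    case True
    then have "c k = coeff s k / real (Suc k) + c (Suc k)"
      unfolding c_def by (rule sum.atLeast_Suc_atMost)
    then show ?thesis by simp
  next
    case False
    then show ?thesis by (simp add: c_def coeff_eq_0)
  qed
  have "coeff (r - [:1, -1:] * pderiv r) k = coeff s k" for k
    using step[of k] by (cases k) (simp_all add: coeff_pderiv r algebra_simps)
  then have e: "r - [:1, -1:] * pderiv r = s" by (rule poly_eqI)
  have "\<Lambda> r - generator (\<Lambda> r) = \<Lambda> (r - [:1, -1:] * pderiv r)"
    unfolding generator_def \<Lambda>_inv_\<Lambda> by (rule poly_eqI) (simp add: diff_divide_distrib)
  also have "\<dots> = q" unfolding e by (simp add: s_def)
  finally show ?thesis by blast
qed

lemma rate_strictly_concave: "rate 0 + rate 2 < 2 * rate 1"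
proof -
  have s: "(\<lambda>k. kernel_coeff k / (kernel_exponent k + real 1) - kernel_coeff k / (kernel_exponent k + real 2))
    sums (pi / sin (\<alpha> * pi) * ((rate 1 - rate 0) / real 1) - pi / sin (\<alpha> * pi) * ((rate 2 - rate 0) / real 2))"
    by (intro sums_diff kernel_moment_sums) auto
  have "0 < kernel_coeff k / (kernel_exponent k + real 1) - kernel_coeff k / (kernel_exponent k + real 2)" for k
    using kernel_coeff_pos[of k] kernel_exponent_ge[of k] by (simp add: divide_strict_left_mono)
  then have "0 < (\<Sum>k. kernel_coeff k / (kernel_exponent k + real 1) - kernel_coeff k / (kernel_exponent k + real 2))"
    using s by (intro suminf_pos) (auto simp: sums_iff)
  then have "0 < pi / sin (\<alpha> * pi) * ((rate 1 - rate 0) / real 1) - pi / sin (\<alpha> * pi) * ((rate 2 - rate 0) / real 2)"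
    using s by (simp add: sums_iff)
  also have "\<dots> = pi / sin (\<alpha> * pi) * ((2 * rate 1 - rate 0 - rate 2) / 2)"
  proof -
    have "C * ((x - z) / real 1) - C * ((y - z) / real 2) = C * ((2 * x - z - y) / 2)" for C x y z :: real
      by (simp add: field_simps)
    then show ?thesis .
  qed
  finally have "0 < pi / sin (\<alpha> * pi) * ((2 * rate 1 - rate 0 - rate 2) / 2)" .
  moreover have "0 < pi / sin (\<alpha> * pi)"
    using sin_gt_zero[of "\<alpha> * pi"] \<alpha>_pos \<alpha>_less_1 by simp
  ultimately have "0 < (2 * rate 1 - rate 0 - rate 2) / 2" by (rule zero_less_mult_pos)
  then show ?thesis by simp
qed

text \<open>The form \<open>\<langle>P p, q\<rangle> - \<langle>p, P q\<rangle>\<close> for the images \<open>p, q\<close> of \<open>y, y\<^sup>2\<close> under \<open>\<Lambda>\<close> is a multiple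
  of the second difference of \<open>\<phi>\<close> at \<open>1, 2, 3\<close>.\<close>

lemma transition_not_symmetric:
  assumes e: "0 < e" "e < 1"
  shows "\<exists>p q. (LINT x|\<nu>. poly (transition e p) x * poly q x) \<noteq> (LINT x|\<nu>. poly p x * poly (transition e q) x)"
proof -
  define m1 m2 m3 where "m1 = moment 1" and "m2 = moment 2" and "m3 = moment 3"
  define p q where "p = \<Lambda> [:0, 1:]" and "q = \<Lambda> [:0, 0, 1:]"
  have m: "m1 > 0" "m2 > 0" "m3 > 0" by (simp_all add: m1_def m2_def m3_def moment_pos)
  note \<Lambda> = \<Lambda>_quadratic[folded m1_def m2_def]
  note \<Lambda>i = \<Lambda>_inv_cubic[folded m1_def m2_def m3_def]
  have p: "p = [:0, 1 / m1:]" using \<Lambda>[of 0 1 0] by (simp add: p_def)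
  have q: "q = [:0, 0, 1 / m2:]" using \<Lambda>[of 0 0 1] by (simp add: q_def)
  have Tp: "transition e p = [:1 - e, e / m1:]"
    using \<Lambda>[of "1 - e" e 0] by (simp add: transition_def p_def pcompose_pCons)
  have Tq: "transition e q = [:(1 - e)\<^sup>2, 2 * e * (1 - e) / m1, e\<^sup>2 / m2:]"
  proof -
    have "pcompose [:0, 0, 1:] [:1 - e, e:] = [:(1 - e)\<^sup>2, 2 * e * (1 - e), e\<^sup>2:]"
      by (simp add: pcompose_pCons power2_eq_square algebra_simps)
    then show ?thesis unfolding transition_def q_def \<Lambda>_inv_\<Lambda> by (simp add: \<Lambda>)
  qed
  have 1: "(LINT x|\<nu>. poly (transition e p) x * poly q x) = (1 - e) + e * m3 / (m1 * m2)"
  proof -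
    have "transition e p * q = [:0, 0, (1 - e) / m2, e / (m1 * m2):]"
      by (simp add: Tp q)
    then have "poly (\<Lambda>_inv (transition e p * q)) 1 = (1 - e) + e * m3 / (m1 * m2)"
      using m by (simp add: \<Lambda>i)
    then show ?thesis using integral_poly[of "transition e p * q"] by simp
  qed
  have 2: "(LINT x|\<nu>. poly p x * poly (transition e q) x) = (1 - e)\<^sup>2 + 2 * e * (1 - e) * m2 / (m1 * m1) + e\<^sup>2 * m3 / (m1 * m2)"
  proof -
    have "p * transition e q = [:0, (1 - e)\<^sup>2 / m1, 2 * e * (1 - e) / (m1 * m1), e\<^sup>2 / (m1 * m2):]"
      by (simp add: Tq p)
    then have "poly (\<Lambda>_inv (p * transition e q)) 1 = (1 - e)\<^sup>2 + 2 * e * (1 - e) * m2 / (m1 * m1) + e\<^sup>2 * m3 / (m1 * m2)"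
      using m by (simp add: \<Lambda>i)
    then show ?thesis using integral_poly[of "p * transition e q"] by simp
  qed
  have r: "rate 0 = m1" "rate 1 = m2 / m1" "rate 2 = m3 / m2"
    by (simp_all add: rate_def m1_def m2_def m3_def moment_0 numeral_2_eq_2 numeral_3_eq_3)
  have "((1 - e) + e * m3 / (m1 * m2)) - ((1 - e)\<^sup>2 + 2 * e * (1 - e) * m2 / (m1 * m1) + e\<^sup>2 * m3 / (m1 * m2))
    = e * (1 - e) / m1 * (rate 0 + rate 2 - 2 * rate 1)"
    unfolding r using m by (simp add: field_simps power2_eq_square)
  moreover have "e * (1 - e) / m1 * (rate 0 + rate 2 - 2 * rate 1) < 0"
    using e m rate_strictly_concave by (intro mult_pos_neg divide_pos_pos mult_pos_pos) auto
  ultimately have "(1 - e) + e * m3 / (m1 * m2) \<noteq> (1 - e)\<^sup>2 + 2 * e * (1 - e) * m2 / (m1 * m1) + e\<^sup>2 * m3 / (m1 * m2)"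
    by linarith
  then show ?thesis using 1 2 by metis
qed

end

section \<open>Action on \<open>C\<^sub>0([0,\<infinity>))\<close>\<close>

text \<open>The indicator of \<open>[0, a]\<close> is a bounded limit of functions in \<open>C\<^sub>0\<close>, so the distribution
  functions agree.\<close>

lemma prob_space_half_line_eqI:
  assumes prob: "prob_space \<mu>1" "prob_space \<mu>2"
    and sets: "sets \<mu>1 = sets (restrict_space borel {0::real..})" "sets \<mu>2 = sets (restrict_space borel {0::real..})"
    and eq: "\<And>f. f \<in> C0_half_line \<Longrightarrow> (LINT x|\<mu>1. f x) = (LINT x|\<mu>2. f x)"
  shows "\<mu>1 = \<mu>2"
proof -
  \<comment> \<open>A continuous descent from \<open>1\<close> to \<open>0\<close> on \<open>[a, a + 1/m]\<close>.\<close>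
  define h where "h m a x = max 0 (1 - real m * max 0 (x - a))" for m and a x :: real
  have hb: "0 \<le> h m a x" "h m a x \<le> 1" for m a x
    by (auto simp: h_def)
  have hC: "h (Suc m) a \<in> C0_half_line" for m a
  proof -
    have "eventually (\<lambda>x. h (Suc m) a x = 0) at_top"
      using eventually_ge_at_top[of "a + 1"]
    proof eventually_elim
      case (elim x)
      then have "1 * 1 \<le> real (Suc m) * max 0 (x - a)" by (intro mult_mono) auto
      then show ?case by (simp add: h_def)
    qed
    then have "(h (Suc m) a \<longlongrightarrow> 0) at_top" by (rule tendsto_eventually)
    moreover have "continuous_on {0..} (h (Suc m) a)"
      unfolding h_def by (intro continuous_intros)
    ultimately show ?thesis by (simp add: C0_half_line_def)
  qed
  have hlim: "(\<lambda>m. h (Suc m) a x) \<longlonglongrightarrow> indicator {..a} x" for a x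
  proof (cases "x \<le> a")
    case True
    then show ?thesis by (simp add: h_def)
  next
    case False
    then obtain M where M: "1 / (x - a) \<le> real M" using real_arch_simple by blast
    have "eventually (\<lambda>m. h (Suc m) a x = 0) sequentially"
      using eventually_ge_at_top[of M]
    proof eventually_elim
      case (elim m)
      have "1 = 1 / (x - a) * (x - a)" using False by simp
      also have "\<dots> \<le> real (Suc m) * (x - a)"
        using False M elim by (intro mult_right_mono) auto
      finally show ?case using False by (simp add: h_def)
    qed
    then have "(\<lambda>m. h (Suc m) a x) \<longlonglongrightarrow> 0" by (rule tendsto_eventually)
    then show ?thesis using False by simp
  qed
  have meas: "f \<in> borel_measurable \<mu>"
    if "sets \<mu> = sets (restrict_space borel {0..})" "f \<in> borel_measurable borel" for \<mu> and f :: "real \<Rightarrow> real"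
    by (subst measurable_cong_sets[OF that(1) refl]) (rule measurable_restrict_space1[OF that(2)])
  have ind: "(\<lambda>m. LINT x|\<mu>. h (Suc m) a x) \<longlonglongrightarrow> measure \<mu> ({..a} \<inter> {0..})"
    if \<mu>: "prob_space \<mu>" "sets \<mu> = sets (restrict_space borel {0..})" for \<mu> a
  proof -
    interpret prob_space \<mu> by (rule \<mu>)
    have "(\<lambda>m. LINT x|\<mu>. h (Suc m) a x) \<longlonglongrightarrow> (LINT x|\<mu>. indicator {..a} x)"
    proof (rule integral_dominated_convergence[where w = "\<lambda>_. 1"])
      show "(\<lambda>x. h (Suc m) a x) \<in> borel_measurable \<mu>" for m
        unfolding h_def by (rule meas[OF \<mu>(2)]) measurable
      show "AE x in \<mu>. norm (h (Suc m) a x) \<le> 1" for m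
        using hb by (intro AE_I2) simp
      show "(indicator {..a} :: real \<Rightarrow> real) \<in> borel_measurable \<mu>"
        by (rule meas[OF \<mu>(2)]) measurable
    qed (use hlim in auto)
    then show ?thesis using space_half_line[OF \<mu>(2)] by (simp add: Int_commute)
  qed
  have cdf_eq: "measure \<mu>1 ({..a} \<inter> {0..}) = measure \<mu>2 ({..a} \<inter> {0..})" for a
    using LIMSEQ_unique[OF ind[OF prob(1) sets(1)] ind[OF prob(2) sets(2), of a, folded eq[OF hC]]] .
  have id: "(\<lambda>x. x) \<in> \<mu> \<rightarrow>\<^sub>M borel" if "sets \<mu> = sets (restrict_space borel {0::real..})" for \<mu>
    by (rule meas[OF that]) simp
  have distr: "real_distribution (distr \<mu> borel (\<lambda>x. x))"
    if "prob_space \<mu>" "sets \<mu> = sets (restrict_space borel {0::real..})" for \<mu>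
    using prob_space.prob_space_distr[OF that(1) id[OF that(2)]]
    by (simp add: real_distribution_def real_distribution_axioms_def)
  have d: "distr \<mu>1 borel (\<lambda>x. x) = distr \<mu>2 borel (\<lambda>x. x)"
  proof (rule cdf_unique[OF distr[OF prob(1) sets(1)] distr[OF prob(2) sets(2)]], rule ext)
    fix a
    have "cdf (distr \<mu> borel (\<lambda>x. x)) a = measure \<mu> ({..a} \<inter> {0..})"
      if "sets \<mu> = sets (restrict_space borel {0::real..})" for \<mu>
      using id[OF that] space_half_line[OF that] by (simp add: cdf_def measure_distr vimage_def atMost_def)
    then show "cdf (distr \<mu>1 borel (\<lambda>x. x)) a = cdf (distr \<mu>2 borel (\<lambda>x. x)) a"
      using sets cdf_eq by simp
  qed
  show ?thesis
  proof (rule measure_eqI)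
    show "sets \<mu>1 = sets \<mu>2" using sets by simp
    fix A assume "A \<in> sets \<mu>1"
    then have A: "A \<in> sets borel" "A \<subseteq> {0..}"
      unfolding sets by (auto simp: sets_restrict_space)
    have "emeasure \<mu> A = emeasure (distr \<mu> borel (\<lambda>x. x)) A"
      if "sets \<mu> = sets (restrict_space borel {0::real..})" for \<mu>
      using id[OF that] space_half_line[OF that] A by (simp add: emeasure_distr vimage_def Int_absorb2)
    then show "emeasure \<mu>1 A = emeasure \<mu>2 A" using sets d by simp
  qed
qed

context gauss_laguerre_parameters
begin

text \<open>The measure \<open>\<nu>\<close> has full support in \<open>[0,\<infinity>)\<close>.\<close>

lemma AE_nonneg_imp_nonneg:
  assumes g: "continuous_on {0..} g" and AE: "AE x in \<nu>. 0 \<le> g x" and x: "0 \<le> x"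
  shows "0 \<le> (g x :: real)"
proof -
  define C where "C = {x. 0 \<le> g (max 0 x)}"
  have "continuous_on UNIV (\<lambda>x. g (max 0 x))"
    by (intro continuous_on_compose2[OF g] continuous_intros) auto
  then have C: "closed C" unfolding C_def by (intro closed_Collect_le continuous_intros)
  have "AE x in lborel. 0 < x \<longrightarrow> 0 \<le> g x" using AE unfolding AE_\<nu> .
  then have "AE x\<in>{0<..} in lebesgue. x \<in> C"
    by (intro AE_completion) (auto elim!: eventually_mono simp: C_def)
  then have "{0<..} \<subseteq> C"
    using mem_closed_if_AE_lebesgue_open[OF open_greaterThan C] by blast
  then have "closure {0<..} \<subseteq> C" using C by (rule closure_minimal)
  then have "x \<in> C" using x by (auto simp only: closure_greaterThan atLeast_iff)
  then show ?thesis using x by (simp add: C_def)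
qed

lemma continuous_AE_eq_imp_eq:
  assumes "continuous_on {0..} f" "continuous_on {0..} g" "AE x in \<nu>. f x = (g x :: real)" "0 \<le> x"
  shows "f x = g x"
proof (rule antisym)
  have "0 \<le> g x - f x"
    by (rule AE_nonneg_imp_nonneg[of "\<lambda>x. g x - f x"]) (use assms in \<open>auto intro!: continuous_intros elim!: eventually_mono\<close>)
  then show "f x \<le> g x" by simp
  have "0 \<le> f x - g x"
    by (rule AE_nonneg_imp_nonneg[of "\<lambda>x. f x - g x"]) (use assms in \<open>auto intro!: continuous_intros elim!: eventually_mono\<close>)
  then show "g x \<le> f x" by simp
qed

lemma extends_to_const: "0 \<le> t \<Longrightarrow> extends_to t (\<lambda>x. c) (\<lambda>x. c)"
proof -
  have "poly [:c:] = (\<lambda>x. c)" by auto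
  then show "0 \<le> t \<Longrightarrow> extends_to t (\<lambda>x. c) (\<lambda>x. c)"
    using extends_to_poly[of t "[:c:]"] by (simp only: transition_const)
qed

lemma extends_to_sum:
  assumes "0 \<le> t" "\<And>i. i \<in> I \<Longrightarrow> extends_to t (F i) (G i)"
  shows "extends_to t (\<lambda>x. \<Sum>i\<in>I. c i * F i x) (\<lambda>x. \<Sum>i\<in>I. c i * G i x)"
  using assms(2)
proof (induction I rule: infinite_finite_induct)
  case (insert i I)
  have "extends_to t (\<lambda>x. c i * F i x + 1 * (\<Sum>i\<in>I. c i * F i x)) (\<lambda>x. c i * G i x + 1 * (\<Sum>i\<in>I. c i * G i x))"
    using insert by (intro extends_to_lincomb assms(1)) auto
  then show ?case using insert by simp
qed (auto intro: extends_to_const assms)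

lemma extends_to_mono:
  assumes t: "0 \<le> t" and fg: "extends_to t f g" "extends_to t f' g'"
    and cont: "continuous_on {0..} g" "continuous_on {0..} g'"
    and le: "\<And>x. 0 \<le> x \<Longrightarrow> f x \<le> f' x" and x: "0 \<le> x"
  shows "g x \<le> g' x"
proof -
  have "extends_to t (\<lambda>x. 1 * f' x + (-1) * f x) (\<lambda>x. 1 * g' x + (-1) * g x)"
    by (intro extends_to_lincomb t fg)
  then have "AE x in \<nu>. 0 \<le> 1 * g' x + (-1) * g x"
    by (rule extends_to_nonneg[OF t]) (auto intro!: AE_I2 simp: space_\<nu> le)
  then have "0 \<le> 1 * g' x + (-1) * g x"
    by (rule AE_nonneg_imp_nonneg[rotated]) (auto intro!: continuous_intros cont x)
  then show ?thesis by simp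
qed

lemma extends_to_sup_bound:
  assumes t: "0 \<le> t" and fg: "extends_to t f g" "extends_to t f' g'"
    and cont: "continuous_on {0..} g" "continuous_on {0..} g'"
    and le: "\<And>x. 0 \<le> x \<Longrightarrow> \<bar>f x - f' x\<bar> \<le> \<delta>" and x: "0 \<le> x"
  shows "\<bar>g x - g' x\<bar> \<le> \<delta>"
proof -
  have shift: "extends_to t (\<lambda>x. 1 * h x + 1 * \<delta>) (\<lambda>x. 1 * k x + 1 * \<delta>)" if "extends_to t h k" for h k
    by (intro extends_to_lincomb t that extends_to_const)
  have "g x \<le> 1 * g' x + 1 * \<delta>"
    by (rule extends_to_mono[OF t fg(1) shift[OF fg(2)]])
       (use le x in \<open>auto intro!: continuous_intros cont simp: abs_le_iff algebra_simps\<close>)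
  moreover have "g' x \<le> 1 * g x + 1 * \<delta>"
    by (rule extends_to_mono[OF t fg(2) shift[OF fg(1)]])
       (use le x in \<open>auto intro!: continuous_intros cont simp: abs_le_iff algebra_simps\<close>)
  ultimately show ?thesis by (simp add: abs_le_iff)
qed

text \<open>Fatou's lemma, for the difference to the image of each polynomial.\<close>

lemma extends_to_pointwise_limit:
  assumes FG: "\<And>n. extends_to t (F n) (G n)" and f: "f \<in> L2 \<nu>" and g: "g \<in> borel_measurable \<nu>"
    and F: "(\<lambda>n. L2_dist \<nu> (F n) f) \<longlonglongrightarrow> 0"
    and G: "AE x in \<nu>. (\<lambda>n. G n x) \<longlonglongrightarrow> g x"
  shows "extends_to t f g"
proof -
  have *: "(\<lambda>x. g x - poly (transition (exp (- t)) p) x) \<in> L2 \<nu> \<and>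
    L2_dist \<nu> g (poly (transition (exp (- t)) p)) \<le> L2_dist \<nu> f (poly p)" for p
  proof -
    let ?T = "poly (transition (exp (- t)) p)"
    have 1: "(\<lambda>x. G n x - ?T x) \<in> L2 \<nu>" for n
      by (intro L2_diff extends_toD(2)[OF FG] L2_poly)
    have 2: "(\<lambda>x. g x - ?T x) \<in> borel_measurable \<nu>"
      using g L2_measurable[OF L2_poly] by (intro borel_measurable_diff)
    have 3: "AE x in \<nu>. (\<lambda>n. G n x - ?T x) \<longlonglongrightarrow> g x - ?T x"
      using G by eventually_elim (intro tendsto_intros)
    have 4: "L2_dist \<nu> (G n) ?T \<le> L2_dist \<nu> (F n) f + L2_dist \<nu> f (poly p)" for n
      by (rule order_trans[OF extends_toD(3)[OF FG]])
         (intro L2_norm_diff_triangle extends_toD(1)[OF FG] f L2_poly)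
    have 5: "(\<lambda>n. L2_dist \<nu> (F n) f + L2_dist \<nu> f (poly p)) \<longlonglongrightarrow> 0 + L2_dist \<nu> f (poly p)"
      by (intro tendsto_intros F)
    show ?thesis using L2_Fatou[OF 1 2 3 4 5] by simp
  qed
  have "g \<in> L2 \<nu>"
    using L2_add[OF conjunct1[OF *[of 0]] L2_poly[of "transition (exp (- t)) 0"]] by simp
  with * f show ?thesis by (simp add: extends_to_def)
qed

text \<open>The image of \<open>exp (- k x)\<close> under the semigroup, by its exponential series.\<close>

definition exp_image_term :: "nat \<Rightarrow> nat \<Rightarrow> real \<Rightarrow> real \<Rightarrow> real" where
  "exp_image_term k n e x = (- real k) ^ n * moment n / fact n * poly (\<Lambda> ([:1 - e, e:] ^ n)) x"

definition exp_image :: "nat \<Rightarrow> real \<Rightarrow> real \<Rightarrow> real" where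
  "exp_image k e x = (\<Sum>n. exp_image_term k n e x)"

lemma poly_\<Lambda>_power:
  "poly (\<Lambda> ([:1 - e, e:] ^ n)) x = (\<Sum>j\<le>n. real (n choose j) * e ^ j * (1 - e) ^ (n - j) / moment j * x ^ j)"
proof -
  have "degree ([:1 - e, e:] ^ n) \<le> degree [:1 - e, e:] * n" by (rule degree_power_le)
  also have "\<dots> \<le> 1 * n" by (intro mult_right_mono) auto
  finally show ?thesis
    by (subst poly_eq_sum_le_degree[of _ n]) (auto simp: coeff_linear_poly_power)
qed

text \<open>The moments are bounded below, so that up to a constant \<open>\<Lambda>\<close> only decreases polynomials with
  nonnegative coefficients.\<close>

lemma poly_\<Lambda>_power_bound:
  "\<exists>C>0. \<forall>n e x. 0 \<le> e \<longrightarrow> e \<le> 1 \<longrightarrow> 0 \<le> x \<longrightarrow> \<bar>poly (\<Lambda> ([:1 - e, e:] ^ n)) x\<bar> \<le> C * (1 + x) ^ n"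
proof -
  obtain C where C: "C > 0" "\<And>n. 1 / moment n \<le> C" using moment_lower_bound by blast
  have "\<bar>poly (\<Lambda> ([:1 - e, e:] ^ n)) x\<bar> \<le> C * (1 + x) ^ n" if ex: "0 \<le> e" "e \<le> 1" "0 \<le> x" for n e x
  proof -
    have "\<bar>poly (\<Lambda> ([:1 - e, e:] ^ n)) x\<bar> \<le> (\<Sum>j\<le>n. C * (real (n choose j) * (e * x) ^ j * (1 - e) ^ (n - j)))"
      unfolding poly_\<Lambda>_power
    proof (rule order_trans[OF sum_abs], rule sum_mono)
      fix j
      define a where "a = real (n choose j) * (e * x) ^ j * (1 - e) ^ (n - j)"
      have a: "0 \<le> a" using ex by (simp add: a_def)
      have "real (n choose j) * e ^ j * (1 - e) ^ (n - j) / moment j * x ^ j = 1 / moment j * a"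
        by (simp add: a_def power_mult_distrib)
      moreover have "0 \<le> 1 / moment j" using moment_pos[of j] by simp
      ultimately show "\<bar>real (n choose j) * e ^ j * (1 - e) ^ (n - j) / moment j * x ^ j\<bar> \<le> C * a"
        using a C(2)[of j] by (simp only: abs_of_nonneg mult_nonneg_nonneg mult_right_mono)
    qed
    also have "\<dots> = C * (e * x + (1 - e)) ^ n"
      by (simp add: binomial_ring sum_distrib_left mult.assoc)
    also have "\<dots> \<le> C * (1 + x) ^ n"
    proof -
      have "e * x \<le> 1 * x" using ex by (intro mult_right_mono) auto
      then show ?thesis using ex C by (intro mult_left_mono power_mono) auto
    qed
    finally show ?thesis .
  qed
  then show ?thesis using C(1) by blast
qed

text \<open>Uniformity down to \<open>e = 0\<close>, that is \<open>t = \<infinity>\<close>, gives the long-time limit as well as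
  continuity in \<open>x\<close>.\<close>

lemma exp_image_uniform:
  "uniform_limit ({0..1} \<times> {0..R}) (\<lambda>N z. \<Sum>n<N. exp_image_term k n (fst z) (snd z))
    (\<lambda>z. exp_image k (fst z) (snd z)) sequentially"
proof -
  obtain C where C: "C > 0" "\<And>n e x. 0 \<le> e \<Longrightarrow> e \<le> 1 \<Longrightarrow> 0 \<le> x \<Longrightarrow> \<bar>poly (\<Lambda> ([:1 - e, e:] ^ n)) x\<bar> \<le> C * (1 + x) ^ n"
    using poly_\<Lambda>_power_bound by blast
  show ?thesis
    unfolding exp_image_def
  proof (rule Weierstrass_m_test)
    show "summable (\<lambda>n. C * (moment n * (real k * (1 + R)) ^ n / fact n))"
      by (intro summable_mult summable_moment_exp)
    fix n and z :: "real \<times> real" assume z: "z \<in> {0..1} \<times> {0..R}"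
    then have z: "0 \<le> fst z" "fst z \<le> 1" "0 \<le> snd z" "snd z \<le> R" by (auto simp: mem_Times_iff)
    have "norm (exp_image_term k n (fst z) (snd z))
      = real k ^ n * moment n / fact n * \<bar>poly (\<Lambda> ([:1 - fst z, fst z:] ^ n)) (snd z)\<bar>"
      using moment_pos[of n] by (simp add: exp_image_term_def abs_mult power_abs)
    also have "\<dots> \<le> real k ^ n * moment n / fact n * (C * (1 + R) ^ n)"
    proof (rule mult_left_mono)
      have "\<bar>poly (\<Lambda> ([:1 - fst z, fst z:] ^ n)) (snd z)\<bar> \<le> C * (1 + snd z) ^ n"
        by (rule C(2)[OF z(1-3)])
      also have "\<dots> \<le> C * (1 + R) ^ n"
        using z C(1) by (intro mult_left_mono power_mono) auto
      finally show "\<bar>poly (\<Lambda> ([:1 - fst z, fst z:] ^ n)) (snd z)\<bar> \<le> C * (1 + R) ^ n" .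
      show "0 \<le> real k ^ n * moment n / fact n" using moment_pos[of n] by simp
    qed
    also have "\<dots> = C * (moment n * (real k * (1 + R)) ^ n / fact n)"
      by (simp add: power_mult_distrib)
    finally show "norm (exp_image_term k n (fst z) (snd z)) \<le> C * (moment n * (real k * (1 + R)) ^ n / fact n)" .
  qed
qed

lemma exp_image_continuous: "continuous_on ({0..1} \<times> {0..R}) (\<lambda>z. exp_image k (fst z) (snd z))"
proof (rule uniform_limit_theorem[OF _ exp_image_uniform])
  show "eventually (\<lambda>N. continuous_on ({0..1} \<times> {0..R}) (\<lambda>z. \<Sum>n<N. exp_image_term k n (fst z) (snd z))) sequentially"
    unfolding exp_image_term_def poly_\<Lambda>_power by (intro always_eventually allI continuous_intros) auto
qed simp

lemma exp_image_continuous_on: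
  assumes e: "0 \<le> e" "e \<le> 1"
  shows "continuous_on {0..} (exp_image k e)"
  unfolding continuous_on_eq_continuous_within
proof
  fix x :: real assume x: "x \<in> {0..}"
  have "continuous_on {0..x + 1} (\<lambda>x. exp_image k (fst (e, x)) (snd (e, x)))"
    by (rule continuous_on_compose2[OF exp_image_continuous[of "x + 1"]]) (use e in \<open>auto intro!: continuous_intros\<close>)
  then have "continuous (at x within {0..x + 1}) (exp_image k e)"
    using x by (simp add: continuous_on_eq_continuous_within)
  moreover have "at x within {0..x + 1} = at x within {0..}"
    by (rule at_within_nhd[of x "{..<x + 1}"]) auto
  ultimately show "continuous (at x within {0..}) (exp_image k e)" by simp
qed

lemma exp_image_sums:
  assumes "0 \<le> e" "e \<le> 1" "0 \<le> x"
  shows "(\<lambda>N. \<Sum>n<N. exp_image_term k n e x) \<longlonglongrightarrow> exp_image k e x"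
  using tendsto_uniform_limitI[OF exp_image_uniform, of "(e, x)" x k] assms by simp

lemma exp_image_tendsto:
  assumes x: "0 \<le> x"
  shows "(\<lambda>n. exp_image k (exp (- real n)) x) \<longlonglongrightarrow> exp_image k 0 x"
proof -
  have "continuous_on {0..1} (\<lambda>e. exp_image k (fst (e, x)) (snd (e, x)))"
    by (rule continuous_on_compose2[OF exp_image_continuous[of x]]) (use x in \<open>auto intro!: continuous_intros\<close>)
  then have c: "continuous_on {0..1} (\<lambda>e. exp_image k e x)" by simp
  have "(\<lambda>n. exp (- real n)) \<longlonglongrightarrow> 0" by real_asymp
  then show ?thesis
    by (intro continuous_on_tendsto_compose[OF c]) auto
qed

lemma exp_image_0: "exp_image k 0 x = exp_image k 0 0"
proof -
  have "\<Lambda> ([:1 - 0, 0:] ^ n) = [:1:]" for n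
  proof -
    have "[:1 - 0, 0:] = (1 :: real poly)" by simp
    then have "[:1 - 0, 0:] ^ n = (1 :: real poly)" by (simp only: power_one)
    moreover have "\<Lambda> 1 = [:1:]"
      by (rule poly_eqI) (simp add: moment_0 coeff_pCons split: nat.split)
    ultimately show ?thesis by (simp only:)
  qed
  then show ?thesis by (simp add: exp_image_def exp_image_term_def)
qed

lemma transition_exp_taylor:
  "poly (transition e (exp_taylor (monom 1 k) N)) x = (\<Sum>n<N. exp_image_term k n e x)"
proof -
  have comp: "pcompose (monom c n) q = smult c (q ^ n)" for c n and q :: "real poly"
    by (simp add: poly_eq_poly_eq_iff[symmetric] fun_eq_iff poly_pcompose poly_monom)
  have "exp_taylor (monom 1 k) N = (\<Sum>n<N. monom ((- real k) ^ n / fact n) n)"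
  proof -
    have "exp_taylor (monom 1 k) N = (\<Sum>j\<le>k. if j = k then (\<Sum>n<N. monom ((- real k) ^ n / fact n) n) else 0)"
      unfolding exp_taylor_def degree_monom_eq[OF one_neq_zero] by (rule sum.cong) auto
    then show ?thesis by simp
  qed
  then have "transition e (exp_taylor (monom 1 k) N)
    = (\<Sum>n<N. \<Lambda> (smult (moment n * ((- real k) ^ n / fact n)) ([:1 - e, e:] ^ n)))"
    by (simp only: transition_sum) (simp add: transition_def \<Lambda>_inv_def rescale_monom comp)
  then show ?thesis
    by (simp add: poly_sum \<Lambda>_linear exp_image_term_def mult_ac)
qed

lemma extends_to_exp:
  assumes t: "0 \<le> t"
  shows "extends_to t (\<lambda>x. exp (- x) ^ k) (exp_image k (exp (- t)))"
proof -
  have e: "0 \<le> exp (- t)" "exp (- t) \<le> 1" using t by auto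
  have "extends_to t (\<lambda>x. poly (monom 1 k) (exp (- x))) (exp_image k (exp (- t)))"
  proof (rule extends_to_pointwise_limit[OF extends_to_poly[OF t] exp_taylor_L2(1) _ exp_taylor_L2(2)])
    show "exp_image k (exp (- t)) \<in> borel_measurable \<nu>"
      by (intro continuous_on_measurable_\<nu> exp_image_continuous_on e)
    show "AE x in \<nu>. (\<lambda>N. poly (transition (exp (- t)) (exp_taylor (monom 1 k) N)) x) \<longlonglongrightarrow> exp_image k (exp (- t)) x"
      unfolding transition_exp_taylor using e by (intro AE_I2 exp_image_sums) (auto simp: space_\<nu>)
  qed
  then show ?thesis by (simp add: poly_monom)
qed

lemma exp_image_bounds:
  assumes t: "0 \<le> t" and x: "0 \<le> x"
  shows "0 \<le> exp_image k (exp (- t)) x" "exp_image k (exp (- t)) x \<le> 1"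
proof -
  have c: "continuous_on {0..} (exp_image k (exp (- t)))"
    using t by (intro exp_image_continuous_on) auto
  show "0 \<le> exp_image k (exp (- t)) x"
    by (rule extends_to_mono[OF t extends_to_const[OF t] extends_to_exp[OF t] continuous_on_const c _ x]) simp
  show "exp_image k (exp (- t)) x \<le> 1"
    by (rule extends_to_mono[OF t extends_to_exp[OF t] extends_to_const[OF t] c continuous_on_const _ x])
       (simp add: power_le_one)
qed

text \<open>Chebyshev's inequality: under the kernel of \<open>P t\<close> at \<open>x\<close> the mean grows like \<open>exp (-t) x\<close>,
  the variance only linearly in \<open>x\<close>, so the mass escapes to infinity with \<open>x\<close>.\<close>

lemma exp_image_vanishes:
  assumes t: "0 \<le> t" and k: "0 < k"
  shows "(exp_image k (exp (- t)) \<longlongrightarrow> 0) at_top"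
proof -
  define e where "e = exp (- t)"
  define m1 m2 where "m1 = moment 1" and "m2 = moment 2"
  have e: "0 < e" "e \<le> 1" using t by (auto simp: e_def)
  have m: "m1 > 0" "m2 > 0" by (simp_all add: m1_def m2_def moment_pos)
  note \<Lambda> = \<Lambda>_quadratic[folded m1_def m2_def]
  have \<Lambda>i: "\<Lambda>_inv [:x, y, z:] = [:x, y * m1, z * m2:]" for x y z
    using \<Lambda>_inv_cubic[of x y z 0] by (simp add: m1_def m2_def)
  define mean where "mean x = m1 * (1 - e) + e * x" for x
  define var where "var x = (m2 - m1\<^sup>2) * (1 - e)\<^sup>2 + 2 * e * (1 - e) * (m2 / m1 - m1) * x" for x
  have variance: "poly (transition e [:(mean x)\<^sup>2, - 2 * mean x, 1:]) x = var x" for x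
  proof -
    have "pcompose [:a, b, c:] [:1 - e, e:] = [:a + b * (1 - e) + c * (1 - e)\<^sup>2, b * e + 2 * c * e * (1 - e), c * e\<^sup>2:]" for a b c
      by (simp add: pcompose_pCons power2_eq_square algebra_simps)
    then have "poly (transition e [:(mean x)\<^sup>2, - 2 * mean x, 1:]) x
      = (mean x)\<^sup>2 - 2 * mean x * m1 * (1 - e) + m2 * (1 - e)\<^sup>2
        + (- 2 * mean x * m1 * e + 2 * m2 * e * (1 - e)) / m1 * x + e\<^sup>2 * x\<^sup>2"
      unfolding transition_def \<Lambda>i using m by (simp add: \<Lambda> power2_eq_square algebra_simps)
    also have "\<dots> = var x"
      unfolding mean_def var_def using m by (simp add: field_simps power2_eq_square)
    finally show ?thesis .
  qed
  \<comment> \<open>For \<open>y \<ge> 0\<close> and \<open>L < m\<close> one has \<open>exp (- y) \<le> exp (- L) + (y - m)\<^sup>2 / (m - L)\<^sup>2\<close>; the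
    semigroup is applied to both sides with \<open>m\<close> fixed, and then \<open>m\<close> is taken to be the mean at \<open>x\<close>.\<close>
  have bound: "exp_image k e x \<le> exp (- L) + var x / (mean x - L)\<^sup>2"
    if x: "0 \<le> x" and L: "0 \<le> L" "L < mean x" for x L
  proof -
    define c where "c = 1 / (mean x - L)\<^sup>2"
    have c: "c > 0" using L by (simp add: c_def)
    define p where "p = [:(mean x)\<^sup>2, - 2 * mean x, 1:]"
    have p: "poly p y = (y - mean x)\<^sup>2" for y
      by (simp add: p_def power2_eq_square algebra_simps)
    have ext: "extends_to t (\<lambda>y. 1 * exp (- L) + c * poly p y) (\<lambda>y. 1 * exp (- L) + c * poly (transition e p) y)"
      unfolding e_def by (intro extends_to_lincomb extends_to_const extends_to_poly t)
    have "exp_image k e x \<le> 1 * exp (- L) + c * poly (transition e p) x"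
    proof (rule extends_to_mono[OF t extends_to_exp[OF t, of k, folded e_def] ext _ _ _ x])
      show "continuous_on {0..} (exp_image k e)" using e by (intro exp_image_continuous_on) auto
      fix y :: real assume y: "0 \<le> y"
      have "exp (- y) ^ k \<le> exp (- y) ^ 1"
        using k y by (intro power_decreasing) auto
      moreover have "exp (- y) \<le> 1 * exp (- L) + c * poly p y"
      proof (cases "L \<le> y")
        case True
        then have "exp (- y) \<le> exp (- L)" by simp
        moreover have "0 \<le> c * poly p y" using c by (simp add: p)
        ultimately show ?thesis by linarith
      next
        case False
        then have "(mean x - L)\<^sup>2 \<le> (mean x - y)\<^sup>2" using L by (intro power_mono) auto
        then have "1 \<le> c * poly p y"
          using L by (simp add: c_def p power2_commute[of y])
        moreover have "exp (- y) \<le> 1" using y by simp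
        moreover have "0 < exp (- L)" by simp
        ultimately show ?thesis by linarith
      qed
      ultimately show "exp (- y) ^ k \<le> 1 * exp (- L) + c * poly p y" by simp
    qed (intro continuous_intros)
    then show ?thesis unfolding p_def variance c_def by simp
  qed
  show ?thesis
    unfolding e_def[symmetric]
  proof (rule order_tendstoI)
    fix a :: real assume "a < 0"
    show "eventually (\<lambda>x. a < exp_image k e x) at_top"
      using eventually_ge_at_top[of 0]
      by eventually_elim (use exp_image_bounds(1)[OF t, of _ k] \<open>a < 0\<close> in \<open>fastforce simp: e_def\<close>)
  next
    fix a :: real assume a: "0 < a"
    define L where "L = max 0 (- ln (a / 2))"
    have L: "0 \<le> L" "exp (- L) \<le> a / 2"
    proof -
      have "exp (- L) \<le> exp (ln (a / 2))" unfolding exp_le_cancel_iff by (simp add: L_def)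
      then show "exp (- L) \<le> a / 2" using a by simp
    qed (simp add: L_def)
    have "((\<lambda>x. var x / (mean x - L)\<^sup>2) \<longlongrightarrow> 0) at_top"
      unfolding var_def mean_def using e(1) by real_asymp
    then have "eventually (\<lambda>x. var x / (mean x - L)\<^sup>2 < a / 2) at_top"
      using a by (intro order_tendstoD) auto
    moreover have "eventually (\<lambda>x. L < mean x) at_top"
      unfolding mean_def using e(1) by real_asymp
    ultimately show "eventually (\<lambda>x. exp_image k e x < a) at_top"
      using eventually_ge_at_top[of 0]
    proof eventually_elim
      case (elim x)
      then show ?case using bound[of x L] L by linarith
    qed
  qed
qed

text \<open>Linear combinations of \<open>exp (- k x)\<close>, \<open>k \<ge> 1\<close>, are uniformly dense in \<open>C\<^sub>0\<close>, and their images
  lie in \<open>C\<^sub>0\<close>.  By the bound on the supremum norm the images converge uniformly.\<close>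

theorem extends_to_C0:
  assumes t: "0 \<le> t" and f: "f \<in> C0_half_line"
  shows "\<exists>g\<in>C0_half_line. extends_to t f g"
proof -
  have "\<exists>r. \<forall>m. poly (r m) 0 = 0 \<and> (\<forall>x\<ge>0. \<bar>f x - poly (r m) (exp (- x))\<bar> < inverse (real (Suc m)))"
    using C0_half_line_exp_approx[OF f] by (intro choice allI) simp
  then obtain r where r0: "\<And>m. poly (r m) 0 = 0"
    and r: "\<And>m x. x \<ge> 0 \<Longrightarrow> \<bar>f x - poly (r m) (exp (- x))\<bar> < inverse (real (Suc m))" by blast
  define F where "F m x = poly (r m) (exp (- x))" for m x
  define G where "G m x = (\<Sum>k\<in>{1..degree (r m)}. coeff (r m) k * exp_image k (exp (- t)) x)" for m x
  have F: "F m = (\<lambda>x. \<Sum>k\<in>{1..degree (r m)}. coeff (r m) k * exp (- x) ^ k)" for m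
    by (rule ext) (simp only: F_def poly_eq_sum_pos_degree[OF r0])
  have FG: "extends_to t (F m) (G m)" for m
    unfolding F G_def by (intro extends_to_sum extends_to_exp t)
  have G0: "G m \<in> C0_half_line" for m
  proof -
    have "((\<lambda>x. G m x) \<longlongrightarrow> (\<Sum>k\<in>{1..degree (r m)}. coeff (r m) k * 0)) at_top"
      unfolding G_def by (intro tendsto_sum tendsto_mult tendsto_const exp_image_vanishes t) auto
    moreover have "continuous_on {0..} (G m)"
      unfolding G_def using t by (intro continuous_intros exp_image_continuous_on) auto
    ultimately show ?thesis by (simp add: C0_half_line_def)
  qed
  have Gc: "continuous_on {0..} (G m)" for m using G0 by (simp add: C0_half_line_def)
  have dist: "\<bar>G m x - G l x\<bar> \<le> inverse (real (Suc m)) + inverse (real (Suc l))" if x: "0 \<le> x" for m l x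
  proof (rule extends_to_sup_bound[OF t FG FG Gc Gc _ x])
    fix x :: real assume "0 \<le> x"
    then show "\<bar>F m x - F l x\<bar> \<le> inverse (real (Suc m)) + inverse (real (Suc l))"
      using r[of x m] r[of x l] unfolding F_def by linarith
  qed
  have inv: "(\<lambda>m. inverse (real (Suc m))) \<longlonglongrightarrow> 0" by (rule LIMSEQ_inverse_real_of_nat)
  define g where "g x = lim (\<lambda>m. G m x)" for x
  have Gg: "(\<lambda>m. G m x) \<longlonglongrightarrow> g x" if x: "0 \<le> x" for x
  proof -
    have "Cauchy (\<lambda>m. G m x)"
    proof (rule metric_CauchyI)
      fix \<epsilon> :: real assume "0 < \<epsilon>"
      then have "eventually (\<lambda>m. inverse (real (Suc m)) < \<epsilon> / 2) sequentially"
        using order_tendstoD(2)[OF inv, of "\<epsilon> / 2"] by simp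
      then obtain M where M: "\<And>m. m \<ge> M \<Longrightarrow> inverse (real (Suc m)) < \<epsilon> / 2"
        by (auto simp: eventually_sequentially)
      have "dist (G m x) (G l x) < \<epsilon>" if "m \<ge> M" "l \<ge> M" for m l
        using dist[OF x, of m l] M[OF that(1)] M[OF that(2)] unfolding dist_real_def by linarith
      then show "\<exists>M. \<forall>m\<ge>M. \<forall>l\<ge>M. dist (G m x) (G l x) < \<epsilon>" by blast
    qed
    then show ?thesis by (simp add: g_def Cauchy_convergent_iff convergent_LIMSEQ_iff)
  qed
  have close: "\<bar>G m x - g x\<bar> \<le> inverse (real (Suc m))" if x: "0 \<le> x" for m x
  proof (rule LIMSEQ_le)
    show "(\<lambda>l. \<bar>G m x - G l x\<bar>) \<longlonglongrightarrow> \<bar>G m x - g x\<bar>" by (intro tendsto_intros Gg x)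
    have "(\<lambda>l. inverse (real (Suc m)) + inverse (real (Suc l))) \<longlonglongrightarrow> inverse (real (Suc m)) + 0"
      by (intro tendsto_intros inv)
    then show "(\<lambda>l. inverse (real (Suc m)) + inverse (real (Suc l))) \<longlonglongrightarrow> inverse (real (Suc m))" by simp
  qed (use dist[OF x] in blast)
  have gc: "continuous_on {0..} g"
  proof (rule uniform_limit_theorem)
    show "uniform_limit {0..} G g sequentially"
    proof (rule uniform_limitI)
      fix \<epsilon> :: real assume "0 < \<epsilon>"
      with inv have "eventually (\<lambda>m. inverse (real (Suc m)) < \<epsilon>) sequentially" by (rule order_tendstoD)
      then show "eventually (\<lambda>m. \<forall>x\<in>{0..}. dist (G m x) (g x) < \<epsilon>) sequentially"
      proof eventually_elim
        case (elim m)
        then show ?case using close[of _ m] unfolding dist_real_def by (auto intro: le_less_trans)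
      qed
    qed
  qed (use Gc in auto)
  have g0: "(g \<longlongrightarrow> 0) at_top"
  proof (rule tendstoI)
    fix \<epsilon> :: real assume \<epsilon>: "0 < \<epsilon>"
    then obtain m where m: "inverse (real (Suc m)) < \<epsilon> / 2"
      using reals_Archimedean[of "\<epsilon> / 2"] by auto
    have "(G m \<longlongrightarrow> 0) at_top" using G0 by (simp add: C0_half_line_def)
    then have "eventually (\<lambda>x. dist (G m x) 0 < \<epsilon> / 2) at_top" using \<epsilon> by (intro tendstoD) auto
    then show "eventually (\<lambda>x. dist (g x) 0 < \<epsilon>) at_top"
      using eventually_ge_at_top[of 0]
    proof eventually_elim
      case (elim x)
      then show ?case using close[OF elim(2), of m] m by (simp add: dist_real_def)
    qed
  qed
  have gC: "g \<in> C0_half_line" using gc g0 by (simp add: C0_half_line_def)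
  have L2_lim: "(\<lambda>m. L2_dist \<nu> (H m) h) \<longlonglongrightarrow> 0"
    if H: "\<And>m. H m \<in> L2 \<nu>" "h \<in> L2 \<nu>" "\<And>m x. 0 \<le> x \<Longrightarrow> \<bar>H m x - h x\<bar> \<le> inverse (real (Suc m))" for H h
  proof (rule tendsto_sandwich[OF _ _ tendsto_const inv])
    have "L2_dist \<nu> (H m) h \<le> inverse (real (Suc m))" for m
      by (rule bounded_L2(2)[OF L2_measurable[OF L2_diff[OF H(1,2)]]]) (rule H(3))
    then show "eventually (\<lambda>m. L2_dist \<nu> (H m) h \<le> inverse (real (Suc m))) sequentially" by simp
  qed (simp add: L2_norm_nonneg)
  have "extends_to t f g"
  proof (rule extends_to_limit[OF FG C0_L2[OF f] C0_L2[OF gC]])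
    show "(\<lambda>m. L2_dist \<nu> (F m) f) \<longlonglongrightarrow> 0"
    proof (rule L2_lim[OF extends_toD(1)[OF FG] C0_L2[OF f]])
      show "\<bar>F m x - f x\<bar> \<le> inverse (real (Suc m))" if "0 \<le> x" for m x
        using r[OF that, of m] unfolding F_def by linarith
    qed
    show "(\<lambda>m. L2_dist \<nu> (G m) g) \<longlonglongrightarrow> 0"
      by (rule L2_lim[OF extends_toD(2)[OF FG] C0_L2[OF gC] close])
  qed
  then show ?thesis using gC by blast
qed

lemma exp_power_C0:
  assumes "0 < k"
  shows "(\<lambda>x. exp (- x) ^ k) \<in> C0_half_line"
proof -
  have "((\<lambda>x::real. exp (- x)) \<longlongrightarrow> 0) at_top" by real_asymp
  then have "((\<lambda>x::real. exp (- x) ^ k) \<longlongrightarrow> 0 ^ k) at_top" by (intro tendsto_intros)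
  then show ?thesis using assms by (auto simp: C0_half_line_def power_0_left intro!: continuous_intros)
qed

end

section \<open>Generator, asymmetry and invariant measures\<close>

context gauss_laguerre_parameters
begin

text \<open>Outside \<open>C\<^sub>0\<close> any representative will do; on \<open>C\<^sub>0\<close> the continuous one has to be taken, as
  an invariant measure may charge \<open>\<nu>\<close>-null sets.\<close>

definition gl_semigroup :: "real \<Rightarrow> (real \<Rightarrow> real) \<Rightarrow> (real \<Rightarrow> real)" where
  "gl_semigroup t f = (SOME g. extends_to t f g \<and> (f \<in> C0_half_line \<longrightarrow> g \<in> C0_half_line))"

lemma
  assumes t: "0 \<le> t" and f: "f \<in> L2 \<nu>"
  shows extends_to_gl_semigroup: "extends_to t f (gl_semigroup t f)"
    and semigroup_C0: "f \<in> C0_half_line \<Longrightarrow> gl_semigroup t f \<in> C0_half_line"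
proof -
  have "\<exists>g. extends_to t f g \<and> (f \<in> C0_half_line \<longrightarrow> g \<in> C0_half_line)"
    using extends_to_exists[OF t f] extends_to_C0[OF t] by blast
  then have "extends_to t f (gl_semigroup t f) \<and> (f \<in> C0_half_line \<longrightarrow> gl_semigroup t f \<in> C0_half_line)"
    unfolding gl_semigroup_def by (rule someI_ex)
  then show "extends_to t f (gl_semigroup t f)" "f \<in> C0_half_line \<Longrightarrow> gl_semigroup t f \<in> C0_half_line"
    by auto
qed

lemma semigroup_L2: "0 \<le> t \<Longrightarrow> f \<in> L2 \<nu> \<Longrightarrow> gl_semigroup t f \<in> L2 \<nu>"
  using extends_to_gl_semigroup extends_toD(2) by blast

lemma semigroup_AE:
  assumes "0 \<le> t" "extends_to t f g"
  shows "AE x in \<nu>. gl_semigroup t f x = g x"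
  by (rule extends_to_unique[OF extends_to_gl_semigroup[OF assms(1) extends_toD(1)[OF assms(2)]] assms(2)]) simp

lemma semigroup_poly_AE:
  "0 \<le> t \<Longrightarrow> AE x in \<nu>. gl_semigroup t (poly p) x = poly (transition (exp (- t)) p) x"
  by (intro semigroup_AE extends_to_poly)

lemma semigroup_strongly_continuous:
  assumes f: "f \<in> L2 \<nu>"
  shows "((\<lambda>t. L2_dist \<nu> (gl_semigroup t f) f) \<longlongrightarrow> 0) (at_right 0)"
proof (rule tendstoI)
  fix \<epsilon> :: real assume \<epsilon>: "0 < \<epsilon>"
  obtain p where p: "L2_dist \<nu> f (poly p) < \<epsilon> / 3"
    using polynomials_dense[OF f, of "\<epsilon> / 3"] \<epsilon> by auto
  have "eventually (\<lambda>t. L2_dist \<nu> (poly (transition (exp (- t)) p)) (poly p) < \<epsilon> / 3) (at_right 0)"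
    using order_tendstoD(2)[OF transition_strongly_continuous, of "\<epsilon> / 3"] \<epsilon> by simp
  then show "eventually (\<lambda>t. dist (L2_dist \<nu> (gl_semigroup t f) f) 0 < \<epsilon>) (at_right 0)"
    using eventually_at_right_less[of 0]
  proof eventually_elim
    case (elim t)
    let ?T = "poly (transition (exp (- t)) p)"
    have t: "0 \<le> t" using elim by simp
    note g = extends_to_gl_semigroup[OF t f]
    have "L2_dist \<nu> (gl_semigroup t f) f
      \<le> L2_dist \<nu> (gl_semigroup t f) ?T + L2_dist \<nu> ?T f"
      by (intro L2_norm_diff_triangle extends_toD[OF g] L2_poly)
    also have "L2_dist \<nu> ?T f \<le> L2_dist \<nu> ?T (poly p) + L2_dist \<nu> (poly p) f"
      by (intro L2_norm_diff_triangle f L2_poly)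
    also have "L2_dist \<nu> (gl_semigroup t f) ?T \<le> L2_dist \<nu> f (poly p)"
      by (rule extends_toD[OF g])
    finally have "L2_dist \<nu> (gl_semigroup t f) f < \<epsilon>"
      using p elim by (simp add: L2_dist_commute[of \<nu> "poly p"])
    then show ?case by (simp add: L2_norm_nonneg)
  qed
qed

theorem semigroup_contraction: "L2_contraction_semigroup \<nu> gl_semigroup"
  unfolding L2_contraction_semigroup_def L2_linear_operator_def
proof (intro conjI allI impI ballI)
  fix t :: real and f g assume t: "0 \<le> t" and f: "f \<in> L2 \<nu>" and g: "g \<in> L2 \<nu>" and "AE x in \<nu>. f x = g x"
  then show "AE x in \<nu>. gl_semigroup t f x = gl_semigroup t g x"
    by (intro extends_to_unique[OF extends_to_gl_semigroup extends_to_gl_semigroup])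
next
  fix t :: real and f g a b assume t: "0 \<le> t" and f: "f \<in> L2 \<nu>" and g: "g \<in> L2 \<nu>"
  show "AE x in \<nu>. gl_semigroup t (\<lambda>y. a * f y + b * g y) x = a * gl_semigroup t f x + b * gl_semigroup t g x"
    by (intro semigroup_AE extends_to_lincomb extends_to_gl_semigroup t f g)
next
  fix f assume "f \<in> L2 \<nu>"
  then show "AE x in \<nu>. gl_semigroup 0 f x = f x" by (intro semigroup_AE extends_to_0) auto
next
  fix s t :: real and f assume s: "0 \<le> s" and t: "0 \<le> t" and f: "f \<in> L2 \<nu>"
  show "AE x in \<nu>. gl_semigroup (s + t) f x = gl_semigroup s (gl_semigroup t f) x"
    using s t f
    by (intro semigroup_AE extends_to_semigroup[of t f "gl_semigroup t f"]
        extends_to_gl_semigroup semigroup_L2) auto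
qed (auto intro: semigroup_L2 extends_to_norm_le extends_to_gl_semigroup semigroup_strongly_continuous)

theorem semigroup_markov: "L2_markov \<nu> gl_semigroup"
  unfolding L2_markov_def
proof (intro conjI allI impI ballI)
  fix t :: real and f assume "0 \<le> t" "f \<in> L2 \<nu>" "AE x in \<nu>. 0 \<le> f x"
  then show "AE x in \<nu>. 0 \<le> gl_semigroup t f x"
    by (intro extends_to_nonneg[OF _ extends_to_gl_semigroup])
qed (intro semigroup_AE extends_to_const)

lemma generator_graph_poly: "L2_generator_graph \<nu> gl_semigroup (poly p) (poly (generator p))"
  unfolding L2_generator_graph_def
proof (intro conjI L2_poly)
  show "((\<lambda>t. L2_norm \<nu> (\<lambda>x. (gl_semigroup t (poly p) x - poly p x) / t - poly (generator p) x)) \<longlongrightarrow> 0) (at_right 0)"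
  proof (rule Lim_transform_eventually[OF transition_derivative_L2])
    show "eventually (\<lambda>t. L2_norm \<nu> (\<lambda>x. (poly (transition (exp (- t)) p) x - poly p x) / t - poly (generator p) x)
      = L2_norm \<nu> (\<lambda>x. (gl_semigroup t (poly p) x - poly p x) / t - poly (generator p) x)) (at_right 0)"
      using eventually_at_right_less[of 0]
    proof eventually_elim
      case (elim t)
      then have t: "0 \<le> t" by simp
      have [measurable]: "poly q \<in> borel_measurable \<nu>" "gl_semigroup t (poly p) \<in> borel_measurable \<nu>" for q
        by (intro L2_measurable[OF L2_poly] L2_measurable[OF semigroup_L2[OF t L2_poly]])+
      show ?case
      proof (rule L2_norm_cong_AE)
        show "AE x in \<nu>. (poly (transition (exp (- t)) p) x - poly p x) / t - poly (generator p) x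
          = (gl_semigroup t (poly p) x - poly p x) / t - poly (generator p) x"
          using semigroup_poly_AE[OF t, of p] by eventually_elim simp
      qed measurable
    qed
  qed
qed

text \<open>A graph element \<open>(f, h)\<close> is approximated by solving \<open>(1 - generator) p = q\<close> for a
  polynomial \<open>q\<close> close to \<open>f - h\<close>: by dissipativity \<open>p\<close> is then close to \<open>f\<close>.\<close>

theorem semigroup_core:
  "L2_generator_with_core \<nu> gl_semigroup (gauss_laguerre \<alpha> \<beta>) polynomial_functions"
proof -
  have gl: "gauss_laguerre \<alpha> \<beta> (poly p) = poly (generator p)" for p
    by (rule ext) (rule gauss_laguerre_poly)
  have "\<exists>p. L2_dist \<nu> f (poly p) < \<epsilon> \<and> L2_dist \<nu> h (poly (generator p)) < \<epsilon>"
    if fh: "L2_generator_graph \<nu> gl_semigroup f h" and \<epsilon>: "0 < \<epsilon>" for f h \<epsilon>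
  proof -
    have f: "f \<in> L2 \<nu>" and h: "h \<in> L2 \<nu>"
      and lim: "((\<lambda>t. L2_norm \<nu> (\<lambda>x. (gl_semigroup t f x - f x) / t - h x)) \<longlongrightarrow> 0) (at_right 0)"
      using fh by (auto simp: L2_generator_graph_def)
    obtain q where q: "L2_norm \<nu> (\<lambda>x. (f x - h x) - poly q x) < \<epsilon> / 2"
      using polynomials_dense[OF L2_diff[OF f h], of "\<epsilon> / 2"] \<epsilon> by auto
    obtain p where p: "p - generator p = q" using one_minus_generator_surjective by blast
    have qx: "poly q x = poly p x - poly (generator p) x" for x by (simp flip: p)
    define u v where "u x = f x - poly p x" and "v x = h x - poly (generator p) x" for x
    have u: "u \<in> L2 \<nu>" and v: "v \<in> L2 \<nu>" unfolding u_def v_def by (intro L2_diff f h L2_poly)+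
    have graph: "L2_generator_graph \<nu> gl_semigroup u v"
    proof -
      let ?D = "\<lambda>f h t x. (gl_semigroup t f x - f x) / t - h x"
      have "((\<lambda>t. L2_norm \<nu> (?D f h t) + L2_norm \<nu> (?D (poly p) (poly (generator p)) t)) \<longlongrightarrow> 0 + 0) (at_right 0)"
        using generator_graph_poly[of p] by (intro tendsto_add lim) (simp add: L2_generator_graph_def)
      then have upper: "((\<lambda>t. L2_norm \<nu> (?D f h t) + L2_norm \<nu> (?D (poly p) (poly (generator p)) t)) \<longlongrightarrow> 0) (at_right 0)"
        by simp
      have "eventually (\<lambda>t. L2_norm \<nu> (?D u v t) \<le> L2_norm \<nu> (?D f h t) + L2_norm \<nu> (?D (poly p) (poly (generator p)) t)) (at_right 0)"
        using eventually_at_right_less[of 0]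
      proof eventually_elim
        case (elim t)
        then have t: "0 \<le> t" by simp
        have D: "?D f h t \<in> L2 \<nu>" if "f \<in> L2 \<nu>" "h \<in> L2 \<nu>" for f h
          using L2_diff[OF L2_cmult[OF L2_diff[OF semigroup_L2[OF t that(1)] that(1)], of "1 / t"] that(2)] by simp
        have "extends_to t (\<lambda>x. 1 * f x + (-1) * poly p x) (\<lambda>x. 1 * gl_semigroup t f x + (-1) * gl_semigroup t (poly p) x)"
          by (intro extends_to_lincomb t extends_to_gl_semigroup f L2_poly)
        from semigroup_AE[OF t this]
        have "AE x in \<nu>. gl_semigroup t u x = gl_semigroup t f x - gl_semigroup t (poly p) x"
          by (simp add: u_def[abs_def])
        then have "AE x in \<nu>. ?D u v t x = ?D f h t x - ?D (poly p) (poly (generator p)) t x"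
          by eventually_elim (simp add: u_def v_def diff_divide_distrib)
        then have "L2_norm \<nu> (?D u v t) = L2_dist \<nu> (?D f h t) (?D (poly p) (poly (generator p)) t)"
          by (intro L2_norm_cong_AE L2_measurable[OF D[OF u v]] L2_measurable[OF L2_diff[OF D[OF f h] D[OF L2_poly L2_poly]]])
        also have "\<dots> = L2_norm \<nu> (\<lambda>x. ?D f h t x + (-1) * ?D (poly p) (poly (generator p)) t x)"
          by (rule arg_cong[of _ _ "L2_norm \<nu>"]) (rule ext, simp)
        also have "\<dots> \<le> L2_norm \<nu> (?D f h t) + L2_norm \<nu> (\<lambda>x. (-1) * ?D (poly p) (poly (generator p)) t x)"
          by (rule L2_norm_triangle[OF D[OF f h] L2_cmult[OF D[OF L2_poly L2_poly]]])
        finally show ?case unfolding L2_norm_cmult by simp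
      qed
      then have "((\<lambda>t. L2_norm \<nu> (?D u v t)) \<longlongrightarrow> 0) (at_right 0)"
        by (rule tendsto_sandwich[rotated, OF _ tendsto_const upper]) (simp add: L2_norm_nonneg)
      then show ?thesis using u v by (simp add: L2_generator_graph_def)
    qed
    have uv: "(\<lambda>x. u x - v x) = (\<lambda>x. (f x - h x) - poly q x)"
      by (auto simp: u_def v_def qx)
    have "L2_norm \<nu> u \<le> L2_dist \<nu> u v"
      by (rule generator_dissipative[OF _ _ graph])
         (auto intro: semigroup_L2 u extends_to_norm_le[OF extends_to_gl_semigroup])
    then have nu: "L2_norm \<nu> u < \<epsilon> / 2" using q unfolding uv by simp
    have "L2_norm \<nu> v = L2_norm \<nu> (\<lambda>x. u x + (-1) * (u x - v x))" by simp
    also have "\<dots> \<le> L2_norm \<nu> u + L2_norm \<nu> (\<lambda>x. (-1) * (u x - v x))"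
      by (intro L2_norm_triangle u L2_cmult L2_diff v)
    finally have "L2_norm \<nu> v < \<epsilon>" using nu q unfolding L2_norm_cmult uv by simp
    with nu \<epsilon> show ?thesis unfolding u_def[abs_def] v_def[abs_def] by (intro exI[of _ p]) auto
  qed
  then show ?thesis
    using generator_graph_poly
    unfolding L2_generator_with_core_def polynomial_functions_def by (fastforce simp: gl)
qed

theorem semigroup_not_self_adjoint: "\<not> L2_self_adjoint_semigroup \<nu> gl_semigroup"
proof
  assume sa: "L2_self_adjoint_semigroup \<nu> gl_semigroup"
  obtain p q where pq: "(LINT x|\<nu>. poly (transition (exp (- 1)) p) x * poly q x)
    \<noteq> (LINT x|\<nu>. poly p x * poly (transition (exp (- 1)) q) x)"
    using transition_not_symmetric[of "exp (- 1)"] by auto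
  have [measurable]: "poly p \<in> borel_measurable \<nu>" "gl_semigroup 1 (poly p) \<in> borel_measurable \<nu>" for p
    by (intro L2_measurable[OF L2_poly] L2_measurable[OF semigroup_L2[OF _ L2_poly]]; simp)+
  have "L2_inner \<nu> (gl_semigroup 1 (poly p)) (poly q) = L2_inner \<nu> (poly p) (gl_semigroup 1 (poly q))"
    using sa L2_poly by (simp add: L2_self_adjoint_semigroup_def)
  moreover have "L2_inner \<nu> (gl_semigroup 1 (poly p)) (poly q) = (LINT x|\<nu>. poly (transition (exp (- 1)) p) x * poly q x)"
    unfolding L2_inner_def using semigroup_poly_AE[of 1 p]
    by (intro integral_cong_AE) (auto elim!: eventually_mono)
  moreover have "L2_inner \<nu> (poly p) (gl_semigroup 1 (poly q)) = (LINT x|\<nu>. poly p x * poly (transition (exp (- 1)) q) x)"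
    unfolding L2_inner_def using semigroup_poly_AE[of 1 q]
    by (intro integral_cong_AE) (auto elim!: eventually_mono)
  ultimately show False using pq by simp
qed

theorem semigroup_preserves_C0: "preserves_C0 gl_semigroup"
  by (auto simp: preserves_C0_def intro: semigroup_C0 C0_L2)

theorem semigroup_invariant: "invariant_measure gl_semigroup \<nu>"
  unfolding invariant_measure_def
  by (intro conjI allI impI ballI prob_space_axioms sets_\<nu>
      extends_to_integral[OF extends_to_gl_semigroup[OF _ C0_L2]])

text \<open>As \<open>t \<rightarrow> \<infinity>\<close>, the images of \<open>exp (- k x)\<close> converge pointwise to constants, so every
  invariant measure integrates these functions to the same values.\<close>

lemma invariant_measure_exp:
  assumes \<mu>: "invariant_measure gl_semigroup \<mu>" and k: "0 < k"
  shows "(LINT x|\<mu>. exp (- x) ^ k) = exp_image k 0 0"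
proof -
  interpret \<mu>: prob_space \<mu> using \<mu> by (simp add: invariant_measure_def)
  have sets: "sets \<mu> = sets (restrict_space borel {0..})" using \<mu> by (simp add: invariant_measure_def)
  note space = space_half_line[OF sets] and meas = continuous_on_measurable_half_line[OF sets]
  have const: "(LINT x|\<mu>. exp_image k (exp (- real n)) x) = (LINT x|\<mu>. exp (- x) ^ k)" for n
  proof -
    have "exp_image k (exp (- real n)) x = gl_semigroup (real n) (\<lambda>x. exp (- x) ^ k) x" if "0 \<le> x" for x
    proof (rule continuous_AE_eq_imp_eq[OF _ _ _ that])
      show "continuous_on {0..} (exp_image k (exp (- real n)))" by (intro exp_image_continuous_on) auto
      show "continuous_on {0..} (gl_semigroup (real n) (\<lambda>x. exp (- x) ^ k))"
        using semigroup_C0[OF _ C0_L2[OF exp_power_C0[OF k]] exp_power_C0[OF k], of "real n"]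
        by (simp add: C0_half_line_def)
      have "AE x in \<nu>. gl_semigroup (real n) (\<lambda>x. exp (- x) ^ k) x = exp_image k (exp (- real n)) x"
        by (intro semigroup_AE extends_to_exp) auto
      then show "AE x in \<nu>. exp_image k (exp (- real n)) x = gl_semigroup (real n) (\<lambda>x. exp (- x) ^ k) x"
        by eventually_elim simp
    qed
    then have "(LINT x|\<mu>. exp_image k (exp (- real n)) x) = (LINT x|\<mu>. gl_semigroup (real n) (\<lambda>x. exp (- x) ^ k) x)"
      using space by (intro Bochner_Integration.integral_cong) auto
    also have "\<dots> = (LINT x|\<mu>. exp (- x) ^ k)"
      using \<mu> exp_power_C0[OF k] by (simp add: invariant_measure_def)
    finally show ?thesis .
  qed
  have "(\<lambda>n. LINT x|\<mu>. exp_image k (exp (- real n)) x) \<longlonglongrightarrow> (LINT x|\<mu>. exp_image k 0 x)"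
  proof (rule integral_dominated_convergence[where w = "\<lambda>_. 1"])
    show "exp_image k 0 \<in> borel_measurable \<mu>" by (intro meas exp_image_continuous_on) auto
    show "exp_image k (exp (- real n)) \<in> borel_measurable \<mu>" for n by (intro meas exp_image_continuous_on) auto
    show "AE x in \<mu>. (\<lambda>n. exp_image k (exp (- real n)) x) \<longlonglongrightarrow> exp_image k 0 x"
      using exp_image_tendsto by (intro AE_I2) (simp add: space)
    show "AE x in \<mu>. norm (exp_image k (exp (- real n)) x) \<le> 1" for n
      using exp_image_bounds[of "real n"] by (intro AE_I2) (simp add: space)
  qed simp
  then have "(LINT x|\<mu>. exp (- x) ^ k) = (LINT x|\<mu>. exp_image k 0 x)"
    unfolding const by (simp add: LIMSEQ_const_iff)
  also have "\<dots> = (LINT x|\<mu>. exp_image k 0 0)"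
    by (rule Bochner_Integration.integral_cong[OF refl exp_image_0])
  also have "\<dots> = exp_image k 0 0" by (simp add: \<mu>.prob_space)
  finally show ?thesis .
qed

text \<open>Integrals of functions in \<open>C\<^sub>0\<close> are determined by those of \<open>exp (- k x)\<close>, \<open>k \<ge> 1\<close>, by uniform
  approximation.\<close>

theorem invariant_measure_unique:
  assumes \<mu>: "invariant_measure gl_semigroup \<mu>"
  shows "\<mu> = \<nu>"
proof (rule prob_space_half_line_eqI)
  have inv: "prob_space \<mu>'" "sets \<mu>' = sets (restrict_space borel {0..})"
    if "invariant_measure gl_semigroup \<mu>'" for \<mu>'
    using that by (auto simp: invariant_measure_def)
  show "prob_space \<mu>" "prob_space \<nu>" "sets \<mu> = sets (restrict_space borel {0..})" "sets \<nu> = sets (restrict_space borel {0..})"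
    using inv[OF \<mu>] inv[OF semigroup_invariant] by auto
  fix f assume f: "f \<in> C0_half_line"
  have approx: "\<bar>(LINT x|\<mu>'. f x) - (\<Sum>k\<in>{1..degree r}. coeff r k * exp_image k 0 0)\<bar> \<le> \<epsilon>"
    if \<mu>': "invariant_measure gl_semigroup \<mu>'" and r: "poly r 0 = 0" "\<And>x. 0 \<le> x \<Longrightarrow> \<bar>f x - poly r (exp (- x))\<bar> < \<epsilon>"
    for \<mu>' r \<epsilon>
  proof -
    interpret \<mu>': prob_space \<mu>' by (rule inv[OF \<mu>'])
    note sets = inv(2)[OF \<mu>']
    note space = space_half_line[OF sets]
    have int: "integrable \<mu>' g" if g: "g \<in> C0_half_line" for g
    proof -
      obtain B where "\<And>x. 0 \<le> x \<Longrightarrow> \<bar>g x\<bar> \<le> B" using C0_half_line_bounded[OF g] by blast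
      moreover have "g \<in> borel_measurable \<mu>'"
        using g by (intro continuous_on_measurable_half_line[OF sets]) (simp add: C0_half_line_def)
      ultimately show ?thesis
        by (intro \<mu>'.integrable_const_bound[where B = B]) (auto intro!: AE_I2 simp: space)
    qed
    note eq = poly_eq_sum_pos_degree[OF r(1)]
    have int_exp: "integrable \<mu>' (\<lambda>x. coeff r k * exp (- x) ^ k)" if "k \<in> {1..degree r}" for k
      using that by (intro integrable_mult_right int exp_power_C0) auto
    have int_r: "integrable \<mu>' (\<lambda>x. poly r (exp (- x)))"
      unfolding eq by (intro Bochner_Integration.integrable_sum int_exp)
    have "(LINT x|\<mu>'. poly r (exp (- x))) = (\<Sum>k\<in>{1..degree r}. coeff r k * exp_image k 0 0)"
    proof -
      have "(LINT x|\<mu>'. poly r (exp (- x))) = (\<Sum>k\<in>{1..degree r}. LINT x|\<mu>'. coeff r k * exp (- x) ^ k)"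
        unfolding eq by (intro Bochner_Integration.integral_sum int_exp)
      also have "\<dots> = (\<Sum>k\<in>{1..degree r}. coeff r k * exp_image k 0 0)"
        by (intro sum.cong refl) (simp add: invariant_measure_exp[OF \<mu>'])
      finally show ?thesis .
    qed
    then have "(LINT x|\<mu>'. f x) - (\<Sum>k\<in>{1..degree r}. coeff r k * exp_image k 0 0)
      = (LINT x|\<mu>'. f x - poly r (exp (- x)))"
      using int[OF f] int_r by simp
    also have "\<bar>\<dots>\<bar> \<le> (LINT x|\<mu>'. \<epsilon>)"
    proof (rule order_trans[OF integral_abs_bound integral_mono])
      show "integrable \<mu>' (\<lambda>x. \<bar>f x - poly r (exp (- x))\<bar>)"
        using int[OF f] int_r by (intro integrable_abs Bochner_Integration.integrable_diff)
    qed (use r(2) in \<open>auto simp: space less_imp_le\<close>)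
    finally show ?thesis by (simp add: \<mu>'.prob_space)
  qed
  have "\<bar>(LINT x|\<mu>. f x) - (LINT x|\<nu>. f x)\<bar> \<le> 0 + \<epsilon>" if \<epsilon>: "0 < \<epsilon>" for \<epsilon>
  proof -
    obtain r :: "real poly" where r: "poly r 0 = 0" "\<And>x. 0 \<le> x \<Longrightarrow> \<bar>f x - poly r (exp (- x))\<bar> < \<epsilon> / 2"
      using C0_half_line_exp_approx[OF f, of "\<epsilon> / 2"] \<epsilon> by auto
    show ?thesis
      using approx[OF \<mu> r] approx[OF semigroup_invariant r] by linarith
  qed
  then have "\<bar>(LINT x|\<mu>. f x) - (LINT x|\<nu>. f x)\<bar> \<le> 0" by (rule field_le_epsilon)
  then show "(LINT x|\<mu>. f x) = (LINT x|\<nu>. f x)" by simp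
qed

end

theorem theorem1p1:
  fixes \<alpha> \<beta> :: real
  assumes "0 < \<alpha>" and "\<alpha> < 1" and "1 - 1 / \<alpha> \<le> \<beta>"
  shows "\<exists>P :: real \<Rightarrow> (real \<Rightarrow> real) \<Rightarrow> (real \<Rightarrow> real).
    L2_contraction_semigroup (gl_measure \<alpha> \<beta>) P \<and>
    L2_markov (gl_measure \<alpha> \<beta>) P \<and>
    L2_generator_with_core (gl_measure \<alpha> \<beta>) P (gauss_laguerre \<alpha> \<beta>) polynomial_functions \<and>
    \<not> L2_self_adjoint_semigroup (gl_measure \<alpha> \<beta>) P \<and>
    preserves_C0 P \<and>
    invariant_measure P (gl_measure \<alpha> \<beta>) \<and>
    (\<forall>\<nu>. invariant_measure P \<nu> \<longrightarrow> \<nu> = gl_measure \<alpha> \<beta>)"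
proof -
  interpret gauss_laguerre_parameters \<alpha> \<beta>
    by standard (fact assms)+
  show ?thesis
    using semigroup_contraction semigroup_markov semigroup_core semigroup_not_self_adjoint
      semigroup_preserves_C0 semigroup_invariant invariant_measure_unique
    by blast
qed

end
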